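(* Let $K\in\mathcal{K}_N$ have charged sparsity graph $G=([N],E,\epsilon)$, and suppose that the simple cycle sparsity $\ell_+$ of $\mathcal{C}^+(G)$ satisfies $\ell_+\ge 3$. Then: (1) any matrix $K'\in\mathcal{K}_N$ with $\Delta_S(K)=\Delta_S(K')$ for all $S\subseteq[N]$ with $|S|\le \ell_+$ also satisfies $\Delta_S(K)=\Delta_S(K')$ for all $S\subseteq[N]$; and (2) there exists a matrix $\hat K\in\mathcal{K}_N$ with $\Delta_S(\hat K)=\Delta_S(K)$ for all $S\subseteq[N]$ with $|S|<\ell_+$, but $\Delta_S(\hat K)\ne\Delta_S(K)$ for some $S\subseteq[N]$ with $|S|=\ell_+$.
   Context: $[N]=\{1,\dots,N\}$. For $K\in\mathbb{R}^{N\times N}$ and $S\subseteq[N]$, $\Delta_S(K)=\det (K_{i,j})_{i,j\in S}$ is the principal minor associated with $S$ ($\Delta_\emptyset=1$). $K$ is magnitude-symmetric if $|K_{i,j}|=|K_{j,i}|$ for all $i,j\in[N]$. $\mathcal{K}_N$ is the set of magnitude-symmetric $K\in\mathbb{R}^{N\times N}$ satisfying the following genericity condition: whenever $K_{i,j}K_{j,k}K_{k,\ell}K_{\ell,i}\neq 0$ for distinct $i,j,k,\ell\in[N]$, then (a) $|K_{i,j}K_{k,\ell}|\ne|K_{j,k}K_{\ell,i}|$, and (b) for all $\phi_1,\phi_2,\phi_3\in\{-1,1\}$, $\phi_1K_{i,j}K_{j,k}K_{k,\ell}K_{\ell,i}+\phi_2K_{i,j}K_{j,\ell}K_{\ell,k}K_{k,i}+\phi_3K_{i,k}K_{k,j}K_{j,\ell}K_{\ell,i}\ne0$.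 All graphs are finite, simple and undirected. A charged graph $G=([N],E,\epsilon)$ is a graph with a function $\epsilon:E\to\{-1,+1\}$, extended to subgraphs by $\epsilon(H)=\prod_{e\in E(H)}\epsilon(e)$; $H$ is positive (negative) if $\epsilon(H)=+1$ ($-1$). The charged sparsity graph of a magnitude-symmetric $K$ has edge set $E=\{\{i,j\}: i\neq j,\ K_{i,j}\ne0\}$ and $\epsilon(\{i,j\})=\mathrm{sgn}(K_{i,j}K_{j,i})$. A cycle of $G$ is a subgraph in which every vertex has even degree (possibly disconnected); a simple cycle is a connected subgraph in which every vertex has degree two; the length $|C|$ of a cycle is its number of edges. For a subgraph $H$, $\chi_H\in \mathrm{GF}(2)^{E}$ is the incidence vector of its edge set. $\mathcal{C}^+(G)=\{\chi_C: C\text{ is a cycle of }G,\ \epsilon(C)=+1\}$, a linear subspace of $\mathrm{GF}(2)^E$. A graph is two-connected if it is connected, has at least two vertices, and has no articulation point (vertex whose removal disconnects the graph). A block of $G$ is a maximal two-connected subgraph; a block with two vertices is trivial. The simple cycle sparsity $\ell_+$ of $\mathcal{C}^+(G)$, for $G$ two-connected, is the smallest number such that the incidence vectors of positive simple cycles of length at most $\ell_+$ span $\mathcal{C}^+(G)$. If $G$ is not two-connected, $\ell_+$ is the maximum of the simple cycle sparsities of $\mathcal{C}^+(H)$ over all blocks $H$ of $G$ (with $\epsilon$ restricted to $H$). If $G$ is a trivial block or contains no blocks, $\ell_+=2$. *)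

theory Defs
  imports
    "Jordan_Normal_Form.Determinant"
    "Jordan_Normal_Form.DL_Submatrix"
    "HOL-Library.Z2"
    "HOL-Library.Function_Algebras"
begin

section \<open>Matrices and principal minors\<close>

text \<open>Matrices are zero-based, so the index set \<open>[N]\<close> is \<open>{..<N}\<close> throughout.
  For \<open>S = {}\<close> the submatrix is the \<open>0 \<times> 0\<close> matrix, whose determinant is \<open>1\<close>.\<close>

definition principal_minor :: "nat set \<Rightarrow> real mat \<Rightarrow> real" where
  "principal_minor S K = det (submatrix K S S)"

definition magnitude_symmetric :: "nat \<Rightarrow> real mat \<Rightarrow> bool" where
  "magnitude_symmetric N K \<longleftrightarrow> (\<forall>i<N. \<forall>j<N. \<bar>K $$ (i,j)\<bar> = \<bar>K $$ (j,i)\<bar>)"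

definition generic_entries :: "nat \<Rightarrow> real mat \<Rightarrow> bool" where
  "generic_entries N K \<longleftrightarrow>
    (\<forall>i<N. \<forall>j<N. \<forall>k<N. \<forall>l<N.
      distinct [i, j, k, l] \<and> K $$ (i,j) * K $$ (j,k) * K $$ (k,l) * K $$ (l,i) \<noteq> 0 \<longrightarrow>
        \<bar>K $$ (i,j) * K $$ (k,l)\<bar> \<noteq> \<bar>K $$ (j,k) * K $$ (l,i)\<bar> \<and>
        (\<forall>\<phi>1\<in>{-1,1}. \<forall>\<phi>2\<in>{-1,1}. \<forall>\<phi>3\<in>{-1,1}.
            \<phi>1 * K $$ (i,j) * K $$ (j,k) * K $$ (k,l) * K $$ (l,i)
          + \<phi>2 * K $$ (i,j) * K $$ (j,l) * K $$ (l,k) * K $$ (k,i)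
          + \<phi>3 * K $$ (i,k) * K $$ (k,j) * K $$ (j,l) * K $$ (l,i) \<noteq> 0))"

definition generic_magnitude_symmetric :: "nat \<Rightarrow> real mat set" where
  "generic_magnitude_symmetric N =
    {K \<in> carrier_mat N N. magnitude_symmetric N K \<and> generic_entries N K}"

section \<open>Finite simple graphs\<close>

text \<open>A graph is a pair of a vertex set and a set of two-element sets of vertices.\<close>

type_synonym 'a graph = "'a set \<times> 'a set set"

abbreviation verts :: "'a graph \<Rightarrow> 'a set" where "verts G \<equiv> fst G"
abbreviation edges :: "'a graph \<Rightarrow> 'a set set" where "edges G \<equiv> snd G"

definition simple_graph :: "'a graph \<Rightarrow> bool" where
  "simple_graph G \<longleftrightarrow> finite (verts G) \<and> (\<forall>e\<in>edges G. e \<subseteq> verts G \<and> card e = 2)"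

definition is_subgraph :: "'a graph \<Rightarrow> 'a graph \<Rightarrow> bool" where
  "is_subgraph H G \<longleftrightarrow> simple_graph H \<and> verts H \<subseteq> verts G \<and> edges H \<subseteq> edges G"

definition degree_in :: "'a graph \<Rightarrow> 'a \<Rightarrow> nat" where
  "degree_in G v = card {e \<in> edges G. v \<in> e}"

text \<open>The graph without vertices counts as disconnected.\<close>

definition connected_graph :: "'a graph \<Rightarrow> bool" where
  "connected_graph G \<longleftrightarrow>
    verts G \<noteq> {} \<and> (\<forall>u\<in>verts G. \<forall>v\<in>verts G. (u, v) \<in> {(x, y). {x, y} \<in> edges G}\<^sup>*)"

definition remove_vertex :: "'a graph \<Rightarrow> 'a \<Rightarrow> 'a graph" where
  "remove_vertex G v = (verts G - {v}, {e \<in> edges G. v \<notin> e})"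

definition articulation_point :: "'a graph \<Rightarrow> 'a \<Rightarrow> bool" where
  "articulation_point G v \<longleftrightarrow> v \<in> verts G \<and> \<not> connected_graph (remove_vertex G v)"

definition two_connected :: "'a graph \<Rightarrow> bool" where
  "two_connected G \<longleftrightarrow>
    connected_graph G \<and> card (verts G) \<ge> 2 \<and> (\<nexists>v. articulation_point G v)"

definition blocks :: "'a graph \<Rightarrow> 'a graph set" where
  "blocks G = {H. is_subgraph H G \<and> two_connected H \<and>
    (\<forall>H'. is_subgraph H' G \<and> two_connected H' \<and> is_subgraph H H' \<longrightarrow> H' = H)}"

definition trivial_block :: "'a graph \<Rightarrow> bool" where
  "trivial_block H \<longleftrightarrow> two_connected H \<and> card (verts H) = 2"

definition cycles :: "'a graph \<Rightarrow> 'a graph set" where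
  "cycles G = {C. is_subgraph C G \<and> (\<forall>v\<in>verts C. even (degree_in C v))}"

definition simple_cycles :: "'a graph \<Rightarrow> 'a graph set" where
  "simple_cycles G =
    {C. is_subgraph C G \<and> connected_graph C \<and> (\<forall>v\<in>verts C. degree_in C v = 2)}"

section \<open>Charges and simple cycle sparsity\<close>

text \<open>A charged graph is given by a graph \<open>G\<close> and a function \<open>\<epsilon>\<close> of which only the
  values on the edges of \<open>G\<close> matter; restricting the charge to a subgraph therefore
  leaves \<open>\<epsilon>\<close> unchanged.\<close>

definition charge :: "('a set \<Rightarrow> real) \<Rightarrow> 'a graph \<Rightarrow> real" where
  "charge \<epsilon> H = (\<Prod>e\<in>edges H. \<epsilon> e)"

text \<open>Elements of \<open>GF(2)\<^sup>E\<close> are represented as functions on all vertex sets that vanish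
  outside \<open>E\<close>.\<close>

definition incidence_vector :: "'a graph \<Rightarrow> 'a set \<Rightarrow> bit" where
  "incidence_vector H = (\<lambda>e. if e \<in> edges H then 1 else 0)"

interpretation gf2: Vector_Spaces.vector_space "\<lambda>(c::bit) (x::'e \<Rightarrow> bit) e. c * x e"
  by unfold_locales (auto simp: fun_eq_iff algebra_simps)

definition positive_cycle_space :: "('a set \<Rightarrow> real) \<Rightarrow> 'a graph \<Rightarrow> ('a set \<Rightarrow> bit) set" where
  "positive_cycle_space \<epsilon> G = {incidence_vector C | C. C \<in> cycles G \<and> charge \<epsilon> C = 1}"

definition short_positive_simple_cycles ::
    "('a set \<Rightarrow> real) \<Rightarrow> 'a graph \<Rightarrow> nat \<Rightarrow> 'a graph set" where
  "short_positive_simple_cycles \<epsilon> G L =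
    {C \<in> simple_cycles G. charge \<epsilon> C = 1 \<and> card (edges C) \<le> L}"

text \<open>Sparsity of a two-connected graph; trivial blocks have sparsity \<open>2\<close> by convention.\<close>

definition block_sparsity :: "('a set \<Rightarrow> real) \<Rightarrow> 'a graph \<Rightarrow> nat" where
  "block_sparsity \<epsilon> G =
    (if trivial_block G then 2
     else LEAST L. gf2.span (incidence_vector ` short_positive_simple_cycles \<epsilon> G L)
                     = positive_cycle_space \<epsilon> G)"

definition simple_cycle_sparsity :: "('a set \<Rightarrow> real) \<Rightarrow> 'a graph \<Rightarrow> nat" where
  "simple_cycle_sparsity \<epsilon> G =
    (if blocks G = {} then 2
     else if two_connected G then block_sparsity \<epsilon> G
     else Max (block_sparsity \<epsilon> ` blocks G))"

section \<open>The charged sparsity graph\<close>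

definition sparsity_graph :: "nat \<Rightarrow> real mat \<Rightarrow> nat graph" where
  "sparsity_graph N K =
    ({..<N}, {{i, j} | i j. i < N \<and> j < N \<and> i \<noteq> j \<and> K $$ (i,j) \<noteq> 0})"

text \<open>\<open>Min\<close> and \<open>Max\<close> only serve to name the two ends of an edge; the order is irrelevant.\<close>

definition sparsity_charge :: "real mat \<Rightarrow> nat set \<Rightarrow> real" where
  "sparsity_charge K e = sgn (K $$ (Min e, Max e) * K $$ (Max e, Min e))"

lemma sparsity_charge_edge: "sparsity_charge K {i, j} = sgn (K $$ (i,j) * K $$ (j,i))"
  by (cases i j rule: linorder_cases) (auto simp: sparsity_charge_def mult.commute)

end

theory Submission
  imports Defs "HOL-Combinatorics.Cycles"
begin

text \<open>The principal minors of order at most two determine the diagonal, the magnitudes and the charged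
  sparsity graph, so the competitor of \<open>K\<close> has entries \<open>sg {i,j} * K(i,j)\<close> for a sign pattern \<open>sg\<close>
  on the edges (\<open>minors_determine_magnitudes\<close>). In the expansion of a principal minor into
  permutations, the two orientations of a cycle cancel if the cycle is negative and agree if it is
  positive. Hence \<open>sg\<close> affects the minors only through the positive simple cycles on which its
  product is \<open>-1\<close>. Such cycles are called bad.

  The central statement is \<open>bad_circuit_changes_minor\<close>: if \<open>C\<close> is a shortest bad cycle, then the
  minor on the vertices of \<open>C\<close> does change. By the recursion \<open>perm_det_expand\<close> the change is, up
  to a nonzero factor, the sum of the weights of the bad Hamiltonian circuits on these vertices
  (\<open>perm_det_difference\<close>), and the problem is to exclude cancellation. A chord of \<open>C\<close> splits it
  into two shorter cycles; if these were positive, one of them would be bad, so they are negative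
  (\<open>chord_negative\<close>). Two crossing chords give two positive cycles whose sum is \<open>C\<close>. One of these
  is bad, so they cannot both be shorter than \<open>C\<close>. Hence the chords join the ends of two edges of
  \<open>C\<close> (\<open>crossing_chords\<close>) and can be exchanged with these two edges, as in the two-opt move for
  tours. In that case, and if \<open>C\<close> has at least five vertices, \<open>C\<close> consists of two paths between
  which the graph has just the two old and the two new edges (\<open>four_cut\<close>). So every Hamiltonian
  circuit uses one of the two pairs, and exchanging the pairs multiplies its weight by a constant
  that differs from \<open>-1\<close> because of the first genericity condition (\<open>ratio_neq\<close>). Fixing one pair
  after the other factorizes the sum into nonzero factors (\<open>toggle_sum_nonzero\<close>). For four
  vertices the two genericity conditions exclude cancellation directly, and a triangle has no
  other Hamiltonian circuit.

  For the first claim, equality of the minors up to the order \<open>L\<close> therefore makes all positive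
  simple cycles of length at most \<open>L\<close> good. As they span the positive cycles of each block, all
  positive simple cycles are good and all minors agree. For the second claim, some positive simple
  cycle of length \<open>L\<close> in some block is not in the span of the shorter ones; a linear functional
  that separates it from them is a sign pattern whose shortest bad cycle has length \<open>L\<close>
  (\<open>sign_with_shortest_bad_of_sparsity\<close>).

  Both claims need that the sparsity of a block is attained, that is, that the positive simple
  cycles of a two-connected graph span its positive cycles (\<open>positive_simple_cycles_span\<close>).
  Dually, a sign pattern without bad cycles is trivial on all positive cycles: if some negative
  cycle has sign \<open>1\<close>, the pattern is a coboundary, which is shown by adding ears, and the other
  cases reduce to this one (\<open>positive_even_set_sign\<close>).\<close>

section \<open>Weights and edges of paths and closed lists\<close>

fun path_weight :: "('a \<Rightarrow> 'a \<Rightarrow> real) \<Rightarrow> 'a list \<Rightarrow> real" where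
  "path_weight w [] = 1"
| "path_weight w [x] = 1"
| "path_weight w (x # y # zs) = w x y * path_weight w (y # zs)"

definition cycle_weight :: "('a \<Rightarrow> 'a \<Rightarrow> real) \<Rightarrow> 'a list \<Rightarrow> real" where
  "cycle_weight w xs = path_weight w xs * w (last xs) (hd xs)"

abbreviation path_prod :: "('a set \<Rightarrow> real) \<Rightarrow> 'a list \<Rightarrow> real" where
  "path_prod f \<equiv> path_weight (\<lambda>x y. f {x, y})"

abbreviation cycle_prod :: "('a set \<Rightarrow> real) \<Rightarrow> 'a list \<Rightarrow> real" where
  "cycle_prod f \<equiv> cycle_weight (\<lambda>x y. f {x, y})"

fun path_edges :: "'a list \<Rightarrow> 'a set set" where
  "path_edges [] = {}"
| "path_edges [x] = {}"
| "path_edges (x # y # zs) = insert {x, y} (path_edges (y # zs))"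

definition cycle_edges :: "'a list \<Rightarrow> 'a set set" where
  "cycle_edges xs = insert {last xs, hd xs} (path_edges xs)"

lemma path_weight_Cons: "zs \<noteq> [] \<Longrightarrow> path_weight w (x # zs) = w x (hd zs) * path_weight w zs"
  by (cases zs) auto

lemma path_weight_append:
  "xs \<noteq> [] \<Longrightarrow> ys \<noteq> [] \<Longrightarrow>
    path_weight w (xs @ ys) = path_weight w xs * w (last xs) (hd ys) * path_weight w ys"
  by (induction w xs rule: path_weight.induct) (auto simp: path_weight_Cons)

lemma path_weight_split: "path_weight w (xs @ x # ys) = path_weight w (xs @ [x]) * path_weight w (x # ys)"
  by (cases "xs = []"; cases "ys = []") (auto simp: path_weight_append path_weight_Cons)

lemma path_weight_rev: "path_weight w (rev xs) = path_weight (\<lambda>x y. w y x) xs"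
proof (induction w xs rule: path_weight.induct)
  case (3 w x y zs)
  then show ?case using path_weight_append[of "rev zs @ [y]" "[x]" w] by simp
qed simp_all

lemma path_weight_cong:
  "(\<And>x y. x \<in> set xs \<Longrightarrow> y \<in> set xs \<Longrightarrow> w x y = w' x y) \<Longrightarrow> path_weight w xs = path_weight w' xs"
  by (induction w xs rule: path_weight.induct) auto

lemma path_weight_mult:
  "path_weight (\<lambda>x y. w x y * w' x y) xs = path_weight w xs * path_weight w' xs"
  by (induction w xs rule: path_weight.induct) auto

lemma cycle_weight_cong:
  assumes "xs \<noteq> []" "\<And>x y. x \<in> set xs \<Longrightarrow> y \<in> set xs \<Longrightarrow> w x y = w' x y"
  shows "cycle_weight w xs = cycle_weight w' xs"
  using path_weight_cong[of xs w w'] assms by (auto simp: cycle_weight_def)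

lemma cycle_weight_mult:
  "cycle_weight (\<lambda>x y. w x y * w' x y) xs = cycle_weight w xs * cycle_weight w' xs"
  by (simp add: cycle_weight_def path_weight_mult)

lemma cycle_weight_append:
  assumes "xs \<noteq> []" "ys \<noteq> []"
  shows "cycle_weight w (xs @ ys) =
    path_weight w xs * w (last xs) (hd ys) * path_weight w ys * w (last ys) (hd xs)"
  using assms by (simp add: cycle_weight_def path_weight_append)

lemma cycle_weight_rotate: "cycle_weight w (xs @ ys) = cycle_weight w (ys @ xs)"
  by (cases "xs = []"; cases "ys = []") (auto simp: cycle_weight_append)

lemma cycle_weight_rev: "xs \<noteq> [] \<Longrightarrow> cycle_weight w (rev xs) = cycle_weight (\<lambda>x y. w y x) xs"
  by (simp add: cycle_weight_def path_weight_rev hd_rev last_rev)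

lemma path_edges_Cons: "zs \<noteq> [] \<Longrightarrow> path_edges (x # zs) = insert {x, hd zs} (path_edges zs)"
  by (cases zs) auto

lemma path_edges_append:
  "xs \<noteq> [] \<Longrightarrow> ys \<noteq> [] \<Longrightarrow>
    path_edges (xs @ ys) = insert {last xs, hd ys} (path_edges xs \<union> path_edges ys)"
proof (induction xs rule: path_edges.induct)
  case (3 x y zs)
  then show ?case by (simp add: insert_commute)
qed (simp_all add: path_edges_Cons)

lemma path_edges_rev: "path_edges (rev xs) = path_edges xs"
proof (induction xs rule: path_edges.induct)
  case (3 x y zs)
  then show ?case using path_edges_append[of "rev zs @ [y]" "[x]"] by (simp add: insert_commute)
qed simp_all

lemma path_edges_subset: "e \<in> path_edges xs \<Longrightarrow> e \<subseteq> set xs"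
  by (induction xs rule: path_edges.induct) auto

lemma finite_path_edges [simp]: "finite (path_edges xs)"
  by (induction xs rule: path_edges.induct) auto

lemma finite_cycle_edges [simp]: "finite (cycle_edges xs)"
  by (simp add: cycle_edges_def)

lemma cycle_edges_subset: "xs \<noteq> [] \<Longrightarrow> e \<in> cycle_edges xs \<Longrightarrow> e \<subseteq> set xs"
  using path_edges_subset[of e xs] by (auto simp: cycle_edges_def)

lemma cycle_edges_append:
  assumes "xs \<noteq> []" "ys \<noteq> []"
  shows "cycle_edges (xs @ ys) =
    insert {last xs, hd ys} (insert {last ys, hd xs} (path_edges xs \<union> path_edges ys))"
  using assms by (auto simp: cycle_edges_def path_edges_append)

lemma cycle_edges_rotate: "cycle_edges (xs @ ys) = cycle_edges (ys @ xs)"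
  by (cases "xs = []"; cases "ys = []") (auto simp: cycle_edges_append)

lemma cycle_edges_rev: "xs \<noteq> [] \<Longrightarrow> cycle_edges (rev xs) = cycle_edges xs"
  by (simp add: cycle_edges_def path_edges_rev hd_rev last_rev insert_commute)

lemma successively_path_edges:
  "successively (\<lambda>x y. P {x, y}) xs \<longleftrightarrow> (\<forall>e\<in>path_edges xs. P e)"
  by (induction xs rule: path_edges.induct) auto

lemma path_edges_split:
  "e \<in> path_edges xs \<Longrightarrow> \<exists>us x y vs. xs = us @ x # y # vs \<and> e = {x, y}"
proof (induction xs rule: path_edges.induct)
  case (3 x y zs)
  show ?case
  proof (cases "e = {x, y}")
    case True
    then have "x # y # zs = [] @ x # y # zs \<and> e = {x, y}" by simp
    then show ?thesis by blast
  next
    case False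
    then have "e \<in> path_edges (y # zs)" using 3 by simp
    from "3.IH"[OF this] obtain us a b vs where "y # zs = us @ a # b # vs \<and> e = {a, b}" by blast
    then have "x # y # zs = (x # us) @ a # b # vs \<and> e = {a, b}" by simp
    then show ?thesis by blast
  qed
qed auto

text \<open>Allows any edge of a closed list to be moved to the closing position by a rotation.\<close>

lemma cycle_edges_closing:
  assumes "e \<in> cycle_edges xs" "xs \<noteq> []"
  shows "\<exists>us vs. xs = us @ vs \<and> vs @ us \<noteq> [] \<and> e = {last (vs @ us), hd (vs @ us)}"
proof (cases "e \<in> path_edges xs")
  case True
  then obtain us x y vs where "xs = us @ x # y # vs" "e = {x, y}"
    using path_edges_split by blast
  then have "xs = (us @ [x]) @ (y # vs) \<and> (y # vs) @ us @ [x] \<noteq> [] \<and>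
      e = {last ((y # vs) @ us @ [x]), hd ((y # vs) @ us @ [x])}" by auto
  then show ?thesis by blast
next
  case False
  then have "xs = [] @ xs \<and> xs @ [] \<noteq> [] \<and> e = {last (xs @ []), hd (xs @ [])}"
    using assms by (auto simp: cycle_edges_def)
  then show ?thesis by blast
qed

lemma card_path_edges: "distinct xs \<Longrightarrow> card (path_edges xs) = length xs - 1"
proof (induction xs rule: path_edges.induct)
  case (3 x y zs)
  have "{x, y} \<notin> path_edges (y # zs)"
    using path_edges_subset[of "{x, y}" "y # zs"] 3 by auto
  then show ?case using 3 by simp
qed auto

lemma prod_path_edges:
  "distinct xs \<Longrightarrow> (\<Prod>e\<in>path_edges xs. f e) = path_prod f xs"
proof (induction xs rule: path_edges.induct)
  case (3 x y zs)
  have "{x, y} \<notin> path_edges (y # zs)"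
    using path_edges_subset[of "{x, y}" "y # zs"] 3 by auto
  then show ?case using 3 by simp
qed auto

lemma closing_edge_notin_path_edges:
  assumes "distinct xs" "length xs \<ge> 3"
  shows "{last xs, hd xs} \<notin> path_edges xs"
proof
  assume "{last xs, hd xs} \<in> path_edges xs"
  obtain x y ys where xs: "xs = x # y # ys" "ys \<noteq> []"
    using assms by (cases xs; cases "tl xs"; cases "tl (tl xs)") auto
  have "{last xs, hd xs} \<notin> path_edges (y # ys)"
    using path_edges_subset[of "{last xs, hd xs}" "y # ys"] assms xs by auto
  moreover have "{last xs, hd xs} \<noteq> {x, y}"
    using assms xs by (auto simp: doubleton_eq_iff)
  ultimately show False using \<open>{last xs, hd xs} \<in> path_edges xs\<close> xs by simp
qed

lemma card_cycle_edges: "distinct xs \<Longrightarrow> length xs \<ge> 3 \<Longrightarrow> card (cycle_edges xs) = length xs"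
  using closing_edge_notin_path_edges[of xs] by (simp add: cycle_edges_def card_path_edges)

lemma prod_cycle_edges:
  "distinct xs \<Longrightarrow> length xs \<ge> 3 \<Longrightarrow>
    (\<Prod>e\<in>cycle_edges xs. f e) = cycle_prod f xs"
  using closing_edge_notin_path_edges[of xs]
  by (simp add: cycle_edges_def prod_path_edges cycle_weight_def)

lemma successively_imp_path_weight_nonzero:
  "successively (\<lambda>x y. w x y \<noteq> 0) xs \<longleftrightarrow> path_weight w xs \<noteq> 0"
  by (induction w xs rule: path_weight.induct) auto

lemma distinct_hd_eq_last: "distinct l \<Longrightarrow> l \<noteq> [] \<Longrightarrow> hd l = last l \<Longrightarrow> length l = 1"
  by (cases l) (auto split: if_splits)

text \<open>The reversal of a closed list that fixes its first entry, so that it acts on the lists with a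
  prescribed base point.\<close>

definition reverse_keeping_head :: "'a list \<Rightarrow> 'a list" where
  "reverse_keeping_head xs = hd xs # rev (tl xs)"

lemma reverse_keeping_head:
  assumes "xs \<noteq> []"
  shows "reverse_keeping_head (reverse_keeping_head xs) = xs"
    and "set (reverse_keeping_head xs) = set xs"
    and "distinct (reverse_keeping_head xs) = distinct xs"
    and "length (reverse_keeping_head xs) = length xs"
    and "hd (reverse_keeping_head xs) = hd xs"
    and "reverse_keeping_head xs \<noteq> []"
    and "cycle_edges (reverse_keeping_head xs) = cycle_edges xs"
    and "cycle_weight w (reverse_keeping_head xs) = cycle_weight (\<lambda>x y. w y x) xs"
proof -
  obtain x ys where xs: "xs = x # ys" using assms by (cases xs) auto
  have rev: "reverse_keeping_head xs = [x] @ rev ys" "rev xs = rev ys @ [x]"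
    by (auto simp: xs reverse_keeping_head_def)
  show "cycle_edges (reverse_keeping_head xs) = cycle_edges xs"
    using cycle_edges_rev[OF assms] cycle_edges_rotate[of "[x]" "rev ys"] rev by simp
  show "cycle_weight w (reverse_keeping_head xs) = cycle_weight (\<lambda>x y. w y x) xs"
    using cycle_weight_rev[OF assms, of w] cycle_weight_rotate[of w "[x]" "rev ys"] rev by simp
qed (use assms in \<open>cases xs; simp add: reverse_keeping_head_def\<close>)+

text \<open>Once two closed lists with the same edges agree on two consecutive entries, every further entry
  is forced: its predecessor has only two neighbours, one of which has already been visited.\<close>

lemma same_cycle_edges_determined:
  assumes "distinct (us @ p # q # vs)" "distinct (us @ p # q # vs')" "length vs = length vs'"
    and "cycle_edges (us @ p # q # vs) = cycle_edges (us @ p # q # vs')"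
  shows "vs = vs'"
  using assms
proof (induction vs arbitrary: us p q vs')
  case (Cons v vt)
  then obtain v' vt' where vs': "vs' = v' # vt'" by (cases vs') auto
  have "cycle_edges (us @ p # q # v # vt) = cycle_edges ((p # q # v # vt) @ us)"
    by (rule cycle_edges_rotate)
  also have "\<dots> = cycle_edges ([p, q] @ (v # vt @ us))" by simp
  also have "\<dots> = {{q, v}, {last (v # vt @ us), p}, {p, q}} \<union> path_edges (v # vt @ us)"
    by (subst cycle_edges_append) auto
  finally have ce: "cycle_edges (us @ p # q # v # vt) =
      {{q, v}, {last (v # vt @ us), p}, {p, q}} \<union> path_edges (v # vt @ us)" .
  have "{q, v'} \<in> path_edges (us @ p # q # v' # vt')"
    using path_edges_append[of "us @ [p]" "q # v' # vt'"] by simp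
  then have "{q, v'} \<in> cycle_edges (us @ p # q # v # vt)"
    using Cons.prems(4) vs' by (simp add: cycle_edges_def)
  moreover have "{q, v'} \<notin> path_edges (v # vt @ us)"
    using path_edges_subset[of "{q, v'}" "v # vt @ us"] Cons.prems(1) by auto
  moreover have "{q, v'} \<noteq> {last (v # vt @ us), p}"
  proof -
    have "last (v # vt @ us) \<in> set (v # vt @ us)" by (rule last_in_set) simp
    moreover have "q \<notin> set (v # vt @ us)" "q \<noteq> p" using Cons.prems(1) by auto
    ultimately show ?thesis by (metis doubleton_eq_iff)
  qed
  moreover have "v' \<noteq> p" "v' \<noteq> q" using Cons.prems(2) vs' by auto
  ultimately have "v' = v" unfolding ce by (auto simp: doubleton_eq_iff)
  moreover have "vt = vt'"
    by (rule Cons.IH[of "us @ [p]" q v]) (use Cons.prems vs' \<open>v' = v\<close> in auto)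
  ultimately show ?case using vs' by simp
qed auto

text \<open>The second entry is one of the two neighbours of the first, and this choice fixes the
  orientation.\<close>

lemma same_cycle_edges_same_head:
  assumes "distinct xs" "distinct ys" "length xs \<ge> 3" "cycle_edges xs = cycle_edges ys"
    and "hd xs = hd ys" "length ys = length xs"
  shows "ys = xs \<or> ys = reverse_keeping_head xs"
proof -
  have ne: "xs \<noteq> []" using assms by auto
  have main: "ys = zs" if "hd (tl ys) = hd (tl zs)" and zs: "distinct zs" "length zs = length xs"
    "cycle_edges zs = cycle_edges xs" "hd zs = hd xs" for zs
  proof -
    obtain p q vs where "ys = p # q # vs" using assms(3,6) by (cases ys; cases "tl ys") auto
    moreover obtain p' q' vs' where "zs = p' # q' # vs'"
      using assms(3) zs(2) by (cases zs; cases "tl zs") auto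
    ultimately show ?thesis
      using same_cycle_edges_determined[of "[]" p q vs vs'] assms zs that by auto
  qed
  obtain x z zs where ys: "ys = x # z # zs" using assms(3,6) by (cases ys; cases "tl ys") auto
  obtain y ws where xs: "xs = x # y # ws" "ws \<noteq> []"
    using assms(3,5) ys by (cases xs; cases "tl xs"; cases "tl (tl xs)") auto
  have "{x, z} \<in> cycle_edges xs" using assms(4) ys by (auto simp: cycle_edges_def)
  moreover have "{x, z} \<notin> path_edges (y # ws)"
    using path_edges_subset[of "{x, z}" "y # ws"] assms(1) xs by auto
  ultimately have "z = y \<or> z = last xs"
    using assms(1,2) xs ys by (auto simp: cycle_edges_def doubleton_eq_iff)
  then show ?thesis
  proof
    assume "z = y"
    then show ?thesis using main[of xs] assms xs ys by auto
  next
    assume "z = last xs"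
    moreover have "hd (tl (reverse_keeping_head xs)) = last xs"
      using xs by (simp add: reverse_keeping_head_def hd_append hd_rev)
    ultimately show ?thesis
      using main[of "reverse_keeping_head xs"] reverse_keeping_head[OF ne] assms ys by auto
  qed
qed

lemma reverse_keeping_head_neq:
  assumes "distinct xs" "length xs \<ge> 3" shows "reverse_keeping_head xs \<noteq> xs"
proof
  assume eq: "reverse_keeping_head xs = xs"
  obtain x y zs where xs: "xs = x # y # zs" "zs \<noteq> []"
    using assms by (cases xs; cases "tl xs"; cases "tl (tl xs)") auto
  have "hd (rev zs @ [y]) = y" using eq xs by (simp add: reverse_keeping_head_def)
  then have "last zs = y" using xs by (simp add: hd_append hd_rev)
  then show False using assms xs last_in_set[of zs] by auto
qed

section \<open>Chords of a shortest bad circuit\<close>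

text \<open>The function \<open>eps\<close> is the charge of the graph and \<open>sig\<close> the sign pattern that relates two
  matrices. Both are total with values \<open>1\<close> and \<open>-1\<close>, so that signs cancel in pairs on arbitrary
  lists.\<close>

locale signed_graph =
  fixes adj :: "'a \<Rightarrow> 'a \<Rightarrow> bool" and eps sig :: "'a set \<Rightarrow> real"
  assumes adj_sym: "adj x y \<Longrightarrow> adj y x"
    and adj_irrefl: "\<not> adj x x"
    and eps_sq: "eps e * eps e = 1"
    and sig_sq: "sig e * sig e = 1"
begin

abbreviation "path_eps \<equiv> path_prod eps"
abbreviation "path_sig \<equiv> path_prod sig"
abbreviation "cycle_eps \<equiv> cycle_prod eps"
abbreviation "cycle_sig \<equiv> cycle_prod sig"

text \<open>A list of two adjacent vertices counts as a circuit. This keeps degenerate cases below uniform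
  and is harmless, since its one edge is used twice and both signs are \<open>1\<close>.\<close>

definition circuit :: "'a list \<Rightarrow> bool" where
  "circuit xs \<longleftrightarrow> xs \<noteq> [] \<and> distinct xs \<and> successively adj xs \<and> adj (last xs) (hd xs)"

definition bad :: "'a list \<Rightarrow> bool" where
  "bad xs \<longleftrightarrow> circuit xs \<and> cycle_eps xs = 1 \<and> cycle_sig xs = -1"

lemma eps_cases: "eps e = 1 \<or> eps e = -1"
  using eps_sq[of e] by (simp add: square_eq_1_iff)

lemma sig_cases: "sig e = 1 \<or> sig e = -1"
  using sig_sq[of e] by (simp add: square_eq_1_iff)

lemma path_sign_cases:
  assumes "\<And>e. f e = 1 \<or> f e = (-1::real)"
  shows "path_prod f xs = 1 \<or> path_prod f xs = -1"
proof (induction "\<lambda>x y. f {x, y}" xs rule: path_weight.induct)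
  case (3 x y zs)
  then show ?case using assms[of "{x, y}"] by auto
qed auto

lemmas path_eps_cases = path_sign_cases[of eps, OF eps_cases]
lemmas path_sig_cases = path_sign_cases[of sig, OF sig_cases]

lemma cycle_eps_cases: "cycle_eps xs = 1 \<or> cycle_eps xs = -1"
  using path_eps_cases[of xs] eps_cases[of "{last xs, hd xs}"] by (auto simp: cycle_weight_def)

lemma cycle_sig_cases: "cycle_sig xs = 1 \<or> cycle_sig xs = -1"
  using path_sig_cases[of xs] sig_cases[of "{last xs, hd xs}"] by (auto simp: cycle_weight_def)

lemma circuit_append:
  assumes "xs \<noteq> []" "ys \<noteq> []"
  shows "circuit (xs @ ys) \<longleftrightarrow> distinct (xs @ ys) \<and> successively adj xs \<and> successively adj ys \<and>
    adj (last xs) (hd ys) \<and> adj (last ys) (hd xs)"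
  using assms by (auto simp: circuit_def successively_append_iff)

lemma circuit_rotate: "circuit (xs @ ys) = circuit (ys @ xs)"
  by (cases "xs = []"; cases "ys = []") (auto simp: circuit_append)

lemma successively_adj_swap [simp]: "successively (\<lambda>x y. adj y x) xs = successively adj xs"
  by (rule successively_cong) (auto intro: adj_sym)

lemma circuit_rev: "circuit (rev xs) = circuit xs"
  by (auto simp: circuit_def hd_rev last_rev intro: adj_sym)

lemma cycle_weight_rev_symmetric:
  "cycle_prod f (rev xs) = cycle_prod f xs"
  by (cases "xs = []") (simp_all add: cycle_weight_rev insert_commute)

lemma path_weight_rev_symmetric:
  "path_prod f (rev xs) = path_prod f xs"
  by (simp add: path_weight_rev insert_commute)

lemma bad_rotate: "bad (xs @ ys) = bad (ys @ xs)"
  unfolding bad_def using circuit_rotate cycle_weight_rotate by metis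

lemma bad_rev: "bad (rev xs) = bad xs"
  unfolding bad_def by (simp add: circuit_rev cycle_weight_rev_symmetric)

lemma circuit_length: assumes "circuit xs" shows "length xs \<ge> 2"
proof -
  have "xs \<noteq> []" "\<not> (\<exists>x. xs = [x])" using assms adj_irrefl by (auto simp: circuit_def)
  then show ?thesis by (cases xs; cases "tl xs") auto
qed

text \<open>On two vertices the same edge would be traversed twice, so both signs would be trivial.\<close>

lemma bad_length: assumes "bad xs" shows "length xs \<ge> 3"
proof (rule ccontr)
  assume "\<not> length xs \<ge> 3"
  then have "length xs = 2" using circuit_length[of xs] assms by (simp add: bad_def)
  then obtain x y where "xs = [x, y]" by (auto simp: length_Suc_conv numeral_2_eq_2)
  then show False using assms sig_sq[of "{x, y}"]
    by (simp add: bad_def cycle_weight_def insert_commute)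
qed

lemma circuit_edge_adj:
  assumes "circuit xs" "{x, y} \<in> cycle_edges xs" shows "adj x y"
proof -
  have "\<exists>a b. {x, y} = {a, b} \<and> adj a b"
  proof (cases "{x, y} \<in> path_edges xs")
    case True
    then obtain us a b vs where "xs = us @ a # b # vs" "{x, y} = {a, b}"
      using path_edges_split by blast
    then show ?thesis using assms by (auto simp: circuit_def successively_append_iff)
  next
    case False
    then show ?thesis using assms by (auto simp: circuit_def cycle_edges_def)
  qed
  then show ?thesis using adj_sym by (metis doubleton_eq_iff)
qed

lemma cycle_weight_two_arcs:
  "cycle_weight w (u # X @ v # Y) = path_weight w (u # X @ [v]) * path_weight w (v # Y @ [u])"
  using path_weight_split[of w "u # X" v Y] path_weight_append[of "v # Y" "[u]" w]
  by (simp add: cycle_weight_def)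

definition shortest_bad :: "'a list \<Rightarrow> bool" where
  "shortest_bad C \<longleftrightarrow> bad C \<and> (\<forall>xs. bad xs \<longrightarrow> length C \<le> length xs)"

lemma shortest_badD: "shortest_bad C \<Longrightarrow> bad C"
  by (simp add: shortest_bad_def)

lemma shorter_circuit_good:
  "shortest_bad C \<Longrightarrow> circuit xs \<Longrightarrow> length xs < length C \<Longrightarrow> cycle_eps xs = 1 \<Longrightarrow> cycle_sig xs = 1"
  using cycle_sig_cases[of xs] by (force simp: shortest_bad_def bad_def)

lemma shortest_bad_rotate: "shortest_bad (xs @ ys) = shortest_bad (ys @ xs)"
  unfolding shortest_bad_def using bad_rotate[of xs ys] by auto

text \<open>The weights of the two halves multiply to the weight of the whole circuit. If one half were
  positive, so would be the other, and one of them would be a shorter bad circuit.\<close>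

lemma chord_negative:
  assumes C: "shortest_bad (u # X @ v # Y)" and "X \<noteq> []" "Y \<noteq> []" "adj u v"
  shows "cycle_eps (u # X @ [v]) = -1"
proof (rule ccontr)
  assume "cycle_eps (u # X @ [v]) \<noteq> -1"
  then have e1: "cycle_eps (u # X @ [v]) = 1" using cycle_eps_cases by blast
  have bad: "bad (u # X @ v # Y)" using C by (rule shortest_badD)
  have circ: "circuit ((u # X) @ (v # Y))" using bad by (simp add: bad_def)
  have c1: "circuit ((u # X) @ [v])" "circuit ((v # Y) @ [u])"
    using circ assms(4) adj_sym circuit_append[of "u # X" "v # Y"]
      circuit_append[of "u # X" "[v]"] circuit_append[of "v # Y" "[u]"] by auto
  have prod: "cycle_prod f (u # X @ [v]) * cycle_prod f (v # Y @ [u])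
      = cycle_prod f (u # X @ v # Y)" if "\<And>e. f e * f e = (1::real)" for f
  proof -
    have "cycle_prod f (u # X @ [v]) = path_prod f (u # X @ [v]) * f {u, v}"
      "cycle_prod f (v # Y @ [u]) = path_prod f (v # Y @ [u]) * f {u, v}"
      by (auto simp: cycle_weight_def insert_commute)
    then have "cycle_prod f (u # X @ [v]) * cycle_prod f (v # Y @ [u]) =
        path_prod f (u # X @ [v]) * path_prod f (v # Y @ [u]) *
        (f {u, v} * f {u, v})" by (simp only: mult_ac)
    then show ?thesis using that[of "{u, v}"] by (simp only: cycle_weight_two_arcs mult_1_right)
  qed
  have e2: "cycle_eps (v # Y @ [u]) = 1"
    using prod[of eps, OF eps_sq] e1 bad by (simp add: bad_def)
  have "cycle_sig (u # X @ [v]) = 1"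
    by (rule shorter_circuit_good[OF C]) (use c1 e1 \<open>Y \<noteq> []\<close> in auto)
  moreover have "cycle_sig (v # Y @ [u]) = 1"
    by (rule shorter_circuit_good[OF C]) (use c1 e2 \<open>X \<noteq> []\<close> in auto)
  ultimately show False using prod[of sig, OF sig_sq] bad by (simp add: bad_def)
qed

text \<open>Each chord splits the circuit into negative halves, so the two circuits that use both chords are
  positive. Their \<open>sig\<close>-signs multiply to \<open>-1\<close>, so they cannot both be shorter than the given
  circuit.\<close>

lemma crossing_chords:
  assumes C: "shortest_bad (u # X1 @ x # X2 @ v # Y1 @ y # Y2)" and uv: "adj u v" and xy: "adj x y"
  shows "X2 = [] \<and> Y2 = [] \<or> X1 = [] \<and> Y1 = []"
proof (rule ccontr)
  assume contr: "\<not> ?thesis"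
  have bad: "bad (u # X1 @ x # X2 @ v # Y1 @ y # Y2)" using C by (rule shortest_badD)
  define P1 P2 P3 P4 where P: "P1 = u # X1 @ [x]" "P2 = x # X2 @ [v]" "P3 = v # Y1 @ [y]" "P4 = y # Y2 @ [u]"
  let ?w = "\<lambda>f x y. f {x, y} :: real"
  have split: "path_weight w (u # X1 @ x # X2 @ [v]) = path_weight w P1 * path_weight w P2"
      "path_weight w (x # X2 @ v # Y1 @ [y]) = path_weight w P2 * path_weight w P3"
      "path_weight w (v # Y1 @ y # Y2 @ [u]) = path_weight w P3 * path_weight w P4" for w
    using path_weight_split[of w "u # X1" x "X2 @ [v]"] path_weight_split[of w "x # X2" v "Y1 @ [y]"]
      path_weight_split[of w "v # Y1" y "Y2 @ [u]"] by (auto simp: P)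
  have n1: "cycle_eps (u # (X1 @ x # X2) @ [v]) = -1"
    by (rule chord_negative[where Y = "Y1 @ y # Y2"]) (use C uv in auto)
  have n2: "cycle_eps (x # (X2 @ v # Y1) @ [y]) = -1"
    by (rule chord_negative[where Y = "Y2 @ u # X1"])
      (use C xy shortest_bad_rotate[of "u # X1" "x # X2 @ v # Y1 @ y # Y2"] in auto)
  have C_split: "cycle_weight w (u # X1 @ x # X2 @ v # Y1 @ y # Y2) =
      path_weight w P1 * path_weight w P2 * path_weight w P3 * path_weight w P4" for w
    using cycle_weight_two_arcs[of w u "X1 @ x # X2" v "Y1 @ y # Y2"] split[of w] by simp
  \<comment> \<open>The two circuits through both chords; each keeps two opposite arcs of the four.\<close>
  define Z1 Z2 where Z: "Z1 = P1 @ rev P3" "Z2 = P2 @ rev P4"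
  have ends: "P1 \<noteq> []" "P2 \<noteq> []" "P3 \<noteq> []" "P4 \<noteq> []"
      "hd P1 = u" "last P1 = x" "hd P2 = x" "last P2 = v" "hd P3 = v" "last P3 = y" "hd P4 = y" "last P4 = u"
    by (auto simp: P)
  have Z_weight: "cycle_prod f Z1 = path_prod f P1 * f {x, y} * path_prod f P3 * f {u, v}"
      "cycle_prod f Z2 = path_prod f P2 * f {u, v} * path_prod f P4 * f {x, y}" for f
    unfolding Z using ends
    by (simp_all add: cycle_weight_append path_weight_rev_symmetric hd_rev last_rev insert_commute)
  have dist: "distinct (u # X1 @ x # X2 @ v # Y1 @ y # Y2)"
    using bad by (simp add: bad_def circuit_def)
  have succ: "successively adj P1" "successively adj P2" "successively adj P3" "successively adj P4"
  proof -
    have "successively adj (u # X1 @ x # X2 @ v # Y1 @ y # Y2 @ [u])"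
      using bad successively_append_iff[of adj "u # X1 @ x # X2 @ v # Y1 @ y # Y2" "[u]"]
      by (simp add: bad_def circuit_def)
    then show "successively adj P1" "successively adj P2" "successively adj P3" "successively adj P4"
      using successively_append_iff[of adj P1 "X2 @ v # Y1 @ y # Y2 @ [u]"]
        successively_append_iff[of adj "u # X1" "P2 @ Y1 @ y # Y2 @ [u]"]
        successively_append_iff[of adj P2 "Y1 @ y # Y2 @ [u]"]
        successively_append_iff[of adj "u # X1 @ x # X2" "P3 @ Y2 @ [u]"]
        successively_append_iff[of adj P3 "Y2 @ [u]"]
        successively_append_iff[of adj "u # X1 @ x # X2 @ v # Y1" "P4"]
      by (auto simp: P)
  qed
  have circ: "circuit Z1" "circuit Z2"
    using dist succ uv xy ends adj_sym unfolding Z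
    by (simp_all add: circuit_append hd_rev last_rev) (auto simp: P)
  have eps_vals: "path_eps P1 * path_eps P2 * eps {u, v} = -1" "path_eps P2 * path_eps P3 * eps {x, y} = -1"
    "path_eps P1 * path_eps P2 * path_eps P3 * path_eps P4 = 1"
    using n1 n2 bad C_split[of "?w eps"] split[of "?w eps"]
    by (auto simp: cycle_weight_def bad_def insert_commute)
  have pos: "cycle_eps Z1 = 1" "cycle_eps Z2 = 1"
    using eps_vals path_eps_cases[of P1] path_eps_cases[of P2] path_eps_cases[of P3] path_eps_cases[of P4]
      eps_cases[of "{u, v}"] eps_cases[of "{x, y}"] unfolding Z_weight by auto
  have "cycle_sig Z1 = 1"
    by (rule shorter_circuit_good[OF C circ(1) _ pos(1)])
      (use contr in \<open>auto simp: Z P neq_Nil_conv\<close>)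
  moreover have "cycle_sig Z2 = 1"
    by (rule shorter_circuit_good[OF C circ(2) _ pos(2)])
      (use contr in \<open>auto simp: Z P neq_Nil_conv\<close>)
  moreover have "path_sig P1 * path_sig P2 * path_sig P3 * path_sig P4 = -1"
    using bad C_split[of "?w sig"] by (simp add: bad_def)
  ultimately show False
    using path_sig_cases[of P1] path_sig_cases[of P2] path_sig_cases[of P3] path_sig_cases[of P4]
      sig_cases[of "{u, v}"] sig_cases[of "{x, y}"] unfolding Z_weight by auto
qed

text \<open>The old edges between the paths \<open>A\<close> and \<open>B\<close> and the two chords form a quadrangle. It is positive
  as the sum of a negative half for each chord, and it is good because it is shorter.\<close>

lemma two_opt_quadrangle:
  assumes C: "shortest_bad (A @ B)" and len: "length A \<ge> 2" "length B \<ge> 2" "length (A @ B) \<ge> 5"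
    and e: "adj (hd A) (hd B)" and f: "adj (last A) (last B)"
  shows "circuit [hd A, hd B, last A, last B]"
    and "cycle_eps [hd A, hd B, last A, last B] = 1"
    and "cycle_sig [hd A, hd B, last A, last B] = 1"
    and "path_eps A * eps {last A, hd B} * eps {hd B, hd A} = -1"
    and "eps {last B, hd A} * path_eps A * eps {last A, last B} = -1"
proof -
  have bad: "bad (A @ B)" using C by (rule shortest_badD)
  have ne: "A \<noteq> []" "B \<noteq> []" using len by auto
  obtain a A' where A: "A = a # A'" "A' \<noteq> []" using len by (cases A; cases "tl A") auto
  obtain c B' where B: "B = c # B'" "B' \<noteq> []" using len by (cases B; cases "tl B") auto
  obtain b A'' where Ab: "A = A'' @ [b]" "A'' \<noteq> []"
    using A by (metis append_butlast_last_id append_Nil last_ConsR list.inject list.simps(3))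
  obtain d B'' where Bd: "B = B'' @ [d]" "B'' \<noteq> []"
    using B by (metis append_butlast_last_id append_Nil last_ConsR list.inject list.simps(3))
  have "hd A = a" "hd B = c" by (simp_all add: A(1) B(1))
  moreover have "last A = b" "last B = d" by (simp_all add: Ab(1) Bd(1))
  ultimately have ends: "hd A = a" "hd B = c" "last A = b" "last B = d" .
  have circ: "circuit (A @ B)" using bad by (simp add: bad_def)
  have adjs: "adj b c" "adj d a" "distinct (A @ B)"
    using circ ends unfolding circuit_append[OF ne] by auto
  have "a \<in> set A" "b \<in> set A" "c \<in> set B" "d \<in> set B"
    using hd_in_set[OF ne(1)] hd_in_set[OF ne(2)] last_in_set[OF ne(1)] last_in_set[OF ne(2)]
    unfolding ends by simp_all
  moreover have "a \<noteq> b" "c \<noteq> d"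
    using adjs(3) distinct_hd_eq_last[of A] distinct_hd_eq_last[of B] ends ne len by auto
  ultimately have "distinct [a, c, b, d]" using adjs(3) by auto
  then show circQ: "circuit [hd A, hd B, last A, last B]"
    using e f adjs adj_sym unfolding ends by (auto simp: circuit_def)
  have "cycle_eps (a # A' @ [c]) = -1"
    by (rule chord_negative[where Y = B']) (use C A B e ends in auto)
  then show n1: "path_eps A * eps {last A, hd B} * eps {hd B, hd A} = -1"
    using path_weight_append[of A "[c]" "\<lambda>x y. eps {x, y}"] ne A(1) ends
    by (simp add: cycle_weight_def)
  have "cycle_eps (d # A'' @ [b]) = -1"
    by (rule chord_negative[where Y = B''])
      (use C Ab Bd f ends shortest_bad_rotate[of "A'' @ b # B''" "[d]"] in \<open>auto intro: adj_sym\<close>)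
  then show n2: "eps {last B, hd A} * path_eps A * eps {last A, last B} = -1"
    using path_weight_append[of "[d]" A "\<lambda>x y. eps {x, y}"] ne Ab(1) ends
    by (simp add: cycle_weight_def)
  have Q: "cycle_prod g [hd A, hd B, last A, last B] =
      g {hd B, hd A} * g {last A, hd B} * g {last A, last B} * g {last B, hd A}" for g :: "'a set \<Rightarrow> real"
    by (simp add: cycle_weight_def insert_commute)
  show posQ: "cycle_eps [hd A, hd B, last A, last B] = 1"
    using n1 n2 path_eps_cases[of A] eps_cases[of "{last A, hd B}"] eps_cases[of "{hd B, hd A}"]
      eps_cases[of "{last B, hd A}"] eps_cases[of "{last A, last B}"] unfolding Q by auto
  show "cycle_sig [hd A, hd B, last A, last B] = 1"
    by (rule shorter_circuit_good[OF C circQ _ posQ]) (use len in auto)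
qed

text \<open>A further edge \<open>{x,y}\<close> between the two paths would be a chord. Together with the chord
  \<open>{hd A, hd B}\<close> it closes the circuit through the initial pieces of \<open>A\<close> and \<open>B\<close>, and together
  with \<open>{last A, last B}\<close> the circuit through the final pieces. Both are positive and shorter,
  hence good, and with the quadrangle they add up to the circuit \<open>A @ B\<close>, which is bad.\<close>

lemma four_cut:
  assumes C: "shortest_bad (A @ B)" and len: "length A \<ge> 2" "length B \<ge> 2" "length (A @ B) \<ge> 5"
    and e: "adj (hd A) (hd B)" and f: "adj (last A) (last B)"
    and x: "x \<in> set A" and y: "y \<in> set B" and xy: "adj x y"
  shows "(x = hd A \<or> x = last A) \<and> (y = hd B \<or> y = last B)"
proof (rule ccontr)
  assume contr: "\<not> ?thesis"
  have bad: "bad (A @ B)" using C by (rule shortest_badD)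
  have ne: "A \<noteq> []" "B \<noteq> []" using len by auto
  obtain X1 X2 where A: "A = X1 @ x # X2" using x by (metis split_list)
  obtain Y1 Y2 where B: "B = Y1 @ y # Y2" using y by (metis split_list)
  define A1 A2 B1 B2 where parts: "A1 = X1 @ [x]" "A2 = x # X2" "B1 = Y1 @ [y]" "B2 = y # Y2"
  let ?w = "\<lambda>f x y. f {x, y} :: real"
  have ends: "hd A = hd A1" "last A = last A2" "hd B = hd B1" "last B = last B2"
    unfolding A B parts by (auto simp: hd_append)
  have pne: "A1 \<noteq> []" "A2 \<noteq> []" "B1 \<noteq> []" "B2 \<noteq> []" by (auto simp: parts)
  have pw: "path_weight w A = path_weight w A1 * path_weight w A2"
    "path_weight w B = path_weight w B1 * path_weight w B2" for w
    unfolding A B parts by (rule path_weight_split)+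
  have circ: "circuit (A @ B)" using bad by (simp add: bad_def)
  then have facts: "distinct (A @ B)" "successively adj A" "successively adj B"
      "adj (last A) (hd B)" "adj (last B) (hd A)"
    unfolding circuit_append[OF ne] by auto
  have succ: "successively adj A1" "successively adj A2" "successively adj B1" "successively adj B2"
    using facts(2,3) unfolding A B parts
    using successively_append_iff[of adj "X1 @ [x]" X2] successively_append_iff[of adj X1 "x # X2"]
      successively_append_iff[of adj "Y1 @ [y]" Y2] successively_append_iff[of adj Y1 "y # Y2"] by auto
  note quad = two_opt_quadrangle[OF C len e f]
  have Q: "cycle_prod g [hd A, hd B, last A, last B] =
      g {hd B, hd A} * g {last A, hd B} * g {last A, last B} * g {last B, hd A}" for g :: "'a set \<Rightarrow> real"
    by (simp add: cycle_weight_def insert_commute)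
  have Cw: "cycle_prod g (A @ B) =
      path_prod g A1 * path_prod g A2 * g {last A, hd B} *
      path_prod g B1 * path_prod g B2 * g {last B, hd A}" for g
    using cycle_weight_append[OF ne] pw by simp
  have "X2 @ Y1 \<noteq> []" "Y2 @ X1 \<noteq> []"
    using contr unfolding A B by (auto simp: hd_append split: if_splits)
  then have "cycle_eps (x # (X2 @ Y1) @ [y]) = -1"
    by (intro chord_negative[where Y = "Y2 @ X1"])
      (use C A B xy shortest_bad_rotate[of X1 "x # X2 @ Y1 @ y # Y2"] in auto)
  moreover have "x # (X2 @ Y1) @ [y] = A2 @ B1" by (simp add: parts)
  ultimately have "cycle_eps (A2 @ B1) = -1" by (simp only:)
  then have n: "path_eps A2 * eps {last A, hd B} * path_eps B1 * eps {x, y} = -1"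
    using cycle_weight_append[OF pne(2,3), of "?w eps"] ends by (simp add: parts insert_commute)
  \<comment> \<open>The circuits through the initial and through the final pieces.\<close>
  define Z1 Z2 where Z: "Z1 = A1 @ rev B1" "Z2 = A2 @ rev B2"
  have Zw: "cycle_prod g Z1 = path_prod g A1 * g {x, y} * path_prod g B1 * g {hd B, hd A}"
      "cycle_prod g Z2 = path_prod g A2 * g {last A, last B} * path_prod g B2 * g {x, y}" for g
    unfolding Z ends using pne
    by (subst cycle_weight_append;
        simp add: path_weight_rev_symmetric hd_rev last_rev; simp add: parts insert_commute)+
  have dist: "distinct A1" "distinct A2" "distinct B1" "distinct B2"
      "set A1 \<inter> set B1 = {}" "set A2 \<inter> set B2 = {}"
    using facts(1) unfolding A B parts by auto
  have "last A1 = x" "last B1 = y" "hd A2 = x" "hd B2 = y" by (simp_all add: parts)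
  then have circZ: "circuit Z1" "circuit Z2"
    using dist succ pne e f xy adj_sym unfolding Z ends
    by (simp_all add: circuit_append hd_rev last_rev)
  note ecases = path_eps_cases[of A1] path_eps_cases[of A2] path_eps_cases[of B1] path_eps_cases[of B2]
      eps_cases[of "{x, y}"] eps_cases[of "{last A, hd B}"] eps_cases[of "{last B, hd A}"]
      eps_cases[of "{last A, last B}"] eps_cases[of "{hd B, hd A}"]
  have CE: "path_eps A1 * path_eps A2 * eps {last A, hd B} * path_eps B1 * path_eps B2 * eps {last B, hd A} = 1"
    using bad Cw[of eps] by (simp add: bad_def)
  have pos1: "cycle_eps Z1 = 1"
    using ecases n quad(4) unfolding Zw pw by (elim disjE) simp_all
  have pos2: "cycle_eps Z2 = 1"
    using ecases n quad(5) CE unfolding Zw pw by (elim disjE) simp_all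
  have proper: "X1 \<noteq> [] \<or> Y1 \<noteq> []" "X2 \<noteq> [] \<or> Y2 \<noteq> []"
    using contr unfolding A B by auto
  have "cycle_sig Z1 = 1"
    by (rule shorter_circuit_good[OF C circZ(1) _ pos1])
      (use proper in \<open>auto simp: Z parts A B\<close>)
  moreover have "cycle_sig Z2 = 1"
    by (rule shorter_circuit_good[OF C circZ(2) _ pos2])
      (use proper in \<open>auto simp: Z parts A B\<close>)
  moreover have "path_sig A1 * path_sig A2 * sig {last A, hd B} * path_sig B1 * path_sig B2 * sig {last B, hd A} = -1"
    using bad Cw[of sig] by (simp add: bad_def)
  ultimately show False
    using path_sig_cases[of A1] path_sig_cases[of A2] path_sig_cases[of B1] path_sig_cases[of B2]
      sig_cases[of "{x, y}"] sig_cases[of "{last A, hd B}"] sig_cases[of "{last B, hd A}"]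
      sig_cases[of "{last A, last B}"] sig_cases[of "{hd B, hd A}"] quad(3)
    unfolding Zw Q by (elim disjE) simp_all
qed

lemma path_crosses:
  assumes "x \<in> set M" "y \<in> set M" "P x" "\<not> P y"
  shows "\<exists>a b. {a, b} \<in> path_edges M \<and> a \<in> set M \<and> b \<in> set M \<and> P a \<and> \<not> P b"
  using assms
proof (induction M arbitrary: x y rule: path_edges.induct)
  case (3 p q zs)
  show ?case
  proof (cases "P p = P q")
    case False
    then show ?thesis by (cases "P p") (auto simp: insert_commute)
  next
    case True
    have "\<exists>x'\<in>set (q # zs). P x'" "\<exists>y'\<in>set (q # zs). \<not> P y'"
      using 3(2-5) True by (auto 0 3)
    then obtain x' y' where "x' \<in> set (q # zs)" "y' \<in> set (q # zs)" "P x'" "\<not> P y'" by blast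
    from "3.IH"[OF this] show ?thesis by auto
  qed
qed auto

text \<open>A Hamiltonian circuit that uses a chord must elsewhere pass from one side of the chord to the
  other, and it can do so only along a second chord, which crosses the first.\<close>

lemma crossing_pair:
  assumes C: "shortest_bad C" and H: "circuit H" "set H = set C"
    and new: "\<not> cycle_edges H \<subseteq> cycle_edges C"
  obtains A B where "length A \<ge> 2" "length B \<ge> 2" "shortest_bad (A @ B)" "length (A @ B) = length C"
    "set A \<union> set B = set C" "cycle_edges (A @ B) = cycle_edges C"
    "{hd A, hd B} \<in> cycle_edges H" "{last A, last B} \<in> cycle_edges H"
proof -
  obtain e where e: "e \<in> cycle_edges H" "e \<notin> cycle_edges C" using new by auto
  have Hne: "H \<noteq> []" using H by (simp add: circuit_def)
  obtain us vs where us: "H = us @ vs" "vs @ us \<noteq> []" "e = {last (vs @ us), hd (vs @ us)}"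
    using cycle_edges_closing[OF e(1) Hne] by auto
  define H' where "H' = vs @ us"
  have H': "circuit H'" "cycle_edges H' = cycle_edges H" "set H' = set C"
    using us H circuit_rotate[of us vs] cycle_edges_rotate[of us vs] by (auto simp: H'_def)
  obtain v T where T: "H' = v # T" using us(2) by (cases H') (auto simp: H'_def)
  have "T \<noteq> []" using circuit_length[OF H'(1)] T by auto
  then obtain M u where H'_eq: "H' = v # M @ [u]" using T by (cases T rule: rev_cases) auto
  have uv: "e = {u, v}" "u \<noteq> v" "adj u v"
    using us(3) H'(1) H'_eq adj_irrefl by (auto simp: H'_def[symmetric] circuit_def)
  have bad: "bad C" using C by (rule shortest_badD)
  have "u \<in> set C" using H'(3) H'_eq by auto
  then obtain p q where pq: "C = p @ u # q" by (metis split_list)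
  have C1: "shortest_bad (u # q @ p)" "cycle_edges (u # q @ p) = cycle_edges C"
    using C shortest_bad_rotate[of p "u # q"] cycle_edges_rotate[of p "u # q"] by (auto simp: pq)
  have "v \<in> set (q @ p)" using H'(3) H'_eq pq uv by auto
  then obtain X Y where XY: "q @ p = X @ v # Y" by (metis split_list)
  define C' where "C' = u # X @ v # Y"
  have C': "shortest_bad C'" "cycle_edges C' = cycle_edges C" "set C' = set C" "length C' = length C"
  proof -
    have "u # q @ p = C'" using XY by (simp add: C'_def)
    then show "shortest_bad C'" "cycle_edges C' = cycle_edges C" using C1 by simp_all
    have "set (u # q @ p) = set C" "length (u # q @ p) = length C" by (auto simp: pq)
    then show "set C' = set C" "length C' = length C" using \<open>u # q @ p = C'\<close> by simp_all
  qed
  have dC': "distinct C'" using shortest_badD[OF C'(1)] by (simp add: bad_def circuit_def)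
  have Xne: "X \<noteq> []"
  proof
    assume "X = []"
    then have "{u, v} \<in> cycle_edges C'" by (simp add: C'_def cycle_edges_def)
    then show False using e(2) uv C'(2) by simp
  qed
  have Yne: "Y \<noteq> []"
  proof
    assume "Y = []"
    then have "{u, v} \<in> cycle_edges C'" by (simp add: C'_def cycle_edges_def insert_commute)
    then show False using e(2) uv C'(2) by simp
  qed
  have setM: "set M = set X \<union> set Y"
  proof -
    have "distinct H'" using H'(1) by (simp add: circuit_def)
    then have "set M = set H' - {u, v}" using H'_eq by auto
    moreover have "set X \<union> set Y = set C' - {u, v}" using dC' by (auto simp: C'_def)
    ultimately show ?thesis using H'(3) C'(3) by simp
  qed
  have XYdisj: "set X \<inter> set Y = {}" using dC' by (auto simp: C'_def)
  obtain x0 y0 where "x0 \<in> set X" "y0 \<in> set Y" using Xne Yne by (meson last_in_set)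
  then have "\<exists>a b. {a, b} \<in> path_edges M \<and> a \<in> set M \<and> b \<in> set M \<and> a \<in> set X \<and> \<not> b \<in> set X"
    using setM XYdisj by (intro path_crosses[of x0 M y0]) auto
  then obtain x y where xy: "{x, y} \<in> path_edges M" "x \<in> set X" "y \<in> set Y" using setM by auto
  have xyH: "{x, y} \<in> cycle_edges H'"
  proof -
    have "M \<noteq> []" using xy(1) by auto
    then have "path_edges M \<subseteq> path_edges H'"
      unfolding H'_eq using path_edges_append[of M "[u]"] path_edges_Cons[of "M @ [u]" v] by auto
    then show ?thesis using xy(1) by (auto simp: cycle_edges_def)
  qed
  then have adj_xy: "adj x y" using circuit_edge_adj[OF H'(1)] by simp
  obtain X1 X2 where X: "X = X1 @ x # X2" using xy(2) by (metis split_list)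
  obtain Y1 Y2 where Y: "Y = Y1 @ y # Y2" using xy(3) by (metis split_list)
  have C'_eq: "C' = u # X1 @ x # X2 @ v # Y1 @ y # Y2" by (simp add: C'_def X Y)
  have uvH: "{u, v} \<in> cycle_edges H" using e uv by simp
  have "X2 = [] \<and> Y2 = [] \<or> X1 = [] \<and> Y1 = []"
    by (rule crossing_chords[OF _ uv(3) adj_xy]) (use C'(1) C'_eq in simp)
  then show ?thesis
  proof
    assume 2: "X2 = [] \<and> Y2 = []"
    define A B where AB: "A = u # X1 @ [x]" "B = v # Y1 @ [y]"
    have eq: "A @ B = C'" using 2 by (simp add: AB C'_eq)
    have "set A \<union> set B = set (A @ B)" by simp
    then show ?thesis
      using C' eq uvH xyH H'(2) by (intro that[of A B]) (auto simp: AB)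
  next
    assume 1: "X1 = [] \<and> Y1 = []"
    define A B where AB: "A = x # X2 @ [v]" "B = y # Y2 @ [u]"
    have eq: "C' = [u] @ (x # X2 @ v # y # Y2)" "A @ B = (x # X2 @ v # y # Y2) @ [u]"
      using 1 by (simp_all add: AB C'_eq)
    have "shortest_bad (A @ B)" "cycle_edges (A @ B) = cycle_edges C" "length (A @ B) = length C"
      "set (A @ B) = set C"
      unfolding eq using C' shortest_bad_rotate[of "[u]"] cycle_edges_rotate[of "[u]"]
      unfolding eq by auto
    then show ?thesis
      using uvH xyH H'(2) by (intro that[of A B]) (auto simp: AB insert_commute)
  qed
qed

text \<open>Equality up to the choice of the base point and of the orientation.\<close>

definition same_cycle :: "'a list \<Rightarrow> 'a list \<Rightarrow> bool" where
  "same_cycle xs ys \<longleftrightarrow> (\<exists>us vs. xs = us @ vs \<and> (ys = vs @ us \<or> ys = rev (vs @ us)))"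

lemma same_cycle_properties:
  assumes "same_cycle xs ys"
  shows "circuit ys = circuit xs" "bad ys = bad xs" "set ys = set xs" "length ys = length xs"
    and "xs \<noteq> [] \<Longrightarrow> cycle_edges ys = cycle_edges xs"
proof -
  obtain us vs where *: "xs = us @ vs" "ys = vs @ us \<or> ys = rev (vs @ us)"
    using assms by (auto simp: same_cycle_def)
  show "circuit ys = circuit xs" "bad ys = bad xs" "set ys = set xs" "length ys = length xs"
    "xs \<noteq> [] \<Longrightarrow> cycle_edges ys = cycle_edges xs"
    using * circuit_rotate[of us vs] bad_rotate[of us vs] cycle_edges_rotate[of us vs]
      circuit_rev[of "vs @ us"] bad_rev[of "vs @ us"] cycle_edges_rev[of "vs @ us"]
    by (auto simp del: rev_append)
qed

text \<open>Cut the circuit into maximal runs within \<open>A\<close> and within \<open>B\<close>. A run starts and ends at one of the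
  two boundary vertices of its side. If there were more than two runs, each would therefore be a
  single vertex, and there would be only four vertices.\<close>

lemma hamiltonian_two_paths:
  assumes H: "circuit H" "set H = set A \<union> set B" and AB: "distinct (A @ B)"
    and len: "length A \<ge> 2" "length B \<ge> 2" "length (A @ B) \<ge> 5"
    and cross: "\<And>x y. x \<in> set A \<Longrightarrow> y \<in> set B \<Longrightarrow> adj x y \<Longrightarrow>
      (x = hd A \<or> x = last A) \<and> (y = hd B \<or> y = last B)"
  obtains P R where "set P = set A" "set R = set B" "distinct P" "distinct R"
    "hd P = hd A" "last P = last A" "hd R = hd B" "last R = last B"
    "same_cycle H (P @ R) \<or> same_cycle H (P @ rev R)"
proof -
  have ne: "A \<noteq> []" "B \<noteq> []" using len by auto
  have disj: "set A \<inter> set B = {}" using AB by auto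
  have dH: "distinct H" using H by (simp add: circuit_def)
  have "hd A \<in> set H" using H ne by auto
  then obtain h1 h2 where h: "H = h1 @ hd A # h2" by (metis split_list)
  have "set (h2 @ h1) = set H - {hd A}" using dH by (auto simp: h)
  then have "\<exists>y\<in>set (h2 @ h1). y \<in> set B"
    using H ne disj by (metis DiffI Un_iff disjoint_iff hd_in_set singletonD)
  then obtain T1 y T2 where T: "h2 @ h1 = T1 @ y # T2" "y \<in> set B" "\<forall>z\<in>set T2. z \<notin> set B"
    using split_list_last_prop[of "h2 @ h1" "\<lambda>y. y \<in> set B"] by blast
  \<comment> \<open>A rotation of the circuit that starts in \<open>A\<close> and ends in \<open>B\<close>, hence at a run boundary.\<close>
  define H' where "H' = T2 @ hd A # T1 @ [y]"
  have same: "same_cycle H H'"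
  proof -
    have "rotate (length h1) H = hd A # T1 @ y # T2"
      using T(1) rotate_append[of h1 "hd A # h2"] by (simp add: h)
    then have "rotate (length (hd A # T1 @ [y])) (rotate (length h1) H) = H'"
      using rotate_append[of "hd A # T1 @ [y]" T2] by (simp add: H'_def)
    then have "H' = rotate (length (hd A # T1 @ [y]) + length h1) H" by (simp add: rotate_rotate)
    then show ?thesis unfolding same_cycle_def rotate_drop_take
      by (metis append_take_drop_id)
  qed
  note sc = same_cycle_properties[OF same]
  have H': "circuit H'" "set H' = set A \<union> set B" "distinct H'" "H' \<noteq> []"
    using sc H by (auto simp: circuit_def)
  have lenH': "length H' \<ge> 5"
    using H'(2,3) AB len by (metis distinct_card set_append)
  have ends: "hd H' \<in> set A" "last H' \<in> set B"
  proof -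
    show "last H' \<in> set B" using T(2) by (simp add: H'_def)
    have "set T2 \<subseteq> set A" using T(3) H'(2) by (auto simp: H'_def)
    then show "hd H' \<in> set A" using ne by (cases T2) (auto simp: H'_def)
  qed
  define inA where "inA x = (x \<in> set A)" for x
  define P1 D where P1: "P1 = takeWhile inA H'" "D = dropWhile inA H'"
  define R1 Rs where R1: "R1 = takeWhile (\<lambda>x. \<not> inA x) D" "Rs = dropWhile (\<lambda>x. \<not> inA x) D"
  have H'_eq: "H' = P1 @ R1 @ Rs" by (simp add: P1 R1)
  have P1A: "set P1 \<subseteq> set A" using P1 by (auto simp: inA_def dest: set_takeWhileD)
  have P1ne: "P1 \<noteq> []" using ends(1) H'(4) by (cases H') (auto simp: P1 inA_def)
  have Dne: "D \<noteq> []" using ends(2) H'(4) disj by (auto simp: P1 inA_def)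
  have "\<not> inA (hd D)" using Dne unfolding P1 by (rule hd_dropWhile)
  then have R1ne: "R1 \<noteq> []" using Dne by (cases D) (auto simp: R1)
  have R1B: "set R1 \<subseteq> set B"
    using H'(2) H'_eq set_takeWhileD[of _ "\<lambda>x. \<not> inA x" D] by (auto simp: R1(1) inA_def)
  have succ: "successively adj H'" "adj (last H') (hd H')" using H'(1) by (auto simp: circuit_def)
  have cross': "(x = hd A \<or> x = last A) \<and> (y = hd B \<or> y = last B)"
    if "adj x y \<or> adj y x" "x \<in> set A" "y \<in> set B" for x y
    using that cross adj_sym by blast
  have lastD: "last D = last H'" using Dne H'_eq P1 by (metis last_appendR takeWhile_dropWhile_id)
  have D_eq: "D = R1 @ Rs" by (simp add: R1)
  have a1: "adj (last P1) (hd R1)"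
    using succ P1ne R1ne by (auto simp: H'_eq successively_append_iff)
  have "last P1 \<in> set A" "hd R1 \<in> set B"
    using P1ne R1ne P1A R1B last_in_set[of P1] hd_in_set[of R1] by blast+
  then have c1: "last P1 = hd A \<or> last P1 = last A" "hd R1 = hd B \<or> hd R1 = last B"
    using cross'[of "last P1" "hd R1"] a1 by auto
  have "hd H' = hd P1" using P1ne by (simp add: H'_eq)
  then have c2: "hd P1 = hd A \<or> hd P1 = last A" "last H' = hd B \<or> last H' = last B"
    using cross'[of "hd H'" "last H'"] succ ends by auto
  have Rs: "Rs = []"
  proof (rule ccontr)
    assume Rsne: "Rs \<noteq> []"
    define W R2 where W: "W = takeWhile inA Rs" "R2 = dropWhile inA Rs"
    have "inA (hd Rs)" using hd_dropWhile[of "\<lambda>x. \<not> inA x" D] Rsne by (auto simp: R1)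
    then have Wne: "W \<noteq> []" using Rsne by (cases Rs) (auto simp: W)
    have lastRs: "last Rs = last H'" using lastD D_eq Rsne by simp
    have R2ne: "R2 \<noteq> []"
    proof
      assume "R2 = []"
      then have "inA (last Rs)" using Rsne last_in_set[of Rs] by (simp add: W dropWhile_eq_Nil_conv)
      then show False using lastRs ends(2) disj by (auto simp: inA_def)
    qed
    have Rs_eq: "Rs = W @ R2" by (simp add: W)
    have WA: "set W \<subseteq> set A" using W by (auto simp: inA_def dest: set_takeWhileD)
    have "\<not> inA (hd R2)" using R2ne unfolding W by (rule hd_dropWhile)
    moreover have "hd R2 \<in> set H'" using R2ne unfolding H'_eq Rs_eq by simp
    ultimately have hdR2: "hd R2 \<in> set B" unfolding H'(2) inA_def by blast
    have lastR2: "last R2 = last H'" using lastRs R2ne Rs_eq by simp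
    have adjs: "adj (last R1) (hd W)" "adj (last W) (hd R2)"
      using succ(1) P1ne R1ne Wne R2ne unfolding H'_eq Rs_eq by (simp_all add: successively_append_iff)
    have c3: "hd W = hd A \<or> hd W = last A" "last R1 = hd B \<or> last R1 = last B"
      using cross'[of "hd W" "last R1"] adjs Wne R1ne WA R1B hd_in_set[of W] last_in_set[of R1]
      by blast+
    have c4: "last W = hd A \<or> last W = last A" "hd R2 = hd B \<or> hd R2 = last B"
      using cross'[of "last W" "hd R2"] adjs Wne WA hdR2 last_in_set[of W] by blast+
    have d: "distinct P1" "distinct R1" "distinct W" "distinct R2"
      "set P1 \<inter> set W = {}" "set R1 \<inter> set R2 = {}"
      using H'(3) unfolding H'_eq Rs_eq by auto
    have n1: "hd P1 \<noteq> hd W" "hd P1 \<noteq> last W" "last P1 \<noteq> hd W" "last P1 \<noteq> last W"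
      using d(5) P1ne Wne hd_in_set last_in_set by (metis disjoint_iff)+
    have n2: "hd R1 \<noteq> hd R2" "hd R1 \<noteq> last R2" "last R1 \<noteq> hd R2" "last R1 \<noteq> last R2"
      using d(6) R1ne R2ne hd_in_set last_in_set by (metis disjoint_iff)+
    have "hd P1 = last P1" "hd W = last W" using n1 c1 c2 c3 c4 by metis+
    moreover have "hd R1 = last R1" "hd R2 = last R2" using n2 c1 c2 c3 c4 lastR2 by metis+
    ultimately have "length P1 = 1" "length W = 1" "length R1 = 1" "length R2 = 1"
      using distinct_hd_eq_last d P1ne Wne R1ne R2ne by blast+
    then have "length H' = 4" by (simp add: H'_eq Rs_eq)
    then show False using lenH' by simp
  qed
  have H'_eq: "H' = P1 @ R1" using H'_eq Rs by simp
  have sets: "set P1 = set A" "set R1 = set B" using H'(2) P1A R1B disj by (auto simp: H'_eq)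
  have d: "distinct P1" "distinct R1" using H'(3) by (auto simp: H'_eq)
  have lens: "length P1 = length A" "length R1 = length B"
    using d sets AB by (metis distinct_append distinct_card)+
  have n: "hd P1 \<noteq> last P1" "hd R1 \<noteq> last R1"
    using distinct_hd_eq_last d P1ne R1ne lens len by fastforce+
  have "last H' = last R1" using R1ne by (simp add: H'_eq)
  then have c: "hd P1 = hd A \<and> last P1 = last A \<or> hd P1 = last A \<and> last P1 = hd A"
      "hd R1 = hd B \<and> last R1 = last B \<or> hd R1 = last B \<and> last R1 = hd B"
    using c1 c2 n by metis+
  obtain us vs where uv: "H = us @ vs" "H' = vs @ us \<or> H' = rev (vs @ us)"
    using same by (auto simp: same_cycle_def)
  have rot: "same_cycle H (P1 @ R1)" "same_cycle H (rev (P1 @ R1))"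
    using uv same unfolding same_cycle_def H'_eq by (metis rev_rev_ident)+
  have rot': "same_cycle H (R @ P)" if "same_cycle H (P @ R)" for P R
  proof -
    obtain us vs where "H = us @ vs" "P @ R = vs @ us \<or> P @ R = rev (vs @ us)"
      using \<open>same_cycle H (P @ R)\<close> by (auto simp: same_cycle_def)
    then obtain n m where "P @ R = rotate n H \<or> rev (P @ R) = rotate n H"
      by (metis rev_rev_ident rotate_append)
    then have "\<exists>n. R @ P = rotate n H \<or> rev (R @ P) = rotate n H"
      by (metis rev_append rotate_append rotate_rotate)
    then show ?thesis unfolding same_cycle_def rotate_drop_take
      by (metis append_take_drop_id rev_rev_ident)
  qed
  from c show ?thesis
  proof (elim disjE)
    assume "hd P1 = hd A \<and> last P1 = last A" "hd R1 = hd B \<and> last R1 = last B"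
    then show ?thesis using that[of P1 R1] sets d rot by blast
  next
    assume "hd P1 = hd A \<and> last P1 = last A" "hd R1 = last B \<and> last R1 = hd B"
    then show ?thesis using that[of P1 "rev R1"] sets d rot P1ne R1ne by (simp add: hd_rev last_rev)
  next
    assume *: "hd P1 = last A \<and> last P1 = hd A" "hd R1 = hd B \<and> last R1 = last B"
    have "same_cycle H (rev P1 @ rev R1)" using rot'[of "rev R1" "rev P1"] rot(2) by simp
    then show ?thesis using that[of "rev P1" "R1"] * sets d P1ne R1ne by (simp add: hd_rev last_rev)
  next
    assume *: "hd P1 = last A \<and> last P1 = hd A" "hd R1 = last B \<and> last R1 = hd B"
    have "same_cycle H (rev P1 @ rev R1)" using rot'[of "rev R1" "rev P1"] rot(2) by simp
    then show ?thesis using that[of "rev P1" "rev R1"] * sets d P1ne R1ne by (simp add: hd_rev last_rev)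
  qed
qed

end

section \<open>Exchanging two edges of a Hamiltonian circuit\<close>

text \<open>The members of \<open>F\<close> that contain \<open>X\<close> split into those that contain \<open>D0\<close> and those that contain
  \<open>D1\<close>, and the exchange is a bijection between the two parts. So the sum is \<open>1 + s\<close> times the sum
  over the members that contain \<open>X \<union> D0\<close>, of which there are fewer. The set \<open>X\<close> collects the
  choices that have been made; both exchanged sets are disjoint from it, because \<open>C\<close> and \<open>H\<close> both
  contain it.\<close>

lemma toggle_sum_nonzero:
  fixes F :: "'e set set" and W :: "'e set \<Rightarrow> real"
  assumes fin: "finite F" and W: "\<And>Z. Z \<in> F \<Longrightarrow> W Z \<noteq> 0"
    and toggle: "\<And>C H. C \<in> F \<Longrightarrow> H \<in> F \<Longrightarrow> C \<noteq> H \<Longrightarrow>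
      \<exists>D0 D1 s. s \<noteq> -1 \<and> D0 \<noteq> {} \<and> D1 \<noteq> {} \<and> D0 \<subseteq> C \<and> D1 \<subseteq> H \<and>
        (\<forall>Z\<in>F. (D0 \<subseteq> Z \<and> D1 \<inter> Z = {} \<and> Z - D0 \<union> D1 \<in> F \<and> W (Z - D0 \<union> D1) = s * W Z) \<or>
                (D1 \<subseteq> Z \<and> D0 \<inter> Z = {} \<and> Z - D1 \<union> D0 \<in> F))"
    and "C \<in> F" "X \<subseteq> C"
  shows "(\<Sum>Z\<in>{Z\<in>F. X \<subseteq> Z}. W Z) \<noteq> 0"
  using \<open>X \<subseteq> C\<close>
proof (induction "card {Z\<in>F. X \<subseteq> Z}" arbitrary: X rule: less_induct)
  case less
  let ?F = "\<lambda>X. {Z\<in>F. X \<subseteq> Z}"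
  show ?case
  proof (cases "?F X = {C}")
    case True
    then show ?thesis using W[OF \<open>C \<in> F\<close>] by simp
  next
    case False
    then obtain H where H: "H \<in> F" "X \<subseteq> H" "C \<noteq> H" using less.prems \<open>C \<in> F\<close> by auto
    obtain D0 D1 s where s: "s \<noteq> -1" "D0 \<noteq> {}" "D1 \<noteq> {}" "D0 \<subseteq> C" "D1 \<subseteq> H"
      and "\<forall>Z\<in>F. (D0 \<subseteq> Z \<and> D1 \<inter> Z = {} \<and> Z - D0 \<union> D1 \<in> F \<and> W (Z - D0 \<union> D1) = s * W Z) \<or>
        (D1 \<subseteq> Z \<and> D0 \<inter> Z = {} \<and> Z - D1 \<union> D0 \<in> F)"
      using toggle[OF \<open>C \<in> F\<close> H(1,3)] by (elim exE conjE) (rule that)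
    note D = bspec[OF this(6)]
    have disj: "D1 \<inter> C = {}" "D0 \<inter> H = {}" using D[OF \<open>C \<in> F\<close>] D[OF H(1)] s by blast+
    then have X: "X \<inter> D0 = {}" "X \<inter> D1 = {}" using less.prems H by auto
    have D01: "D0 \<inter> D1 = {}" using disj s by auto
    have in0: "D0 \<subseteq> Z \<Longrightarrow> Z \<in> F \<Longrightarrow> D1 \<inter> Z = {} \<and> Z - D0 \<union> D1 \<in> F \<and> W (Z - D0 \<union> D1) = s * W Z" for Z
      using D[of Z] s(2) by blast
    have in1: "D1 \<subseteq> Z \<Longrightarrow> Z \<in> F \<Longrightarrow> D0 \<inter> Z = {} \<and> Z - D1 \<union> D0 \<in> F" for Z
      using D[of Z] s(3) by blast
    have split: "?F X = ?F (X \<union> D0) \<union> ?F (X \<union> D1)" using D by blast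
    have "(\<Sum>Z\<in>?F (X \<union> D1). W Z) = (\<Sum>Z\<in>?F (X \<union> D0). s * W Z)"
    proof (rule sum.reindex_bij_witness[where i = "\<lambda>Z. Z - D0 \<union> D1" and j = "\<lambda>Z. Z - D1 \<union> D0"])
      fix Z assume "Z \<in> ?F (X \<union> D1)"
      then have Z: "Z \<in> F" "X \<subseteq> Z" "D1 \<subseteq> Z" by auto
      note Z1 = in1[OF Z(3,1)]
      show inverse: "Z - D1 \<union> D0 - D0 \<union> D1 = Z" using Z Z1 by blast
      show "Z - D1 \<union> D0 \<in> ?F (X \<union> D0)" using Z Z1 X by blast
      then have "W (Z - D1 \<union> D0 - D0 \<union> D1) = s * W (Z - D1 \<union> D0)" using in0 by blast
      then show "s * W (Z - D1 \<union> D0) = W Z" using inverse by simp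
    next
      fix Z assume "Z \<in> ?F (X \<union> D0)"
      then have Z: "Z \<in> F" "X \<subseteq> Z" "D0 \<subseteq> Z" by auto
      note Z0 = in0[OF Z(3,1)]
      show "Z - D0 \<union> D1 - D1 \<union> D0 = Z" using Z Z0 by blast
      show "Z - D0 \<union> D1 \<in> ?F (X \<union> D1)" using Z Z0 X by blast
    qed
    moreover have "?F (X \<union> D0) \<inter> ?F (X \<union> D1) = {}" using in0 s(3) by blast
    ultimately have "(\<Sum>Z\<in>?F X. W Z) = (\<Sum>Z\<in>?F (X \<union> D0). W Z) + s * (\<Sum>Z\<in>?F (X \<union> D0). W Z)"
      using fin unfolding split by (subst sum.union_disjoint) (auto simp: sum_distrib_left)
    also have "\<dots> = (1 + s) * (\<Sum>Z\<in>?F (X \<union> D0). W Z)" by (simp add: algebra_simps)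
    finally have eq: "(\<Sum>Z\<in>?F X. W Z) = (1 + s) * (\<Sum>Z\<in>?F (X \<union> D0). W Z)" .
    have "H \<in> ?F X" "H \<notin> ?F (X \<union> D0)" using H disj(2) s(2) by auto
    then have "?F (X \<union> D0) \<subset> ?F X" by auto
    then have "card (?F (X \<union> D0)) < card (?F X)" using fin by (intro psubset_card_mono) auto
    moreover have "X \<union> D0 \<subseteq> C" using less.prems s by auto
    ultimately have "(\<Sum>Z\<in>?F (X \<union> D0). W Z) \<noteq> 0" by (rule less.hyps)
    then show ?thesis using eq s(1) by auto
  qed
qed

context signed_graph
begin

lemma bad_cong_edges:
  assumes "bad xs" "circuit ys" "length ys \<ge> 3" "cycle_edges ys = cycle_edges xs"
  shows "bad ys"
proof -
  have "distinct xs" "distinct ys" using assms by (auto simp: bad_def circuit_def)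
  then have "cycle_prod f ys = cycle_prod f xs" for f :: "'a set \<Rightarrow> real"
    using prod_cycle_edges[of xs f] prod_cycle_edges[of ys f] assms bad_length[of xs] by simp
  then show ?thesis using assms by (simp add: bad_def)
qed

lemma circuit_card: "circuit xs \<Longrightarrow> length xs = card (set xs)"
  by (simp add: circuit_def distinct_card)

lemma hamiltonian_card_edges:
  assumes "circuit H" "set H = set C" "bad C"
  shows "card (cycle_edges H) = length C" "length H = length C" "length H \<ge> 3"
proof -
  show *: "length H = length C"
    using assms circuit_card[of H] circuit_card[of C] by (simp add: bad_def)
  then show "length H \<ge> 3" using bad_length[OF assms(3)] by simp
  then show "card (cycle_edges H) = length C" using assms * by (simp add: card_cycle_edges circuit_def)
qed

end

text \<open>The circuit \<open>A @ B\<close> admits a two-opt move: its two edges between the paths \<open>A\<close> and \<open>B\<close> can be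
  replaced by the chords that join their first and their last vertices.\<close>

locale two_opt = signed_graph +
  fixes A B :: "'a list"
  assumes shortest: "shortest_bad (A @ B)" and lenA: "length A \<ge> 2" and lenB: "length B \<ge> 2"
    and len: "length (A @ B) \<ge> 5"
    and e: "adj (hd A) (hd B)" and f: "adj (last A) (last B)"
begin

definition "old_edges = {{last A, hd B}, {last B, hd A}}"
definition "new_edges = {{hd A, hd B}, {last A, last B}}"

text \<open>The pairs of paths out of which all Hamiltonian circuits are composed: \<open>P @ R\<close> uses the old and
  \<open>P @ rev R\<close> the new edges between the two sides.\<close>

definition rerouting :: "'a list \<Rightarrow> 'a list \<Rightarrow> bool" where
  "rerouting P R \<longleftrightarrow> set P = set A \<and> set R = set B \<and> distinct P \<and> distinct R \<and>
    successively adj P \<and> successively adj R \<and>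
    hd P = hd A \<and> last P = last A \<and> hd R = hd B \<and> last R = last B"

lemma ne: "A \<noteq> []" "B \<noteq> []" using lenA lenB by auto

lemma circuit_AB: "circuit (A @ B)" using shortest_badD[OF shortest] by (simp add: bad_def)

lemma disjoint: "distinct A" "distinct B" "set A \<inter> set B = {}"
  using circuit_AB by (auto simp: circuit_def)

lemma old_adj: "adj (last A) (hd B)" "adj (last B) (hd A)"
  using circuit_AB circuit_append[OF ne] by auto

lemma ends_distinct: "hd A \<noteq> last A" "hd B \<noteq> last B"
  using distinct_hd_eq_last disjoint lenA lenB ne by fastforce+

lemma ends_in: "hd A \<in> set A" "last A \<in> set A" "hd B \<in> set B" "last B \<in> set B"
  using ne by auto

lemma ends_sep: "hd A \<noteq> hd B" "hd A \<noteq> last B" "last A \<noteq> hd B" "last A \<noteq> last B"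
  using ends_in disjoint(3) by auto

lemma rerouting_ne: "rerouting P R \<Longrightarrow> P \<noteq> [] \<and> R \<noteq> []"
  using ne by (auto simp: rerouting_def)

lemma rerouting_AB: "rerouting A B"
  using circuit_AB circuit_append[OF ne] disjoint by (auto simp: rerouting_def)

lemma rerouting_restore_tail: "rerouting P R \<Longrightarrow> rerouting P B"
  using rerouting_AB by (auto simp: rerouting_def)

lemma rerouting_circuits:
  assumes "rerouting P R"
  shows "circuit (P @ R)" "circuit (P @ rev R)" "set (P @ R) = set (A @ B)" "set (P @ rev R) = set (A @ B)"
  using assms rerouting_ne[OF assms] disjoint old_adj e f adj_sym unfolding rerouting_def
  by (simp_all add: circuit_append hd_rev last_rev)

lemma rerouting_edges:
  assumes "rerouting P R"
  shows "cycle_edges (P @ R) = old_edges \<union> (path_edges P \<union> path_edges R)"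
    and "cycle_edges (P @ rev R) = new_edges \<union> (path_edges P \<union> path_edges R)"
    and "(path_edges P \<union> path_edges R) \<inter> old_edges = {}"
    and "(path_edges P \<union> path_edges R) \<inter> new_edges = {}"
proof -
  note ne' = rerouting_ne[OF assms]
  have ends: "hd P = hd A" "last P = last A" "hd R = hd B" "last R = last B" "set P = set A" "set R = set B"
    using assms by (auto simp: rerouting_def)
  show "cycle_edges (P @ R) = old_edges \<union> (path_edges P \<union> path_edges R)"
    "cycle_edges (P @ rev R) = new_edges \<union> (path_edges P \<union> path_edges R)"
    using ne' ends
    by (auto simp: cycle_edges_append path_edges_rev hd_rev last_rev old_edges_def new_edges_def
        insert_commute)
  have no: "{x, y} \<notin> path_edges P \<union> path_edges R" if "x \<in> set A" "y \<in> set B" for x y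
    using path_edges_subset[of "{x, y}" P] path_edges_subset[of "{x, y}" R] that disjoint(3)
    unfolding ends by auto
  show "(path_edges P \<union> path_edges R) \<inter> old_edges = {}"
    "(path_edges P \<union> path_edges R) \<inter> new_edges = {}"
    using no[of "last A" "hd B"] no[of "hd A" "last B"] no[of "hd A" "hd B"] no[of "last A" "last B"] ends_in
    by (auto simp: old_edges_def new_edges_def insert_commute)
qed

lemma old_new_disjoint: "old_edges \<inter> new_edges = {}"
  using ends_distinct ends_sep by (auto simp: old_edges_def new_edges_def doubleton_eq_iff)

lemma rerouting_weight:
  assumes "rerouting P R"
  shows "cycle_weight w (P @ R) =
      path_weight w P * w (last A) (hd B) * path_weight w R * w (last B) (hd A)"
    and "cycle_weight w (P @ rev R) =
      path_weight w P * w (last A) (last B) * path_weight (\<lambda>x y. w y x) R * w (hd B) (hd A)"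
  using assms rerouting_ne[OF assms] unfolding rerouting_def
  by (auto simp: cycle_weight_append hd_rev last_rev path_weight_rev)

lemmas quadrangle = two_opt_quadrangle[OF shortest lenA lenB len e f]

text \<open>The two circuits differ by the quadrangle, which is positive and good.\<close>

lemma rerouting_bad:
  assumes "rerouting P R"
  shows "bad (P @ rev R) = bad (P @ R)"
proof -
  have *: "cycle_prod g (P @ rev R) = cycle_prod g (P @ R)"
    if g: "\<And>e. g e * g e = 1" and quad: "cycle_prod g [hd A, hd B, last A, last B] = 1"
    for g :: "'a set \<Rightarrow> real"
  proof -
    have Q: "g {hd A, hd B} * g {last A, last B} * (g {last A, hd B} * g {last B, hd A}) = 1"
      using quad by (simp add: cycle_weight_def insert_commute mult_ac)
    have "g {last A, hd B} * g {last B, hd A} =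
        g {last A, hd B} * g {last B, hd A} *
          (g {hd A, hd B} * g {last A, last B} * (g {last A, hd B} * g {last B, hd A}))"
      unfolding Q by simp
    also have "\<dots> = (g {last A, hd B} * g {last A, hd B}) * (g {last B, hd A} * g {last B, hd A}) *
        (g {hd A, hd B} * g {last A, last B})" by (simp only: mult_ac)
    finally have "g {last A, hd B} * g {last B, hd A} = g {hd A, hd B} * g {last A, last B}"
      using g by simp
    then have "path_prod g P * path_prod g R * (g {last A, hd B} * g {last B, hd A})
       = path_prod g P * path_prod g R * (g {hd A, hd B} * g {last A, last B})"
      by simp
    moreover have "path_weight (\<lambda>x y. g {y, x}) R = path_prod g R"
      by (simp add: insert_commute)
    moreover have "g {hd B, hd A} = g {hd A, hd B}" by (simp add: insert_commute)
    ultimately show ?thesis unfolding rerouting_weight[OF assms] by (simp only: mult_ac)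
  qed
  show ?thesis unfolding bad_def
    using *[of eps, OF eps_sq quadrangle(2)] *[of sig, OF sig_sq quadrangle(3)] rerouting_circuits[OF assms]
    by simp
qed

lemma hamiltonian_rerouting:
  assumes "circuit H" "set H = set (A @ B)"
  obtains P R where "rerouting P R" "same_cycle H (P @ R) \<or> same_cycle H (P @ rev R)"
proof -
  have cross: "(x = hd A \<or> x = last A) \<and> (y = hd B \<or> y = last B)"
    if "x \<in> set A" "y \<in> set B" "adj x y" for x y
    using four_cut[OF shortest lenA lenB len e f that] .
  obtain P R where PR: "set P = set A" "set R = set B" "distinct P" "distinct R"
    "hd P = hd A" "last P = last A" "hd R = hd B" "last R = last B"
    "same_cycle H (P @ R) \<or> same_cycle H (P @ rev R)"
    using hamiltonian_two_paths[of H A B] assms circuit_AB lenA lenB len cross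
    by (auto simp: circuit_def)
  have "P \<noteq> []" "R \<noteq> []" using PR ne by auto
  then have "circuit (P @ R) \<or> circuit (P @ rev R) \<Longrightarrow> successively adj P \<and> successively adj R"
    by (auto simp: circuit_append)
  then have "successively adj P \<and> successively adj R"
    using PR(9) same_cycle_properties(1) assms(1) by blast
  then show ?thesis using that[of P R] PR by (auto simp: rerouting_def)
qed

end

context signed_graph
begin

lemma crossing_two_opt:
  assumes C: "shortest_bad C" "length C \<noteq> 4" and H: "circuit H" "set H = set C"
    and new: "\<not> cycle_edges H \<subseteq> cycle_edges C"
  obtains A B where "two_opt adj eps sig A B" "set (A @ B) = set C" "cycle_edges (A @ B) = cycle_edges C"
    "{hd A, hd B} \<in> cycle_edges H" "{last A, last B} \<in> cycle_edges H"
proof -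
  obtain A B where AB: "length A \<ge> 2" "length B \<ge> 2" "shortest_bad (A @ B)" "length (A @ B) = length C"
    "set A \<union> set B = set C" "cycle_edges (A @ B) = cycle_edges C"
    "{hd A, hd B} \<in> cycle_edges H" "{last A, last B} \<in> cycle_edges H"
    using crossing_pair[OF C(1) H new] by metis
  have "length (A @ B) \<ge> 5" using AB(1,2,4) C(2) by simp
  then have "two_opt adj eps sig A B"
    using AB circuit_edge_adj[OF H(1)] by unfold_locales auto
  then show ?thesis using that[of A B] AB by simp
qed

text \<open>A Hamiltonian circuit with an edge outside \<open>C\<close> uses the new edges of some two-opt exchange.
  Undoing the exchange preserves badness and leaves fewer edges outside \<open>C\<close>.\<close>

lemma all_hamiltonian_bad:
  assumes C: "shortest_bad C" "length C \<noteq> 4"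
  shows "circuit H \<Longrightarrow> set H = set C \<Longrightarrow> bad H"
proof (induction "card (cycle_edges H - cycle_edges C)" arbitrary: H rule: less_induct)
  case less
  note bad = shortest_badD[OF C(1)]
  note card = hamiltonian_card_edges[OF less.prems bad]
  show ?case
  proof (cases "cycle_edges H \<subseteq> cycle_edges C")
    case True
    have "card (cycle_edges C) = length C"
      using hamiltonian_card_edges[of C C] bad by (simp add: bad_def)
    then have "cycle_edges H = cycle_edges C" using True card by (intro card_subset_eq) auto
    then show ?thesis using bad_cong_edges[OF bad less.prems(1)] card by simp
  next
    case False
    obtain A B where "two_opt adj eps sig A B" and AB: "set (A @ B) = set C"
      "cycle_edges (A @ B) = cycle_edges C"
      "{hd A, hd B} \<in> cycle_edges H" "{last A, last B} \<in> cycle_edges H"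
      using crossing_two_opt[OF C less.prems False] by metis
    interpret two_opt adj eps sig A B by fact
    obtain P R where PR: "rerouting P R" "same_cycle H (P @ R) \<or> same_cycle H (P @ rev R)"
      using hamiltonian_rerouting[OF less.prems(1)] less.prems(2) AB(1) by metis
    have Hne: "H \<noteq> []" using less.prems by (simp add: circuit_def)
    note edges = rerouting_edges[OF PR(1)]
    have new: "new_edges \<subseteq> cycle_edges H" using AB by (simp add: new_edges_def)
    have old: "old_edges \<subseteq> cycle_edges C"
      using rerouting_edges(1)[OF rerouting_AB] AB(2) by auto
    have "new_edges \<inter> cycle_edges C = {}"
      using rerouting_edges(1,4)[OF rerouting_AB] AB(2) old_new_disjoint by auto
    have "\<not> same_cycle H (P @ R)"
    proof
      assume "same_cycle H (P @ R)"
      then have "new_edges \<subseteq> cycle_edges (P @ R)" using same_cycle_properties(5) Hne new by metis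
      then show False using edges old_new_disjoint by (auto simp: new_edges_def)
    qed
    then have same: "same_cycle H (P @ rev R)" using PR(2) by simp
    note sc = same_cycle_properties[OF same]
    have ce: "cycle_edges (P @ R) - cycle_edges C = cycle_edges H - cycle_edges C - new_edges"
      using edges sc(5)[OF Hne] old by auto
    have "{hd A, hd B} \<in> (cycle_edges H - cycle_edges C) \<inter> new_edges"
      using \<open>new_edges \<inter> cycle_edges C = {}\<close> new by (auto simp: new_edges_def)
    then have "cycle_edges H - cycle_edges C - new_edges \<subset> cycle_edges H - cycle_edges C" by auto
    then have "card (cycle_edges (P @ R) - cycle_edges C) < card (cycle_edges H - cycle_edges C)"
      unfolding ce by (intro psubset_card_mono) auto
    then have "bad (P @ R)"
      using less.hyps rerouting_circuits[OF PR(1)] AB(1) by metis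
    then show ?thesis using rerouting_bad[OF PR(1)] sc(2) by simp
  qed
qed

end

section \<open>The sum over the bad Hamiltonian circuits\<close>

locale generic_weights = signed_graph +
  fixes V :: "'a set" and k :: "'a \<Rightarrow> 'a \<Rightarrow> real"
  assumes adj_iff: "adj x y \<longleftrightarrow> x \<in> V \<and> y \<in> V \<and> x \<noteq> y \<and> k x y \<noteq> 0"
    and k_swap: "x \<in> V \<Longrightarrow> y \<in> V \<Longrightarrow> k y x = eps {x, y} * k x y"
    and generic_products: "distinct [i, j, l, m] \<Longrightarrow> adj i j \<Longrightarrow> adj j l \<Longrightarrow> adj l m \<Longrightarrow> adj m i \<Longrightarrow>
      \<bar>k i j * k l m\<bar> \<noteq> \<bar>k j l * k m i\<bar>"
    and generic_signed_sums: "distinct [i, j, l, m] \<Longrightarrow> adj i j \<Longrightarrow> adj j l \<Longrightarrow> adj l m \<Longrightarrow> adj m i \<Longrightarrow>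
      k i j * k j l * k l m * k m i + k i j * k j m * k m l * k l i + k i l * k l j * k j m * k m i \<noteq> 0"
begin

lemma circuit_vertices: assumes "circuit xs" shows "set xs \<subseteq> V"
proof
  fix x assume "x \<in> set xs"
  then obtain us vs where xs: "xs = us @ x # vs" by (metis split_list)
  have "circuit (x # vs @ us)" using assms circuit_rotate[of us "x # vs"] by (simp add: xs)
  then have "adj (last (x # vs @ us)) x" by (simp add: circuit_def)
  then show "x \<in> V" by (simp add: adj_iff)
qed

lemma circuit_weight_nonzero: assumes "circuit xs" shows "cycle_weight k xs \<noteq> 0"
proof -
  have "successively (\<lambda>x y. k x y \<noteq> 0) xs"
    using assms by (auto simp: circuit_def adj_iff elim!: successively_mono)
  then show ?thesis
    using assms by (simp add: cycle_weight_def successively_imp_path_weight_nonzero circuit_def adj_iff)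
qed

lemma cycle_weight_swapped:
  assumes "set xs \<subseteq> V" "xs \<noteq> []"
  shows "cycle_weight (\<lambda>x y. k y x) xs = cycle_eps xs * cycle_weight k xs"
proof -
  have "cycle_weight (\<lambda>x y. k y x) xs = cycle_weight (\<lambda>x y. eps {x, y} * k x y) xs"
    using assms k_swap by (intro cycle_weight_cong) auto
  then show ?thesis by (simp add: cycle_weight_mult)
qed

lemma path_weight_swapped:
  assumes "set xs \<subseteq> V"
  shows "path_weight (\<lambda>x y. k y x) xs = path_eps xs * path_weight k xs"
proof -
  have "path_weight (\<lambda>x y. k y x) xs = path_weight (\<lambda>x y. eps {x, y} * k x y) xs"
    using assms k_swap by (intro path_weight_cong) auto
  then show ?thesis by (simp add: path_weight_mult)
qed

lemma bad_reverse_keeping_head: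
  assumes "xs \<noteq> []" shows "bad (reverse_keeping_head xs) = bad xs"
proof -
  obtain x ys where xs: "xs = x # ys" using assms by (cases xs) auto
  have "reverse_keeping_head xs = [x] @ rev ys" "rev xs = rev ys @ [x]"
    by (simp_all add: xs reverse_keeping_head_def)
  then show ?thesis using bad_rev[of xs] bad_rotate[of "[x]" "rev ys"] by simp
qed

lemma bad_weight_reverse_keeping_head:
  assumes "bad xs" shows "cycle_weight k (reverse_keeping_head xs) = cycle_weight k xs"
proof -
  have "xs \<noteq> []" "set xs \<subseteq> V" using assms circuit_vertices by (auto simp: bad_def circuit_def)
  then show ?thesis
    using reverse_keeping_head(8)[of xs k] cycle_weight_swapped[of xs] assms by (simp add: bad_def)
qed

text \<open>The prescribed head \<open>s\<close> makes every oriented circuit occur exactly once.\<close>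

definition hamiltonian_bad :: "'a set \<Rightarrow> 'a \<Rightarrow> 'a list set" where
  "hamiltonian_bad S s = {xs. bad xs \<and> set xs = S \<and> hd xs = s}"

lemma finite_hamiltonian_bad: "finite S \<Longrightarrow> finite (hamiltonian_bad S s)"
  by (rule finite_subset[OF _ finite_subset_distinct[of S]])
    (auto simp: hamiltonian_bad_def bad_def circuit_def)

text \<open>The two orientations of a bad circuit have equal weights, so this is twice its weight.\<close>

definition edge_set_weight :: "'a set \<Rightarrow> 'a \<Rightarrow> 'a set set \<Rightarrow> real" where
  "edge_set_weight S s Z = (\<Sum>xs\<in>{xs \<in> hamiltonian_bad S s. cycle_edges xs = Z}. cycle_weight k xs)"

lemma edge_set_weight_eq:
  assumes "bad xs" "s \<in> set xs"
  shows "edge_set_weight (set xs) s (cycle_edges xs) = 2 * cycle_weight k xs"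
proof -
  obtain us vs where xs: "xs = us @ s # vs" using assms(2) by (metis split_list)
  define ys where "ys = (s # vs) @ us"
  have ys: "bad ys" "cycle_edges ys = cycle_edges xs" "cycle_weight k ys = cycle_weight k xs"
    "set ys = set xs" "hd ys = s" "ys \<noteq> []"
    using assms bad_rotate[of us "s # vs"] cycle_edges_rotate[of us "s # vs"]
      cycle_weight_rotate[of k us "s # vs"] by (auto simp: xs ys_def)
  have d: "distinct ys" "length ys \<ge> 3" using ys bad_length by (auto simp: bad_def circuit_def)
  have "{zs \<in> hamiltonian_bad (set xs) s. cycle_edges zs = cycle_edges xs} = {ys, reverse_keeping_head ys}"
  proof (intro equalityI subsetI)
    fix zs assume "zs \<in> {zs \<in> hamiltonian_bad (set xs) s. cycle_edges zs = cycle_edges xs}"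
    then have zs: "bad zs" "set zs = set ys" "hd zs = hd ys" "cycle_edges zs = cycle_edges ys"
      using ys by (auto simp: hamiltonian_bad_def)
    then have "distinct zs" by (simp add: bad_def circuit_def)
    moreover from this have "length zs = length ys" using zs(2) d(1) by (metis distinct_card)
    ultimately have "zs = ys \<or> zs = reverse_keeping_head ys"
      using zs d by (intro same_cycle_edges_same_head) auto
    then show "zs \<in> {ys, reverse_keeping_head ys}" by simp
  next
    fix zs assume "zs \<in> {ys, reverse_keeping_head ys}"
    then show "zs \<in> {zs \<in> hamiltonian_bad (set xs) s. cycle_edges zs = cycle_edges xs}"
      using ys reverse_keeping_head[OF ys(6)] bad_reverse_keeping_head[OF ys(6)]
      by (auto simp: hamiltonian_bad_def)
  qed
  then show ?thesis
    using reverse_keeping_head_neq[OF d] bad_weight_reverse_keeping_head[OF ys(1)] ys(3)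
    by (auto simp: edge_set_weight_def)
qed

lemma sum_hamiltonian_bad:
  assumes "finite S"
  shows "(\<Sum>xs\<in>hamiltonian_bad S s. cycle_weight k xs) =
    (\<Sum>Z\<in>cycle_edges ` hamiltonian_bad S s. edge_set_weight S s Z)"
  unfolding edge_set_weight_def
  by (rule sum.image_gen[OF finite_hamiltonian_bad[OF assms]])

text \<open>Up to orientation there are three Hamiltonian circuits on four vertices. If all of them are bad,
  the sum is excluded by the second genericity condition. Any two of them share a pair of opposite
  edges; if their weights cancelled, the products of the two remaining pairs would have the same
  magnitude, although these pairs form the third circuit.\<close>

lemma sum_hamiltonian_bad_nonzero_4:
  assumes C: "bad C" "length C = 4" and s: "s \<in> set C"
  shows "(\<Sum>xs\<in>hamiltonian_bad (set C) s. cycle_weight k xs) \<noteq> 0"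
proof -
  obtain us vs where us: "C = us @ s # vs" using s by (metis split_list)
  obtain l where l: "l = vs @ us" by simp
  then have "length l = 3" using C(2) us by simp
  then obtain a b c where "l = [a, b, c]" by (auto simp: length_Suc_conv numeral_3_eq_3)
  then have abc: "vs @ us = [a, b, c]" using l by simp
  have badC: "bad [s, a, b, c]" using C(1) bad_rotate[of us "s # vs"] abc by (simp add: us)
  have setC: "set C = {s, a, b, c}"
  proof -
    have "set C = insert s (set (vs @ us))" by (auto simp: us)
    then show ?thesis by (simp add: abc)
  qed
  have d: "distinct [s, a, b, c]" using badC by (simp add: bad_def circuit_def)
  have inV: "{s, a, b, c} \<subseteq> V" using circuit_vertices[of "[s, a, b, c]"] badC by (simp add: bad_def)
  define t where "t xs = (if bad xs then cycle_weight k xs else 0)" for xs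
  have t_rev: "t (reverse_keeping_head xs) = t xs" if "xs \<noteq> []" for xs
    using bad_weight_reverse_keeping_head[of xs] bad_reverse_keeping_head[OF that] by (simp add: t_def)
  define L where "L = {xs. distinct xs \<and> set xs = {s, a, b, c} \<and> hd xs = s}"
  have L: "L = {[s,a,b,c], [s,c,b,a], [s,a,c,b], [s,b,c,a], [s,b,a,c], [s,c,a,b]}"
  proof (intro equalityI subsetI)
    fix xs assume "xs \<in> L"
    then have xs: "distinct xs" "set xs = {s, a, b, c}" "hd xs = s" by (auto simp: L_def)
    then have "length xs = 4" using d distinct_card[of xs] by simp
    then obtain p q r where "xs = [s, p, q, r]" using xs(3)
      by (auto simp: length_Suc_conv numeral_eq_Suc)
    moreover have "p \<in> {a, b, c}" "q \<in> {a, b, c}" "r \<in> {a, b, c}"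
      using xs \<open>xs = [s, p, q, r]\<close> by auto
    ultimately show "xs \<in> {[s,a,b,c], [s,c,b,a], [s,a,c,b], [s,b,c,a], [s,b,a,c], [s,c,a,b]}"
      using xs(1) by auto
  qed (use d in \<open>auto simp: L_def\<close>)
  have "finite L" by (simp add: L)
  have "(\<Sum>xs\<in>hamiltonian_bad (set C) s. cycle_weight k xs) = (\<Sum>xs\<in>L. t xs)"
    using \<open>finite L\<close> by (intro sum.mono_neutral_cong_left)
      (auto simp: hamiltonian_bad_def setC L_def t_def bad_def circuit_def)
  also have "\<dots> = t [s,a,b,c] + t [s,c,b,a] + t [s,a,c,b] + t [s,b,c,a] + t [s,b,a,c] + t [s,c,a,b]"
    unfolding L using d by (simp add: insert_commute)
  also have "\<dots> = 2 * (t [s,a,b,c] + t [s,a,c,b] + t [s,b,a,c])"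
    using t_rev[of "[s,a,b,c]"] t_rev[of "[s,a,c,b]"] t_rev[of "[s,b,a,c]"]
    by (simp add: reverse_keeping_head_def)
  finally have sum: "(\<Sum>xs\<in>hamiltonian_bad (set C) s. cycle_weight k xs) =
      2 * (t [s,a,b,c] + t [s,a,c,b] + t [s,b,a,c])" .
  have w: "cycle_weight k [x, y, z, v] = k x y * k y z * k z v * k v x" for x y z v
    by (simp add: cycle_weight_def)
  have nz: "t [s,a,b,c] \<noteq> 0" using badC circuit_weight_nonzero by (simp add: t_def bad_def)
  have adjC: "adj s a" "adj a b" "adj b c" "adj c s" using badC by (auto simp: bad_def circuit_def)
  have eps_abs: "\<bar>k y x\<bar> = \<bar>k x y\<bar>" if "x \<in> V" "y \<in> V" for x y
    using k_swap[OF that] eps_cases[of "{x, y}"] by auto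
  have t1: "t [s,a,b,c] = k s a * k a b * k b c * k c s" using badC by (simp add: t_def w)
  have "t [s,a,b,c] + t [s,a,c,b] + t [s,b,a,c] \<noteq> 0"
  proof (cases "bad [s,a,c,b]")
    case b2: True
    then have t2: "t [s,a,c,b] = k s a * k a c * k c b * k b s" by (simp add: t_def w)
    have adj2: "adj a c" "adj c b" "adj b s" using b2 by (auto simp: bad_def circuit_def)
    show ?thesis
    proof (cases "bad [s,b,a,c]")
      case True
      then have "t [s,b,a,c] = k s b * k b a * k a c * k c s" by (simp add: t_def w)
      then show ?thesis using t1 t2 generic_signed_sums[of s a b c] d adjC by simp
    next
      case False
      have "\<bar>t [s,a,b,c]\<bar> \<noteq> \<bar>t [s,a,c,b]\<bar>"
      proof
        assume "\<bar>t [s,a,b,c]\<bar> = \<bar>t [s,a,c,b]\<bar>"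
        then have "\<bar>k s a\<bar> * \<bar>k b c\<bar> * (\<bar>k a b\<bar> * \<bar>k c s\<bar>) = \<bar>k s a\<bar> * \<bar>k b c\<bar> * (\<bar>k a c\<bar> * \<bar>k b s\<bar>)"
          using eps_abs[of b c] inV by (auto simp: t1 t2 abs_mult mult_ac)
        moreover have "\<bar>k s a\<bar> * \<bar>k b c\<bar> \<noteq> 0" using adjC by (simp add: adj_iff)
        ultimately have "\<bar>k a b\<bar> * \<bar>k c s\<bar> = \<bar>k a c\<bar> * \<bar>k b s\<bar>" by simp
        then have "\<bar>k a b * k s c\<bar> = \<bar>k b s * k c a\<bar>"
          using eps_abs[of s c] eps_abs[of a c] inV by (simp add: abs_mult mult_ac)
        then show False
          using generic_products[of a b s c] d adjC adj2 adj_sym by auto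
      qed
      then show ?thesis using False by (auto simp: t_def)
    qed
  next
    case b2: False
    show ?thesis
    proof (cases "bad [s,b,a,c]")
      case b3: True
      then have t3: "t [s,b,a,c] = k s b * k b a * k a c * k c s" by (simp add: t_def w)
      have adj3: "adj s b" "adj b a" "adj a c" using b3 by (auto simp: bad_def circuit_def)
      have "\<bar>t [s,a,b,c]\<bar> \<noteq> \<bar>t [s,b,a,c]\<bar>"
      proof
        assume "\<bar>t [s,a,b,c]\<bar> = \<bar>t [s,b,a,c]\<bar>"
        then have "\<bar>k a b\<bar> * \<bar>k c s\<bar> * (\<bar>k s a\<bar> * \<bar>k b c\<bar>) = \<bar>k a b\<bar> * \<bar>k c s\<bar> * (\<bar>k s b\<bar> * \<bar>k a c\<bar>)"
          using eps_abs[of a b] inV by (auto simp: t1 t3 abs_mult mult_ac)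
        moreover have "\<bar>k a b\<bar> * \<bar>k c s\<bar> \<noteq> 0" using adjC by (simp add: adj_iff)
        ultimately have "\<bar>k s a\<bar> * \<bar>k b c\<bar> = \<bar>k s b\<bar> * \<bar>k a c\<bar>" by simp
        then have "\<bar>k s a * k c b\<bar> = \<bar>k a c * k b s\<bar>"
          using eps_abs[of b c] eps_abs[of s b] inV by (simp add: abs_mult mult_ac)
        then show False
          using generic_products[of s a c b] d adjC adj3 adj_sym by auto
      qed
      then show ?thesis using b2 by (auto simp: t_def)
    next
      case False
      then show ?thesis using b2 nz by (simp add: t_def)
    qed
  qed
  then show ?thesis using sum by simp
qed

end

locale generic_two_opt = generic_weights + two_opt
begin

text \<open>The factor by which the two-opt exchange multiplies the weight of a circuit; the sign
  \<open>path_eps B\<close> comes from reversing the path within \<open>B\<close>.\<close>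

definition ratio :: real where
  "ratio = k (last A) (last B) * path_eps B * k (hd B) (hd A) / (k (last A) (hd B) * k (last B) (hd A))"

text \<open>If \<open>P @ R\<close> is a circuit, then so is \<open>P @ B\<close>. Both are bad, in particular positive, and they
  differ only in the path through \<open>B\<close>.\<close>

lemma rerouting_eps:
  assumes bad: "\<And>H. circuit H \<Longrightarrow> set H = set (A @ B) \<Longrightarrow> bad H" and PR: "rerouting P R"
  shows "path_eps R = path_eps B"
proof -
  have "bad (P @ R)" "bad (P @ B)"
    using bad rerouting_circuits[OF PR] rerouting_circuits[OF rerouting_restore_tail[OF PR]] by auto
  then have "cycle_eps (P @ R) = cycle_eps (P @ B)" by (simp add: bad_def)
  then show ?thesis
    unfolding rerouting_weight(1)[OF PR] rerouting_weight(1)[OF rerouting_restore_tail[OF PR]]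
    using path_eps_cases[of P] eps_cases[of "{last A, hd B}"] eps_cases[of "{last B, hd A}"] by auto
qed

lemma rerouting_ratio:
  assumes bad: "\<And>H. circuit H \<Longrightarrow> set H = set (A @ B) \<Longrightarrow> bad H" and PR: "rerouting P R"
  shows "cycle_weight k (P @ rev R) = ratio * cycle_weight k (P @ R)"
proof -
  have eps: "path_eps R = path_eps B" by (rule rerouting_eps[OF bad PR])
  have "set R \<subseteq> V" using circuit_vertices[OF circuit_AB] PR by (auto simp: rerouting_def)
  then show ?thesis
    unfolding rerouting_weight[OF PR] path_weight_swapped[OF \<open>set R \<subseteq> V\<close>] eps ratio_def
    using old_adj by (simp add: adj_iff field_simps)
qed

lemma ratio_neq: "ratio \<noteq> -1"
proof
  assume "ratio = -1"
  then have "k (last A) (last B) * path_eps B * k (hd B) (hd A) = - (k (last A) (hd B) * k (last B) (hd A))"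
    using old_adj by (simp add: ratio_def adj_iff field_simps)
  then have "k (last A) (last B) * k (hd B) (hd A) = k (last A) (hd B) * k (last B) (hd A) \<or>
      k (last A) (last B) * k (hd B) (hd A) = - (k (last A) (hd B) * k (last B) (hd A))"
    using path_eps_cases[of B] by auto
  then have "\<bar>k (last A) (last B) * k (hd B) (hd A)\<bar> = \<bar>k (last A) (hd B) * k (last B) (hd A)\<bar>"
    by (simp only: abs_eq_iff)
  moreover have "\<bar>k (last A) (last B)\<bar> = \<bar>k (last B) (last A)\<bar>" "\<bar>k (hd B) (hd A)\<bar> = \<bar>k (hd A) (hd B)\<bar>"
    "\<bar>k (last A) (hd B)\<bar> = \<bar>k (hd B) (last A)\<bar>"
    using k_swap[of "last A" "last B"] k_swap[of "hd A" "hd B"] k_swap[of "last A" "hd B"]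
      eps_cases[of "{last A, last B}"] eps_cases[of "{hd A, hd B}"] eps_cases[of "{last A, hd B}"]
      e f old_adj by (auto simp: adj_iff)
  ultimately have "\<bar>k (hd A) (hd B) * k (last A) (last B)\<bar> = \<bar>k (hd B) (last A) * k (last B) (hd A)\<bar>"
    by (simp add: abs_mult mult_ac)
  moreover have "distinct [hd A, hd B, last A, last B]" "adj (hd A) (hd B)" "adj (hd B) (last A)"
    "adj (last A) (last B)" "adj (last B) (hd A)"
    using quadrangle(1) by (auto simp: circuit_def)
  ultimately show False using generic_products by blast
qed

end

context generic_weights
begin

lemma sum_hamiltonian_bad_nonzero:
  assumes C: "shortest_bad C" and s: "s \<in> set C"
  shows "(\<Sum>xs\<in>hamiltonian_bad (set C) s. cycle_weight k xs) \<noteq> 0"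
proof (cases "length C = 4")
  case True
  then show ?thesis using sum_hamiltonian_bad_nonzero_4 shortest_badD[OF C] s by blast
next
  case False
  note bad = all_hamiltonian_bad[OF C False]
  let ?F = "cycle_edges ` hamiltonian_bad (set C) s"
  let ?W = "edge_set_weight (set C) s"
  have F: "?F = {cycle_edges xs | xs. circuit xs \<and> set xs = set C}"
  proof (intro equalityI subsetI)
    fix Z assume "Z \<in> {cycle_edges xs | xs. circuit xs \<and> set xs = set C}"
    then obtain xs where xs: "Z = cycle_edges xs" "circuit xs" "set xs = set C" by auto
    then obtain us vs where us: "xs = us @ s # vs" using s by (metis split_list)
    have "circuit (s # vs @ us)" "set (s # vs @ us) = set C" "cycle_edges (s # vs @ us) = Z"
      using xs circuit_rotate[of us "s # vs"] cycle_edges_rotate[of us "s # vs"] by (auto simp: us)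
    moreover from this have "s # vs @ us \<in> hamiltonian_bad (set C) s"
      using bad by (simp add: hamiltonian_bad_def)
    ultimately show "Z \<in> ?F" by blast
  qed (auto simp: hamiltonian_bad_def bad_def)
  have W: "?W (cycle_edges xs) = 2 * cycle_weight k xs" if "circuit xs" "set xs = set C" for xs
    using edge_set_weight_eq[of xs s] bad[OF that] that s by simp
  have circC: "circuit C" using shortest_badD[OF C] by (simp add: bad_def)
  then have CF: "cycle_edges C \<in> ?F" unfolding F by auto
  have "(\<Sum>Z\<in>{Z\<in>?F. {} \<subseteq> Z}. ?W Z) \<noteq> 0"
  proof (rule toggle_sum_nonzero[where C = "cycle_edges C"])
    show "finite ?F" using finite_hamiltonian_bad by auto
    show "?W Z \<noteq> 0" if "Z \<in> ?F" for Z
      using that W circuit_weight_nonzero unfolding F by auto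
    fix C' H' assume "C' \<in> ?F" "H' \<in> ?F" "C' \<noteq> H'"
    then obtain X Y where X: "C' = cycle_edges X" "circuit X" "set X = set C"
      and Y: "H' = cycle_edges Y" "circuit Y" "set Y = set C" unfolding F by blast
    have badX: "bad X" "bad Y" using bad X Y by auto
    have "length X = length C" using circuit_card X circC by simp
    then have X': "shortest_bad X" "length X \<noteq> 4" using C badX False by (auto simp: shortest_bad_def)
    have "card (cycle_edges X) = card (cycle_edges Y)"
      using hamiltonian_card_edges[of Y X] hamiltonian_card_edges[of X X] X Y badX by simp
    then have "\<not> cycle_edges Y \<subseteq> cycle_edges X"
      using \<open>C' \<noteq> H'\<close> X(1) Y(1) card_subset_eq[of "cycle_edges X" "cycle_edges Y"] by auto
    then obtain A B where "two_opt adj eps sig A B" and AB: "set (A @ B) = set C"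
      "cycle_edges (A @ B) = C'" "{hd A, hd B} \<in> H'" "{last A, last B} \<in> H'"
      using crossing_two_opt[OF X' Y(2)] X Y by metis
    interpret two_opt adj eps sig A B by fact
    interpret generic_two_opt adj eps sig V k A B by unfold_locales
    have badAB: "\<And>H. circuit H \<Longrightarrow> set H = set (A @ B) \<Longrightarrow> bad H" using bad AB(1) by simp
    have "\<forall>Z\<in>?F. (old_edges \<subseteq> Z \<and> new_edges \<inter> Z = {} \<and> Z - old_edges \<union> new_edges \<in> ?F \<and>
          ?W (Z - old_edges \<union> new_edges) = ratio * ?W Z) \<or>
        (new_edges \<subseteq> Z \<and> old_edges \<inter> Z = {} \<and> Z - new_edges \<union> old_edges \<in> ?F)"
    proof
      fix Z assume "Z \<in> ?F"
      then obtain H where H: "Z = cycle_edges H" "circuit H" "set H = set C" unfolding F by blast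
      then have Hne: "H \<noteq> []" by (simp add: circuit_def)
      obtain P R where PR: "rerouting P R" "same_cycle H (P @ R) \<or> same_cycle H (P @ rev R)"
        using hamiltonian_rerouting[OF H(2)] H(3) AB(1) by metis
      note ed = rerouting_edges[OF PR(1)] old_new_disjoint
      note ci = rerouting_circuits[OF PR(1)]
      have inF: "cycle_edges (P @ R) \<in> ?F" "cycle_edges (P @ rev R) \<in> ?F"
        using ci AB(1) unfolding F by blast+
      have to_new: "cycle_edges (P @ R) - old_edges \<union> new_edges = cycle_edges (P @ rev R)"
        and to_old: "cycle_edges (P @ rev R) - new_edges \<union> old_edges = cycle_edges (P @ R)"
        using ed by blast+
      from PR(2) show "(old_edges \<subseteq> Z \<and> new_edges \<inter> Z = {} \<and> Z - old_edges \<union> new_edges \<in> ?F \<and>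
          ?W (Z - old_edges \<union> new_edges) = ratio * ?W Z) \<or>
        (new_edges \<subseteq> Z \<and> old_edges \<inter> Z = {} \<and> Z - new_edges \<union> old_edges \<in> ?F)"
      proof
        assume "same_cycle H (P @ R)"
        then have Z: "Z = cycle_edges (P @ R)" using same_cycle_properties(5) Hne H(1) by metis
        have "?W (cycle_edges (P @ rev R)) = ratio * ?W (cycle_edges (P @ R))"
          using W ci AB(1) rerouting_ratio[OF badAB PR(1)] by simp
        moreover have "old_edges \<subseteq> Z" "new_edges \<inter> Z = {}" unfolding Z using ed by blast+
        ultimately show ?thesis using inF to_new unfolding Z by simp
      next
        assume "same_cycle H (P @ rev R)"
        then have Z: "Z = cycle_edges (P @ rev R)" using same_cycle_properties(5) Hne H(1) by metis
        moreover have "new_edges \<subseteq> Z" "old_edges \<inter> Z = {}" unfolding Z using ed by blast+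
        ultimately show ?thesis using inF to_old by simp
      qed
    qed
    moreover have "old_edges \<subseteq> C'" using rerouting_edges(1)[OF rerouting_AB] AB(2) by auto
    moreover have "new_edges \<subseteq> H'" "old_edges \<noteq> {}" "new_edges \<noteq> {}"
      using AB by (auto simp: new_edges_def old_edges_def)
    ultimately show "\<exists>D0 D1 s. s \<noteq> -1 \<and> D0 \<noteq> {} \<and> D1 \<noteq> {} \<and> D0 \<subseteq> C' \<and> D1 \<subseteq> H' \<and>
        (\<forall>Z\<in>?F. (D0 \<subseteq> Z \<and> D1 \<inter> Z = {} \<and> Z - D0 \<union> D1 \<in> ?F \<and> ?W (Z - D0 \<union> D1) = s * ?W Z) \<or>
                (D1 \<subseteq> Z \<and> D0 \<inter> Z = {} \<and> Z - D1 \<union> D0 \<in> ?F))"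
      using ratio_neq by blast
  qed (use CF in auto)
  then show ?thesis using sum_hamiltonian_bad[of "set C" s] by simp
qed

end

section \<open>Principal minors as sums over circuits\<close>

text \<open>The determinant with rows and columns indexed by an arbitrary finite set, so that vertices can
  be removed without renumbering.\<close>

definition perm_det :: "('a \<Rightarrow> 'a \<Rightarrow> real) \<Rightarrow> 'a set \<Rightarrow> real" where
  "perm_det w S = (\<Sum>p\<in>{p. p permutes S}. of_int (sign p) * (\<Prod>i\<in>S. w i (p i)))"

lemma perm_det_empty [simp]: "perm_det w {} = 1"
  by (simp add: perm_det_def)

lemma bij_betw_pick: "finite S \<Longrightarrow> bij_betw (pick S) {0..<card S} S"
  unfolding bij_betw_def
proof
  assume "finite S"
  show inj: "inj_on (pick S) {0..<card S}"
    by (rule linorder_inj_onI) (use pick_mono in fastforce)+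
  show "pick S ` {0..<card S} = S"
    by (rule card_subset_eq) (use \<open>finite S\<close> pick_in_set in \<open>auto simp: card_image[OF inj]\<close>)
qed

lemma principal_minor_eq_perm_det:
  assumes K: "K \<in> carrier_mat N N" and S: "S \<subseteq> {..<N}"
  shows "principal_minor S K = perm_det (\<lambda>i j. K $$ (i, j)) S"
proof -
  define n where "n = card S"
  have fin: "finite S" using S finite_subset by blast
  have sub: "{i. i < N \<and> i \<in> S} = S" using S by auto
  note bij = bij_betw_pick[OF fin, folded n_def]
  have inj: "inj_on (pick S) {0..<n}" and img: "pick S ` {0..<n} = S"
    using bij by (auto simp: bij_betw_def)
  have carrier: "submatrix K S S \<in> carrier_mat n n"
    using K sub by (intro carrier_matI) (simp_all add: dim_submatrix n_def)
  have entry: "submatrix K S S $$ (i, j) = K $$ (pick S i, pick S j)" if "i < n" "j < n" for i j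
    using that K sub by (intro submatrix_index) (simp_all add: n_def)
  have "principal_minor S K =
      (\<Sum>p\<in>{p. p permutes {0..<n}}. signof p * (\<Prod>i = 0..<n. submatrix K S S $$ (i, p i)))"
    unfolding principal_minor_def by (rule det_def'[OF carrier])
  also have "\<dots> = perm_det (\<lambda>i j. K $$ (i, j)) S"
    unfolding perm_det_def
  proof (rule sum.reindex_bij_witness[where j = "map_permutation {0..<n} (pick S)"
        and i = "map_permutation S (inv_into {0..<n} (pick S))"])
    have inv: "bij_betw (inv_into {0..<n} (pick S)) S {0..<n}" by (rule bij_betw_inv_into[OF bij])
    fix p assume "p \<in> {p. p permutes {0..<n}}"
    then have p: "p permutes {0..<n}" by simp
    show "map_permutation S (inv_into {0..<n} (pick S)) (map_permutation {0..<n} (pick S) p) = p"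
      by (rule map_permutation_compose_inv) (use bij inj p in auto)
    show "map_permutation {0..<n} (pick S) p \<in> {p. p permutes S}"
      using map_permutation_permutes[OF bij p] by simp
    have "(\<Prod>i\<in>S. K $$ (i, map_permutation {0..<n} (pick S) p i)) =
        (\<Prod>i\<in>{0..<n}. K $$ (pick S i, map_permutation {0..<n} (pick S) p (pick S i)))"
      by (rule prod.reindex_bij_betw[OF bij, symmetric])
    also have "\<dots> = (\<Prod>i = 0..<n. submatrix K S S $$ (i, p i))"
    proof (rule prod.cong[OF refl])
      fix i assume i: "i \<in> {0..<n}"
      then have "p i \<in> {0..<n}" using permutes_in_image[OF p] by blast
      then show "K $$ (pick S i, map_permutation {0..<n} (pick S) p (pick S i)) = submatrix K S S $$ (i, p i)"
        using i inj by (simp add: map_permutation_apply entry)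
    qed
    finally show "of_int (sign (map_permutation {0..<n} (pick S) p)) *
        (\<Prod>i\<in>S. K $$ (i, map_permutation {0..<n} (pick S) p i)) =
      signof p * (\<Prod>i = 0..<n. submatrix K S S $$ (i, p i))"
      using sign_map_permutation[OF inj p] by (simp add: sign_def)
  next
    have inv: "bij_betw (inv_into {0..<n} (pick S)) S {0..<n}" by (rule bij_betw_inv_into[OF bij])
    fix q assume "q \<in> {p. p permutes S}"
    then have q: "q permutes S" by simp
    show "map_permutation {0..<n} (pick S) (map_permutation S (inv_into {0..<n} (pick S)) q) = q"
      by (rule map_permutation_compose_inv) (use inv inj img q in \<open>auto simp: f_inv_into_f\<close>)
    show "map_permutation S (inv_into {0..<n} (pick S)) q \<in> {p. p permutes {0..<n}}"
      using map_permutation_permutes[OF inv q] by simp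
  qed
  finally show ?thesis .
qed

lemma sign_cycle_of_list: "distinct xs \<Longrightarrow> xs \<noteq> [] \<Longrightarrow> sign (cycle_of_list xs) = (-1) ^ (length xs - 1)"
proof (induction xs rule: cycle_of_list.induct)
  case (1 i j cs)
  have "sign (cycle_of_list (i # j # cs)) = sign (transpose i j) * sign (cycle_of_list (j # cs))"
    unfolding cycle_of_list.simps by (rule sign_compose[OF permutation_swap_id permutation_of_cycle])
  then show ?case using 1 by (simp add: sign_swap_id del: cycle_of_list.simps)
qed auto

lemma cycle_of_list_nth:
  assumes "distinct xs" "i < length xs"
  shows "cycle_of_list xs (xs ! i) = xs ! (Suc i mod length xs)"
proof -
  have "map (cycle_of_list xs) xs = rotate 1 xs"
    using cyclic_rotation[OF assms(1), of 1] by simp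
  then have "map (cycle_of_list xs) xs ! i = rotate 1 xs ! i" by simp
  then show ?thesis using assms(2) nth_rotate[OF assms(2), of 1] by simp
qed

lemma path_weight_nth: "path_weight w xs = (\<Prod>i<length xs - 1. w (xs ! i) (xs ! Suc i))"
proof (induction w xs rule: path_weight.induct)
  case (3 w x y zs)
  then show ?case by (simp add: prod.lessThan_Suc_shift del: prod.lessThan_Suc)
qed auto

lemma prod_cycle_of_list:
  assumes "distinct xs" "xs \<noteq> []"
  shows "(\<Prod>i\<in>set xs. w i (cycle_of_list xs i)) = cycle_weight w xs"
proof -
  obtain n where n: "length xs = Suc n" using assms(2) by (cases xs) auto
  have "(\<Prod>i\<in>set xs. w i (cycle_of_list xs i)) = (\<Prod>i\<in>{..<length xs}. w (xs ! i) (cycle_of_list xs (xs ! i)))"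
    using bij_betw_nth[OF assms(1) refl refl] by (rule prod.reindex_bij_betw[symmetric])
  also have "\<dots> = (\<Prod>i\<in>{..<length xs}. w (xs ! i) (xs ! (Suc i mod length xs)))"
    using cycle_of_list_nth[OF assms(1)] by simp
  also have "\<dots> = (\<Prod>i<n. w (xs ! i) (xs ! Suc i)) * w (last xs) (hd xs)"
    using assms(2) by (simp add: n last_conv_nth hd_conv_nth)
  finally show ?thesis by (simp add: cycle_weight_def path_weight_nth n)
qed

text \<open>The possible cycles through \<open>x\<close> of a permutation of \<open>S\<close>, including the fixed point \<open>[x]\<close>.\<close>

definition rooted_lists :: "'a set \<Rightarrow> 'a \<Rightarrow> 'a list set" where
  "rooted_lists S x = {xs. distinct xs \<and> set xs \<subseteq> S \<and> xs \<noteq> [] \<and> hd xs = x}"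

lemma finite_rooted_lists: "finite S \<Longrightarrow> finite (rooted_lists S x)"
  by (rule finite_subset[OF _ finite_subset_distinct[of S]]) (auto simp: rooted_lists_def)

lemma support_cycle_comp:
  assumes xs: "distinct xs" "xs \<noteq> []" and q: "\<And>y. y \<in> set xs \<Longrightarrow> q y = y"
  shows "support (cycle_of_list xs \<circ> q) (hd xs) = xs"
proof -
  let ?p = "cycle_of_list xs \<circ> q" and ?n = "length xs"
  have n: "?n > 0" using xs by simp
  have pow: "(?p ^^ i) (hd xs) = xs ! (i mod ?n)" for i
  proof (induction i)
    case 0
    then show ?case using xs by (simp add: hd_conv_nth)
  next
    case (Suc i)
    have "i mod ?n < ?n" using n by simp
    then have "?p (xs ! (i mod ?n)) = xs ! (Suc (i mod ?n) mod ?n)"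
      using q cycle_of_list_nth[OF xs(1)] by simp
    then show ?case using Suc by (simp add: mod_Suc_eq)
  qed
  have "least_power ?p (hd xs) = ?n"
    unfolding least_power_def
  proof (rule Least_equality)
    show "(?p ^^ ?n) (hd xs) = hd xs \<and> ?n > 0" using pow[of ?n] xs by (simp add: hd_conv_nth)
    fix m assume m: "(?p ^^ m) (hd xs) = hd xs \<and> m > 0"
    then have "xs ! (m mod ?n) = xs ! 0" using pow[of m] xs by (simp add: hd_conv_nth)
    then have "m mod ?n = 0" using xs(1) n nth_eq_iff_index_eq[OF xs(1), of "m mod ?n" 0] by simp
    then show "?n \<le> m" using m by (auto simp: mod_eq_0_iff_dvd dest: dvd_imp_le)
  qed
  then show ?thesis by (intro nth_equalityI) (simp_all add: pow del: comp_apply)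
qed

text \<open>A permutation is determined by its cycle through \<open>x\<close> and its restriction to the other elements.\<close>

lemma perm_det_expand:
  assumes fin: "finite S" and x: "x \<in> S"
  shows "perm_det w S = (\<Sum>xs\<in>rooted_lists S x.
    (-1) ^ (length xs - 1) * cycle_weight w xs * perm_det w (S - set xs))"
proof -
  let ?T = "SIGMA xs:rooted_lists S x. {q. q permutes (S - set xs)}"
  let ?g = "\<lambda>(xs, q). (-1) ^ (length xs - 1) * cycle_weight w xs * (of_int (sign q) * (\<Prod>i\<in>S - set xs. w i (q i)))"
  have "(\<Sum>xs\<in>rooted_lists S x. (-1) ^ (length xs - 1) * cycle_weight w xs * perm_det w (S - set xs)) =
      (\<Sum>xs\<in>rooted_lists S x. \<Sum>q\<in>{q. q permutes (S - set xs)}. ?g (xs, q))"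
    by (simp add: perm_det_def sum_distrib_left)
  also have "\<dots> = (\<Sum>z\<in>?T. ?g z)"
    using fin by (subst sum.Sigma) (auto simp: finite_rooted_lists finite_permutations)
  also have "\<dots> = perm_det w S"
    unfolding perm_det_def
  proof (rule sum.reindex_bij_witness[where j = "\<lambda>(xs, q). cycle_of_list xs \<circ> q"
        and i = "\<lambda>p. (support p x, \<lambda>y. if y \<in> S - set (support p x) then p y else y)"])
    fix z assume "z \<in> ?T"
    then obtain xs q where z: "z = (xs, q)" "xs \<in> rooted_lists S x" "q permutes (S - set xs)" by auto
    then have xs: "distinct xs" "set xs \<subseteq> S" "xs \<noteq> []" "hd xs = x" by (auto simp: rooted_lists_def)
    have q_id: "q y = y" if "y \<in> set xs" for y using z(3) that by (simp add: permutes_def)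
    have supp: "support (cycle_of_list xs \<circ> q) x = xs"
      using support_cycle_comp[OF xs(1,3) q_id] xs(4) by simp
    have c_perm: "cycle_of_list xs permutes S" using cycle_permutes permutes_subset xs(2) by blast
    have q_perm: "q permutes S" using z(3) permutes_subset by blast
    have off: "cycle_of_list xs (q y) = q y" if "y \<in> S - set xs" for y
    proof -
      have "q y \<in> S - set xs" using permutes_in_image[OF z(3)] that by blast
      then show ?thesis using id_outside_supp[of "q y" xs] by simp
    qed
    have "(\<lambda>y. if y \<in> S - set xs then (cycle_of_list xs \<circ> q) y else y) = q"
    proof
      fix y show "(if y \<in> S - set xs then (cycle_of_list xs \<circ> q) y else y) = q y"
        using off[of y] permutes_not_in[OF z(3), of y] by auto
    qed
    then show "(\<lambda>p. (support p x, \<lambda>y. if y \<in> S - set (support p x) then p y else y))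
        (case z of (xs, q) \<Rightarrow> cycle_of_list xs \<circ> q) = z"
      by (simp only: z(1) case_prod_conv supp)
    show "(case z of (xs, q) \<Rightarrow> cycle_of_list xs \<circ> q) \<in> {p. p permutes S}"
      using permutes_compose[OF q_perm c_perm] by (simp add: z(1))
    have "sign (cycle_of_list xs \<circ> q) = (-1) ^ (length xs - 1) * sign q"
      using sign_compose[OF permutation_of_cycle, of q xs] sign_cycle_of_list[OF xs(1,3)]
        permutation_permutes fin q_perm by auto
    moreover have "(\<Prod>i\<in>S. w i ((cycle_of_list xs \<circ> q) i)) =
        (\<Prod>i\<in>set xs. w i ((cycle_of_list xs \<circ> q) i)) * (\<Prod>i\<in>S - set xs. w i ((cycle_of_list xs \<circ> q) i))"
      using prod.subset_diff[OF xs(2) fin, of "\<lambda>i. w i ((cycle_of_list xs \<circ> q) i)"]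
      by (simp add: mult.commute)
    moreover have "(\<Prod>i\<in>set xs. w i ((cycle_of_list xs \<circ> q) i)) = cycle_weight w xs"
      using q_id prod_cycle_of_list[OF xs(1,3)] by simp
    moreover have "(\<Prod>i\<in>S - set xs. w i ((cycle_of_list xs \<circ> q) i)) = (\<Prod>i\<in>S - set xs. w i (q i))"
      using off by (intro prod.cong) auto
    ultimately show "of_int (sign (case z of (xs, q) \<Rightarrow> cycle_of_list xs \<circ> q)) *
        (\<Prod>i\<in>S. w i ((case z of (xs, q) \<Rightarrow> cycle_of_list xs \<circ> q) i)) = ?g z"
      by (simp add: z(1) del: comp_apply)
  next
    fix p assume "p \<in> {p. p permutes S}"
    then have p: "p permutes S" by simp
    then have perm: "permutation p" using fin permutation_permutes by blast
    define xs where "xs = support p x"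
    define q where "q = (\<lambda>y. if y \<in> S - set xs then p y else y)"
    have q: "q permutes (S - set xs)"
      unfolding q_def xs_def by (rule semidecomposition[OF p fin])
    have lp: "least_power p x > 0" using least_power_of_permutation[OF perm] by blast
    have "(p ^^ i) x \<in> S" for i using permutes_in_image[OF permutes_funpow[OF p]] x by blast
    then have "set xs \<subseteq> S" by (auto simp: xs_def)
    moreover have "distinct xs" unfolding xs_def by (rule cycle_of_permutation[OF perm])
    moreover have "xs \<noteq> []" using lp by (simp add: xs_def)
    moreover have "hd xs = x" using lp by (simp add: xs_def hd_map upt_conv_Cons)
    ultimately have "xs \<in> rooted_lists S x" by (simp add: rooted_lists_def)
    then show "(support p x, \<lambda>y. if y \<in> S - set (support p x) then p y else y) \<in> ?T"
      using q unfolding q_def xs_def by blast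
    have "cycle_of_list xs \<circ> q = p"
    proof
      fix y
      show "(cycle_of_list xs \<circ> q) y = p y"
      proof (cases "y \<in> S - set xs")
        case True
        then have "q y \<in> S - set xs" using permutes_in_image[OF q] by blast
        then show ?thesis using True id_outside_supp[of "p y" xs] by (simp add: q_def)
      next
        case False
        then have "q y = y" unfolding q_def by (rule if_not_P)
        show ?thesis
        proof (cases "y \<in> set xs")
          case True
          then show ?thesis using \<open>q y = y\<close> cycle_restrict[OF perm, of y x] by (simp add: xs_def)
        next
          case 2: False
          then have "y \<notin> S" using False by simp
          then show ?thesis using \<open>q y = y\<close> id_outside_supp[OF 2] permutes_not_in[OF p] by simp
        qed
      qed
    qed
    then show "(case (support p x, \<lambda>y. if y \<in> S - set (support p x) then p y else y) of
        (xs, q) \<Rightarrow> cycle_of_list xs \<circ> q) = p"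
      unfolding q_def xs_def by simp
  qed
  finally show ?thesis by simp
qed

context generic_weights
begin

text \<open>After expansion along \<open>x\<close> the remaining minors agree by induction, since they are too small to
  contain a bad circuit. The terms of lists that are not bad cancel in pairs under reversal, and a
  bad list has to exhaust \<open>S\<close>.\<close>

lemma perm_det_difference:
  assumes "finite S" "S \<subseteq> V" "x \<in> S" and sig1: "\<And>y. y \<in> V \<Longrightarrow> sig {y} = 1"
    and short: "\<And>xs. bad xs \<Longrightarrow> set xs \<subseteq> S \<Longrightarrow> card S \<le> length xs"
  shows "perm_det (\<lambda>i j. sig {i, j} * k i j) S - perm_det k S =
    2 * (-1) ^ card S * (\<Sum>xs\<in>hamiltonian_bad S x. cycle_weight k xs)"
  using assms(1,2,3,5)
proof (induction "card S" arbitrary: S x rule: less_induct)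
  case less
  let ?k' = "\<lambda>i j. sig {i, j} * k i j"
  let ?G = "rooted_lists S x"
  define t where "t xs = (-1) ^ (length xs - 1) * ((cycle_sig xs - 1) * cycle_weight k xs) * perm_det k (S - set xs)" for xs
  have finG: "finite ?G" by (rule finite_rooted_lists[OF less.prems(1)])
  have rest: "perm_det ?k' (S - set xs) = perm_det k (S - set xs)" if "xs \<in> ?G" for xs
  proof (cases "S - set xs = {}")
    case True
    show ?thesis unfolding True by simp
  next
    case False
    then obtain y where y: "y \<in> S - set xs" by auto
    have "hd xs \<in> set xs" "hd xs \<in> S" using that less.prems by (auto simp: rooted_lists_def)
    then have "S - set xs \<subset> S" by auto
    then have card: "card (S - set xs) < card S" using less.prems(1) by (intro psubset_card_mono)
    have large: "card S \<le> length ys" if "bad ys" "set ys \<subseteq> S - set xs" for ys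
      using less.prems(4) that by auto
    have "hamiltonian_bad (S - set xs) y = {}"
    proof (rule ccontr)
      assume "hamiltonian_bad (S - set xs) y \<noteq> {}"
      then obtain ys where "bad ys" "set ys = S - set xs" by (auto simp: hamiltonian_bad_def)
      then show False using large[of ys] circuit_card[of ys] card by (simp add: bad_def)
    qed
    moreover have "perm_det ?k' (S - set xs) - perm_det k (S - set xs) =
        2 * (-1) ^ card (S - set xs) * (\<Sum>xs\<in>hamiltonian_bad (S - set xs) y. cycle_weight k xs)"
    proof (rule less.hyps[OF card _ _ y])
      show "card (S - set xs) \<le> length ys" if "bad ys" "set ys \<subseteq> S - set xs" for ys
        using large[OF that] card by simp
    qed (use less.prems in auto)
    ultimately show ?thesis by simp
  qed
  have "perm_det ?k' S - perm_det k S = (\<Sum>xs\<in>?G. t xs)"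
    unfolding perm_det_expand[OF less.prems(1,3)] sum_subtractf[symmetric]
    by (intro sum.cong refl) (simp only: t_def rest cycle_weight_mult left_diff_distrib
        right_diff_distrib mult_1_left mult_1_right mult.assoc)
  also have "\<dots> = (\<Sum>xs\<in>{xs\<in>?G. bad xs}. t xs) + (\<Sum>xs\<in>{xs\<in>?G. \<not> bad xs}. t xs)"
    using finG by (subst sum.union_disjoint[symmetric]) (auto intro: sum.cong)
  also have "(\<Sum>xs\<in>{xs\<in>?G. \<not> bad xs}. t xs) = 0"
  proof -
    \<comment> \<open>A list that is not bad has a zero factor, or \<open>sig\<close>-sign \<open>1\<close>, or is a negative circuit; in
      the last case its reversal has the opposite weight.\<close>
    have neg: "t (reverse_keeping_head xs) = - t xs" if xs: "xs \<in> ?G" "\<not> bad xs" for xs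
    proof (cases "cycle_sig xs = 1 \<or> cycle_weight k xs = 0")
      case True
      have ne: "xs \<noteq> []" "set xs \<subseteq> V" using xs less.prems by (auto simp: rooted_lists_def)
      have "cycle_sig (reverse_keeping_head xs) = cycle_sig xs"
        using reverse_keeping_head(8)[OF ne(1), of "\<lambda>x y. sig {x, y}"] by (simp add: insert_commute)
      moreover have "cycle_weight k (reverse_keeping_head xs) = cycle_eps xs * cycle_weight k xs"
        using reverse_keeping_head(8)[OF ne(1)] cycle_weight_swapped[OF ne(2,1)] by simp
      ultimately show ?thesis using True by (auto simp: t_def)
    next
      case False
      then have sg: "cycle_sig xs = -1" and nz: "cycle_weight k xs \<noteq> 0" using cycle_sig_cases by blast+
      have ne: "xs \<noteq> []" "set xs \<subseteq> V" "distinct xs" using xs less.prems by (auto simp: rooted_lists_def)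
      have "length xs \<noteq> 1"
      proof
        assume "length xs = 1"
        then obtain y where "xs = [y]" by (auto simp: length_Suc_conv)
        then show False using sg sig1[of y] ne by (simp add: cycle_weight_def)
      qed
      then have hl: "hd xs \<noteq> last xs" using distinct_hd_eq_last ne by blast
      have "successively (\<lambda>x y. k x y \<noteq> 0) xs"
        using nz by (simp add: successively_imp_path_weight_nonzero cycle_weight_def)
      moreover have "successively (\<noteq>) xs"
        using ne(3) by (induction xs rule: induct_list012) auto
      ultimately have "successively adj xs"
        using ne(2) by (induction xs rule: induct_list012) (auto simp: adj_iff)
      moreover have "adj (last xs) (hd xs)"
        using nz hl ne hd_in_set[OF ne(1)] last_in_set[OF ne(1)]
        by (auto simp: adj_iff cycle_weight_def)
      ultimately have "circuit xs" using ne by (simp add: circuit_def)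
      then have ep: "cycle_eps xs = -1" using xs(2) sg cycle_eps_cases[of xs] by (auto simp: bad_def)
      have "cycle_sig (reverse_keeping_head xs) = cycle_sig xs"
        using reverse_keeping_head(8)[OF ne(1), of "\<lambda>x y. sig {x, y}"] by (simp add: insert_commute)
      moreover have "cycle_weight k (reverse_keeping_head xs) = - cycle_weight k xs"
        using reverse_keeping_head(8)[OF ne(1)] cycle_weight_swapped[OF ne(2,1)] ep by simp
      ultimately show ?thesis
        using reverse_keeping_head(2,4)[OF ne(1)] by (simp add: t_def)
    qed
    have "(\<Sum>xs\<in>{xs\<in>?G. \<not> bad xs}. t xs) = (\<Sum>xs\<in>{xs\<in>?G. \<not> bad xs}. - t xs)"
    proof (rule sum.reindex_bij_witness[where i = reverse_keeping_head and j = reverse_keeping_head])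
      fix xs assume "xs \<in> {xs\<in>?G. \<not> bad xs}"
      then have xs: "xs \<in> ?G" "\<not> bad xs" "xs \<noteq> []" by (auto simp: rooted_lists_def)
      show "reverse_keeping_head (reverse_keeping_head xs) = xs"
        by (rule reverse_keeping_head(1)[OF xs(3)])
      then show "reverse_keeping_head (reverse_keeping_head xs) = xs" .
      show in1: "reverse_keeping_head xs \<in> {xs\<in>?G. \<not> bad xs}"
        using xs reverse_keeping_head[OF xs(3)] bad_reverse_keeping_head[OF xs(3)]
        by (auto simp: rooted_lists_def)
      then show "reverse_keeping_head xs \<in> {xs\<in>?G. \<not> bad xs}" .
      show "- t (reverse_keeping_head xs) = t xs" using neg[OF xs(1,2)] by simp
    qed
    also have "\<dots> = - (\<Sum>xs\<in>{xs\<in>?G. \<not> bad xs}. t xs)" by (simp add: sum_negf)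
    finally show ?thesis by simp
  qed
  also have "{xs\<in>?G. bad xs} = hamiltonian_bad S x"
  proof (intro equalityI subsetI)
    fix xs assume "xs \<in> {xs\<in>?G. bad xs}"
    then have xs: "bad xs" "set xs \<subseteq> S" "hd xs = x" by (auto simp: rooted_lists_def)
    then have "card S \<le> card (set xs)" using less.prems(4)[OF xs(1,2)] circuit_card[of xs] xs(1)
      by (simp add: bad_def)
    then have "set xs = S" using xs(2) less.prems(1) by (metis card_seteq)
    then show "xs \<in> hamiltonian_bad S x" using xs by (simp add: hamiltonian_bad_def)
  qed (auto simp: hamiltonian_bad_def rooted_lists_def bad_def circuit_def)
  also have "(\<Sum>xs\<in>hamiltonian_bad S x. t xs) =
      (\<Sum>xs\<in>hamiltonian_bad S x. 2 * (-1) ^ card S * cycle_weight k xs)"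
  proof (rule sum.cong[OF refl])
    fix xs assume "xs \<in> hamiltonian_bad S x"
    then have xs: "bad xs" "set xs = S" by (auto simp: hamiltonian_bad_def)
    then have len: "length xs = card S" using circuit_card[of xs] by (simp add: bad_def)
    moreover obtain n where "card S = Suc n" using bad_length[OF xs(1)] len by (cases "card S") auto
    ultimately show "t xs = 2 * (-1) ^ card S * cycle_weight k xs"
      using xs by (simp add: t_def bad_def)
  qed
  finally show ?case by (simp add: sum_distrib_left)
qed

lemma perm_det_eq_if_no_bad:
  assumes "finite S" "S \<subseteq> V" and sig1: "\<And>y. y \<in> V \<Longrightarrow> sig {y} = 1"
    and none: "\<And>xs. bad xs \<Longrightarrow> set xs \<subseteq> S \<Longrightarrow> False"
  shows "perm_det (\<lambda>i j. sig {i, j} * k i j) S = perm_det k S"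
proof (cases "S = {}")
  case False
  then obtain x where "x \<in> S" by auto
  moreover have "hamiltonian_bad S x = {}" using none by (auto simp: hamiltonian_bad_def)
  moreover have "card S \<le> length xs" if "bad xs" "set xs \<subseteq> S" for xs using none[OF that] by simp
  ultimately show ?thesis using perm_det_difference[OF assms(1,2) \<open>x \<in> S\<close> sig1] by simp
qed simp

text \<open>The difference of the two minors is a nonzero multiple of the sum over the bad Hamiltonian
  circuits.\<close>

lemma bad_circuit_changes_minor:
  assumes "finite V" and sig1: "\<And>y. y \<in> V \<Longrightarrow> sig {y} = 1" and C: "shortest_bad C"
  shows "perm_det (\<lambda>i j. sig {i, j} * k i j) (set C) \<noteq> perm_det k (set C)"
proof -
  have bad: "bad C" by (rule shortest_badD[OF C])
  then have circ: "circuit C" "hd C \<in> set C" by (auto simp: bad_def circuit_def)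
  have "perm_det (\<lambda>i j. sig {i, j} * k i j) (set C) - perm_det k (set C) =
      2 * (-1) ^ card (set C) * (\<Sum>xs\<in>hamiltonian_bad (set C) (hd C). cycle_weight k xs)"
  proof (rule perm_det_difference[OF _ _ circ(2) sig1])
    show "card (set C) \<le> length xs" if "bad xs" for xs
      using that C circuit_card[OF circ(1)] by (simp add: shortest_bad_def)
  qed (use circuit_vertices[OF circ(1)] in auto)
  then show ?thesis using sum_hamiltonian_bad_nonzero[OF C circ(2)] by auto
qed

end

section \<open>Positive even edge sets of two-connected graphs\<close>

context signed_graph
begin

definition reach :: "'a set \<Rightarrow> 'a \<Rightarrow> 'a \<Rightarrow> real \<Rightarrow> real \<Rightarrow> bool" where
  "reach U u v a b \<longleftrightarrow> (\<exists>R. R \<noteq> [] \<and> distinct R \<and> set R \<subseteq> U \<and> hd R = u \<and> last R = v \<and>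
    successively adj R \<and> path_eps R = a \<and> path_sig R = b)"

lemma reach_mono: "reach U u v a b \<Longrightarrow> U \<subseteq> U' \<Longrightarrow> reach U' u v a b"
  unfolding reach_def by blast

lemma reach_sym: assumes "reach U u v a b" shows "reach U v u a b"
proof -
  obtain R where "R \<noteq> []" "distinct R" "set R \<subseteq> U" "hd R = u" "last R = v"
    "successively adj R" "path_eps R = a" "path_sig R = b"
    using assms unfolding reach_def by blast
  then show ?thesis unfolding reach_def
    by (intro exI[of _ "rev R"]) (simp add: hd_rev last_rev path_weight_rev_symmetric)
qed

lemma reach_trans:
  assumes "reach U u w a b" "reach U' w v a' b'" "U \<inter> U' \<subseteq> {w}"
  shows "reach (U \<union> U') u v (a * a') (b * b')"
proof -
  obtain R where R: "R \<noteq> []" "distinct R" "set R \<subseteq> U" "hd R = u" "last R = w"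
    "successively adj R" "path_eps R = a" "path_sig R = b"
    using assms(1) unfolding reach_def by blast
  obtain R' where R': "R' \<noteq> []" "distinct R'" "set R' \<subseteq> U'" "hd R' = w" "last R' = v"
    "successively adj R'" "path_eps R' = a'" "path_sig R' = b'"
    using assms(2) unfolding reach_def by blast
  obtain X where X: "R = X @ [w]" using R(1,5) by (metis append_butlast_last_id)
  obtain Y where Y: "R' = w # Y" using R'(1,4) by (cases R') auto
  let ?Z = "X @ w # Y"
  have "distinct ?Z" using R(2,3) R'(2,3) assms(3) unfolding X Y by auto
  moreover have "successively adj ?Z"
    using R(6) R'(6) unfolding X Y by (auto simp: successively_append_iff)
  moreover have "hd ?Z = u" using R(4) unfolding X by (cases X) auto
  moreover have "last ?Z = v" using R'(5) unfolding Y by simp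
  moreover have "path_eps ?Z = a * a'" "path_sig ?Z = b * b'"
    using R(7,8) R'(7,8) path_weight_split[of _ X w Y] unfolding X Y by simp_all
  moreover have "set ?Z \<subseteq> U \<union> U'" using R(3) R'(3) unfolding X Y by auto
  ultimately show ?thesis unfolding reach_def by blast
qed

lemma reach_path:
  "distinct R \<Longrightarrow> R \<noteq> [] \<Longrightarrow> successively adj R \<Longrightarrow> reach (set R) (hd R) (last R) (path_eps R) (path_sig R)"
  unfolding reach_def by blast

text \<open>On \<open>U\<close> the pattern \<open>sig\<close> looks like the coboundary of \<open>s\<close>, as far as paths within \<open>U\<close> are
  concerned. The two charges ensure that every ear closes up to a positive circuit.\<close>

definition balanced_links :: "'a set \<Rightarrow> ('a \<Rightarrow> real) \<Rightarrow> bool" where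
  "balanced_links U s \<longleftrightarrow> (\<forall>x. s x * s x = 1) \<and>
    (\<forall>u\<in>U. \<forall>v\<in>U. u \<noteq> v \<longrightarrow> (\<forall>a\<in>{1, -1}. reach U u v a (s u * s v)))"

lemma path_sig_sq: "path_sig xs * path_sig xs = 1"
  using path_sig_cases[of xs] by auto

text \<open>The two arcs between any two vertices have opposite charges and equal \<open>sig\<close>-signs. So \<open>s\<close> can be
  read off along the circuit.\<close>

lemma negative_circuit_balanced:
  assumes C: "circuit C" "cycle_eps C = -1" "cycle_sig C = 1"
  shows "\<exists>s. balanced_links (set C) s"
proof -
  define s where "s x = path_sig (takeWhile (\<lambda>y. y \<noteq> x) C @ [x])" for x
  have d: "distinct C" using C by (simp add: circuit_def)
  have prefix: "s x = path_sig (P @ [x])" if "C = P @ x # Q" for x P Q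
  proof -
    have "takeWhile (\<lambda>y. y \<noteq> x) C = P"
      using d unfolding that by (simp add: takeWhile_tail) (metis takeWhile_eq_all_conv)
    then show ?thesis by (simp add: s_def)
  qed
  have main: "reach (set C) u v a (s u * s v)" if split: "C = P @ u # X @ v # Y" and a: "a \<in> {1, -1}" for P u X v Y a
  proof -
    have su: "s u = path_sig (P @ [u])" by (rule prefix[OF split])
    have sv: "s v = path_sig (P @ u # X @ [v])" using prefix[of "P @ u # X" v Y] split by simp
    have "path_sig (P @ u # X @ [v]) = path_sig (P @ [u]) * path_sig (u # X @ [v])"
      by (rule path_weight_split)
    then have sig1: "path_sig (u # X @ [v]) = s u * s v"
      using su sv path_sig_sq[of "P @ [u]"] by (simp add: mult.assoc[symmetric])
    let ?C = "u # X @ v # (Y @ P)"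
    have C': "circuit ?C" "cycle_eps ?C = -1" "cycle_sig ?C = 1" "set ?C = set C"
      using C circuit_rotate[of P "u # X @ v # Y"] cycle_weight_rotate[of _ P "u # X @ v # Y"]
      by (auto simp: split)
    have succ: "successively adj (u # X @ [v])" "successively adj (v # (Y @ P) @ [u])"
    proof -
      have "successively adj ((u # X @ v # (Y @ P)) @ [u])"
        using C'(1) by (subst successively_append_iff) (auto simp: circuit_def)
      then have "successively adj ((u # X @ [v]) @ (Y @ P) @ [u])"
        "successively adj ((u # X) @ (v # (Y @ P) @ [u]))" by simp_all
      then show "successively adj (u # X @ [v])" "successively adj (v # (Y @ P) @ [u])"
        by (simp_all only: successively_append_iff)
    qed
    have dist: "distinct (u # X @ [v])" "distinct (v # (Y @ P) @ [u])"
      using d unfolding split by auto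
    have r1: "reach (set C) u v (path_eps (u # X @ [v])) (path_sig (u # X @ [v]))"
    proof (rule reach_mono)
      show "reach (set (u # X @ [v])) u v (path_eps (u # X @ [v])) (path_sig (u # X @ [v]))"
        using reach_path[OF dist(1) _ succ(1)] by simp
    qed (auto simp: split)
    have r2: "reach (set C) u v (path_eps (v # (Y @ P) @ [u])) (path_sig (v # (Y @ P) @ [u]))"
    proof (rule reach_mono[OF reach_sym])
      show "reach (set (v # (Y @ P) @ [u])) v u (path_eps (v # (Y @ P) @ [u])) (path_sig (v # (Y @ P) @ [u]))"
        using reach_path[OF dist(2) _ succ(2)] by simp
    qed (auto simp: split)
    have prods: "path_eps (u # X @ [v]) * path_eps (v # (Y @ P) @ [u]) = -1"
      "path_sig (u # X @ [v]) * path_sig (v # (Y @ P) @ [u]) = 1"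
      using C'(2,3) cycle_weight_two_arcs[of _ u X v "Y @ P"] by simp_all
    have sig2: "path_sig (v # (Y @ P) @ [u]) = s u * s v"
      using prods(2) path_sig_cases[of "u # X @ [v]"] sig1 by auto
    show ?thesis
    proof (cases "path_eps (u # X @ [v]) = a")
      case True
      then show ?thesis using r1 sig1 by simp
    next
      case False
      then have "path_eps (v # (Y @ P) @ [u]) = a"
        using prods(1) a path_eps_cases[of "u # X @ [v]"] by auto
      then show ?thesis using r2 sig2 by simp
    qed
  qed
  have "balanced_links (set C) s"
    unfolding balanced_links_def
  proof (intro conjI allI ballI impI)
    show "s x * s x = 1" for x unfolding s_def by (rule path_sig_sq)
    fix u v a assume uv: "u \<in> set C" "v \<in> set C" "u \<noteq> v" and a: "a \<in> {1, -1::real}"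
    from uv(1) obtain P Q where PQ: "C = P @ u # Q" by (metis split_list)
    then consider "v \<in> set P" | "v \<in> set Q" using uv by auto
    then show "reach (set C) u v a (s u * s v)"
    proof cases
      case 1
      then obtain P1 P2 where "P = P1 @ v # P2" by (metis split_list)
      then have "reach (set C) v u a (s v * s u)" using main[of P1 v P2 u Q a] PQ a by simp
      then show ?thesis using reach_sym by (simp add: mult.commute)
    next
      case 2
      then obtain Q1 Q2 where "Q = Q1 @ v # Q2" by (metis split_list)
      then show ?thesis using main[of P u Q1 v Q2 a] PQ a by simp
    qed
  qed
  then show ?thesis by blast
qed

text \<open>Some path in \<open>U\<close> closes the ear to a positive circuit, which is good. So \<open>sig\<close> is \<open>s u * s v\<close> on
  the ear, and \<open>s\<close> extends consistently from either end. Paths between new vertices lead through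
  \<open>U\<close>, where either charge is available.\<close>

lemma ear_step:
  assumes bal: "balanced_links U s" and none: "\<And>xs. \<not> bad xs"
    and ear: "u \<in> U" "v \<in> U" "u \<noteq> v" "Z \<noteq> []" "distinct Z" "set Z \<inter> U = {}" "successively adj (u # Z @ [v])"
  shows "\<exists>s'. balanced_links (U \<union> set Z) s'"
proof -
  have s_sq: "s x * s x = 1" for x using bal by (simp add: balanced_links_def)
  have link: "reach U x y a (s x * s y)" if "x \<in> U" "y \<in> U" "x \<noteq> y" "a \<in> {1, -1}" for x y a
    using bal that unfolding balanced_links_def by blast
  have ep: "path_eps xs \<in> {1, -1}" for xs using path_eps_cases[of xs] by auto
  have dP: "distinct (u # Z @ [v])" using ear by auto
  have sigP: "path_sig (u # Z @ [v]) = s u * s v"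
  proof -
    obtain R where R: "R \<noteq> []" "distinct R" "set R \<subseteq> U" "hd R = u" "last R = v"
        "successively adj R" "path_eps R = path_eps (u # Z @ [v])" "path_sig R = s u * s v"
      using link[OF ear(1-3) ep] unfolding reach_def by blast
    have w: "cycle_prod g (R @ rev Z) =
        path_prod g R * path_prod g (u # Z @ [v])" for g :: "'a set \<Rightarrow> real"
      using R ear(4)
      by (simp add: cycle_weight_append path_weight_rev_symmetric path_weight_Cons path_weight_append
          hd_rev last_rev insert_commute)
    have ends: "adj u (hd Z)" "adj (last Z) v" "successively adj Z"
      using ear(4,7) by (auto simp: successively_append_iff successively_Cons)
    have "circuit (R @ rev Z)"
      using R ear ends adj_sym by (auto simp: circuit_append hd_rev last_rev)
    moreover have "cycle_eps (R @ rev Z) = 1" using R(7) ep[of R] unfolding w by auto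
    ultimately have "cycle_sig (R @ rev Z) = 1"
      using none[of "R @ rev Z"] cycle_sig_cases[of "R @ rev Z"] by (auto simp: bad_def)
    then show ?thesis using R(8) path_sig_cases[of "u # Z @ [v]"] unfolding w by auto
  qed
  define s' where "s' x = (if x \<in> set Z then s u * path_sig (u # takeWhile (\<lambda>y. y \<noteq> x) Z @ [x]) else s x)" for x
  have s'U: "s' x = s x" if "x \<in> U" for x using that ear(6) by (auto simp: s'_def)
  have s'_sq: "s' x * s' x = 1" for x
  proof -
    have "(a * b) * (a * b) = 1" if "a * a = 1" "b * b = 1" for a b :: real
    proof -
      have "(a * b) * (a * b) = (a * a) * (b * b)" by (simp only: mult_ac)
      then show ?thesis using that by simp
    qed
    then show ?thesis using s_sq path_sig_sq by (simp add: s'_def)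
  qed
  have legs: "\<exists>a1. a1 \<in> {1, -1} \<and> reach (insert u (insert x (set Z1))) u x a1 (s u * s' x)"
    "\<exists>a2. a2 \<in> {1, -1} \<and> reach (insert v (insert x (set Z2))) x v a2 (s' x * s v)"
    if Z: "Z = Z1 @ x # Z2" for x Z1 Z2
  proof -
    have "takeWhile (\<lambda>y. y \<noteq> x) Z = Z1"
      using ear(5) unfolding Z by (simp add: takeWhile_tail) (metis takeWhile_eq_all_conv)
    then have s'x: "s' x = s u * path_sig (u # Z1 @ [x])" by (simp add: s'_def Z)
    have t1: "path_sig (u # Z1 @ [x]) = s u * s' x"
      using s_sq[of u] by (simp add: s'x mult.assoc[symmetric])
    have "path_sig (u # Z @ [v]) = path_sig (u # Z1 @ [x]) * path_sig (x # Z2 @ [v])"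
      using path_weight_split[of _ "u # Z1" x "Z2 @ [v]"] by (simp add: Z)
    then have "s u * s v = s u * (s' x * path_sig (x # Z2 @ [v]))"
      using sigP t1 by (simp add: mult.assoc)
    then have "s u * s u * s v = s u * s u * (s' x * path_sig (x # Z2 @ [v]))" by (simp add: mult.assoc)
    then have "s v = s' x * path_sig (x # Z2 @ [v])" using s_sq[of u] by simp
    then have t2: "path_sig (x # Z2 @ [v]) = s' x * s v"
      using s'_sq[of x] by (simp add: mult.assoc[symmetric])
    have succ: "successively adj (u # Z1 @ [x])" "successively adj (x # Z2 @ [v])"
      using ear(7) successively_append_iff[of adj "u # Z1 @ [x]" "Z2 @ [v]"]
        successively_append_iff[of adj "u # Z1" "x # Z2 @ [v]"] by (auto simp: Z)
    have "reach (set (u # Z1 @ [x])) u x (path_eps (u # Z1 @ [x])) (path_sig (u # Z1 @ [x]))"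
      using reach_path[of "u # Z1 @ [x]"] succ dP by (auto simp: Z)
    then show "\<exists>a1. a1 \<in> {1, -1} \<and> reach (insert u (insert x (set Z1))) u x a1 (s u * s' x)"
      using ep t1 by auto
    have "reach (set (x # Z2 @ [v])) x v (path_eps (x # Z2 @ [v])) (path_sig (x # Z2 @ [v]))"
      using reach_path[of "x # Z2 @ [v]"] succ dP by (auto simp: Z)
    moreover have "set (x # Z2 @ [v]) = insert v (insert x (set Z2))" by auto
    ultimately show "\<exists>a2. a2 \<in> {1, -1} \<and> reach (insert v (insert x (set Z2))) x v a2 (s' x * s v)"
      using ep t2 by metis
  qed
  have cancel: "(p * q) * (q * r) = p * r" if "q * q = 1" for p q r :: real
  proof -
    have "(p * q) * (q * r) = p * r * (q * q)" by (simp only: mult_ac)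
    then show ?thesis using that by simp
  qed
  have sgn_prod: "a1 * (a1 * a) = a" if "a1 \<in> {1, -1}" for a1 a :: real using that by auto
  have mixed: "reach (U \<union> set Z) x y a (s' x * s' y)" if x: "x \<in> set Z" and y: "y \<in> U" and a: "a \<in> {1, -1}" for x y a
  proof -
    obtain Z1 Z2 where Z: "Z = Z1 @ x # Z2" using x by (metis split_list)
    show ?thesis
    proof (cases "y = u")
      case False
      obtain a1 where a1: "a1 \<in> {1, -1}" "reach (insert u (insert x (set Z1))) u x a1 (s u * s' x)"
        using legs(1)[OF Z] by blast
      have "a1 * a \<in> {1, -1}" using a a1 by auto
      then have "reach U u y (a1 * a) (s u * s y)" using link ear(1) y False by auto
      then have "reach (insert u (insert x (set Z1)) \<union> U) x y (a1 * (a1 * a)) (s u * s' x * (s u * s y))"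
        by (rule reach_trans[OF reach_sym[OF a1(2)]]) (use ear(6) in \<open>auto simp: Z\<close>)
      moreover have "s u * s' x * (s u * s y) = s' x * s' y"
        using cancel[OF s_sq[of u], of "s' x" "s y"] s'U[OF y]
        by (simp only: mult.commute[of "s u" "s' x"])
      ultimately have "reach (insert u (insert x (set Z1)) \<union> U) x y a (s' x * s' y)"
        by (simp only: sgn_prod[OF a1(1)])
      then show ?thesis by (rule reach_mono) (use ear in \<open>auto simp: Z\<close>)
    next
      case True
      obtain a1 where a1: "a1 \<in> {1, -1}" "reach (insert v (insert x (set Z2))) x v a1 (s' x * s v)"
        using legs(2)[OF Z] by blast
      have "a1 * a \<in> {1, -1}" using a a1 by auto
      then have "reach U v y (a1 * a) (s v * s y)" using link ear(2,3) y True by auto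
      then have "reach (insert v (insert x (set Z2)) \<union> U) x y (a1 * (a1 * a)) (s' x * s v * (s v * s y))"
        by (rule reach_trans[OF a1(2)]) (use ear(6) in \<open>auto simp: Z\<close>)
      then have "reach (insert v (insert x (set Z2)) \<union> U) x y a (s' x * s' y)"
        using cancel[OF s_sq[of v], of "s' x" "s y"] sgn_prod[OF a1(1)] s'U[OF y] by simp
      then show ?thesis by (rule reach_mono) (use ear in \<open>auto simp: Z\<close>)
    qed
  qed
  have inner: "reach (U \<union> set Z) x y a (s' x * s' y)" if Z: "Z = Z1 @ x # Z2 @ y # Z3" and a: "a \<in> {1, -1}"
    for x y a Z1 Z2 Z3
  proof -
    have yZ: "y \<in> set Z" by (simp add: Z)
    obtain a1 where a1: "a1 \<in> {1, -1}" "reach (insert u (insert x (set Z1))) u x a1 (s u * s' x)"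
      using legs(1)[OF Z] by blast
    obtain a2 where a2: "a2 \<in> {1, -1}" "reach (insert v (insert y (set Z3))) y v a2 (s' y * s v)"
      using legs(2)[of "Z1 @ x # Z2" y Z3] Z by auto
    have "a1 * (a2 * a) \<in> {1, -1}" using a a1 a2 by auto
    then have "reach U u v (a1 * (a2 * a)) (s u * s v)" using link ear(1-3) by auto
    then have "reach (insert u (insert x (set Z1)) \<union> U) x v (a1 * (a1 * (a2 * a))) (s u * s' x * (s u * s v))"
      by (rule reach_trans[OF reach_sym[OF a1(2)]]) (use ear(6) in \<open>auto simp: Z\<close>)
    moreover have "s u * s' x * (s u * s v) = s' x * s v"
      using cancel[OF s_sq[of u], of "s' x" "s v"] by (simp only: mult.commute[of "s u" "s' x"])
    ultimately have 1: "reach (insert u (insert x (set Z1)) \<union> U) x v (a2 * a) (s' x * s v)"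
      by (simp only: sgn_prod[OF a1(1)])
    have "reach (insert u (insert x (set Z1)) \<union> U \<union> insert v (insert y (set Z3))) x y
        (a2 * a * a2) (s' x * s v * (s' y * s v))"
      by (rule reach_trans[OF 1 reach_sym[OF a2(2)]]) (use ear(5,6) dP in \<open>auto simp: Z\<close>)
    moreover have "a2 * a * a2 = a" using a2(1) by auto
    moreover have "s' x * s v * (s' y * s v) = s' x * s' y"
      using cancel[OF s_sq[of v], of "s' x" "s' y"] by (simp add: mult.commute)
    ultimately have "reach (insert u (insert x (set Z1)) \<union> U \<union> insert v (insert y (set Z3))) x y a (s' x * s' y)"
      by simp
    then show ?thesis by (rule reach_mono) (use ear in \<open>auto simp: Z\<close>)
  qed
  have "balanced_links (U \<union> set Z) s'"
    unfolding balanced_links_def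
  proof (intro conjI allI ballI impI)
    show "s' x * s' x = 1" for x by (rule s'_sq)
    fix x y a assume xy: "x \<in> U \<union> set Z" "y \<in> U \<union> set Z" "x \<noteq> y" and a: "a \<in> {1, -1::real}"
    show "reach (U \<union> set Z) x y a (s' x * s' y)"
    proof (cases "x \<in> set Z")
      case xZ: True
      show ?thesis
      proof (cases "y \<in> set Z")
        case yZ: True
        obtain P Q where PQ: "Z = P @ x # Q" using xZ by (metis split_list)
        then consider "y \<in> set P" | "y \<in> set Q" using yZ xy by auto
        then show ?thesis
        proof cases
          case 1
          then obtain P1 P2 where "P = P1 @ y # P2" by (metis split_list)
          then have "reach (U \<union> set Z) y x a (s' y * s' x)" using inner[of P1 y P2 x Q a] PQ a by simp
          then show ?thesis using reach_sym by (simp add: mult.commute)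
        next
          case 2
          then obtain Q1 Q2 where "Q = Q1 @ y # Q2" by (metis split_list)
          then show ?thesis using inner[of P x Q1 y Q2 a] PQ a by simp
        qed
      next
        case False
        then show ?thesis using mixed[of x y a] xZ xy a by auto
      qed
    next
      case False
      then have xU: "x \<in> U" using xy by auto
      show ?thesis
      proof (cases "y \<in> set Z")
        case True
        then have "reach (U \<union> set Z) y x a (s' y * s' x)" using mixed[of y x a] xU a by auto
        then show ?thesis using reach_sym by (simp add: mult.commute)
      next
        case False
        then have yU: "y \<in> U" using xy by auto
        then have "reach U x y a (s x * s y)" using link xU xy(3) a by blast
        then show ?thesis using reach_mono s'U xU yU by (metis Un_upper1)
      qed
    qed
  qed
  then show ?thesis by blast
qed

end

definition ear_property :: "'a set \<Rightarrow> ('a \<Rightarrow> 'a \<Rightarrow> bool) \<Rightarrow> bool" where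
  "ear_property V adj \<longleftrightarrow> (\<forall>U a b. U \<subset> V \<longrightarrow> a \<in> U \<longrightarrow> b \<in> U \<longrightarrow> a \<noteq> b \<longrightarrow>
    (\<exists>u v Z. u \<in> U \<and> v \<in> U \<and> u \<noteq> v \<and> Z \<noteq> [] \<and> distinct Z \<and> set Z \<subseteq> V - U \<and>
      successively adj (u # Z @ [v])))"

context signed_graph
begin

text \<open>Ears are added until the links span all vertices. Then every edge is closed to a positive
  circuit by a path of the same charge.\<close>

lemma coboundary_if_negative_circuit:
  assumes "finite V" and ears: "ear_property V adj" and none: "\<And>xs. \<not> bad xs"
    and edge_V: "\<And>x y. adj x y \<Longrightarrow> x \<in> V"
    and C: "circuit C" "cycle_eps C = -1" "cycle_sig C = 1"
  shows "\<exists>s. (\<forall>x. s x * s x = 1) \<and> (\<forall>x y. adj x y \<longrightarrow> sig {x, y} = s x * s y)"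
proof -
  have grow: "\<exists>s. balanced_links V s" if "U \<subseteq> V" "p \<in> U" "q \<in> U" "p \<noteq> q" "balanced_links U s" for U p q s
    using that
  proof (induction "card (V - U)" arbitrary: U s rule: less_induct)
    case less
    show ?case
    proof (cases "U = V")
      case False
      then have "U \<subset> V" using less.prems by auto
      then obtain u v Z where ear: "u \<in> U" "v \<in> U" "u \<noteq> v" "Z \<noteq> []" "distinct Z" "set Z \<subseteq> V - U"
          "successively adj (u # Z @ [v])"
        using ears[unfolded ear_property_def, rule_format, OF \<open>U \<subset> V\<close> less.prems(2-4)] by blast
      obtain s' where s': "balanced_links (U \<union> set Z) s'"
        using ear_step[OF less.prems(5) none ear(1-5) _ ear(7)] ear(6) by blast
      have "V - (U \<union> set Z) \<subset> V - U" using ear(4,6) by (cases Z) auto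
      then have "card (V - (U \<union> set Z)) < card (V - U)"
        using \<open>finite V\<close> by (intro psubset_card_mono) auto
      then show ?thesis by (rule less.hyps[OF _ _ _ _ _ s']) (use less.prems ear in auto)
    qed (use less.prems in blast)
  qed
  have "set C \<subseteq> V"
  proof
    fix x assume "x \<in> set C"
    then obtain us vs where "C = us @ x # vs" by (metis split_list)
    then have "circuit (x # vs @ us)" using C circuit_rotate[of us "x # vs"] by simp
    then have "adj x (last (x # vs @ us))" using adj_sym by (simp add: circuit_def)
    then show "x \<in> V" by (rule edge_V)
  qed
  moreover have "hd C \<in> set C" "last C \<in> set C" "hd C \<noteq> last C"
    using C adj_irrefl by (auto simp: circuit_def)
  ultimately obtain s where s: "balanced_links V s"
    using negative_circuit_balanced[OF C] grow by blast
  have "sig {x, y} = s x * s y" if "adj x y" for x y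
  proof -
    have "x \<in> V" "y \<in> V" "x \<noteq> y" using that edge_V adj_sym adj_irrefl by blast+
    moreover have "eps {x, y} \<in> {1, -1}" using eps_cases by blast
    ultimately obtain R where R: "R \<noteq> []" "distinct R" "hd R = x" "last R = y" "successively adj R"
        "path_eps R = eps {x, y}" "path_sig R = s x * s y"
      using s unfolding balanced_links_def reach_def by blast
    have "circuit R" using R that adj_sym by (simp add: circuit_def)
    moreover have "cycle_eps R = 1" using R eps_sq by (simp add: cycle_weight_def insert_commute)
    ultimately have "cycle_sig R = 1" using none[of R] cycle_sig_cases[of R] by (auto simp: bad_def)
    then have "path_sig R * sig {x, y} = 1" using R by (simp add: cycle_weight_def insert_commute)
    then have "sig {x, y} = path_sig R" using path_sig_cases[of R] by auto
    then show ?thesis using R by simp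
  qed
  then show ?thesis using s unfolding balanced_links_def by blast
qed

end

text \<open>Every vertex contributes its sign once for each edge at it, hence an even number of times.\<close>

lemma prod_even_degree_coboundary:
  fixes s :: "'a \<Rightarrow> real"
  assumes "finite V" "finite F" and F: "\<And>e. e \<in> F \<Longrightarrow> e \<subseteq> V \<and> card e = 2"
    and even: "\<And>v. v \<in> V \<Longrightarrow> even (card {e \<in> F. v \<in> e})"
    and s: "\<And>x. s x * s x = 1" and g: "\<And>x y. {x, y} \<in> F \<Longrightarrow> x \<noteq> y \<Longrightarrow> g {x, y} = s x * s y"
  shows "(\<Prod>e\<in>F. g e) = 1"
proof -
  have "(\<Prod>e\<in>F. g e) = (\<Prod>e\<in>F. \<Prod>x\<in>V. if x \<in> e then s x else 1)"
  proof (rule prod.cong[OF refl])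
    fix e assume e: "e \<in> F"
    then obtain x y where xy: "e = {x, y}" "x \<noteq> y" using F[OF e] by (auto simp: card_2_iff)
    have "V \<inter> e = e" using F[OF e] by auto
    then have "(\<Prod>x\<in>V. if x \<in> e then s x else 1) = (\<Prod>x\<in>e. s x)"
      using prod.inter_restrict[OF \<open>finite V\<close>, of s e] by simp
    then show "g e = (\<Prod>x\<in>V. if x \<in> e then s x else 1)" using g e xy by simp
  qed
  also have "\<dots> = (\<Prod>x\<in>V. \<Prod>e\<in>F. if x \<in> e then s x else 1)" by (rule prod.swap)
  also have "\<dots> = (\<Prod>x\<in>V. 1)"
  proof (rule prod.cong[OF refl])
    fix x assume "x \<in> V"
    have "(\<Prod>e\<in>F. if x \<in> e then s x else 1) = (\<Prod>e\<in>{e\<in>F. x \<in> e}. s x)"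
      by (rule prod.inter_filter[OF \<open>finite F\<close>, symmetric])
    also have "\<dots> = s x ^ card {e\<in>F. x \<in> e}" by simp
    also have "\<dots> = 1"
      using even[OF \<open>x \<in> V\<close>] s[of x] by (auto elim!: evenE simp: power_mult power2_eq_square)
    finally show "(\<Prod>e\<in>F. if x \<in> e then s x else 1) = 1" .
  qed
  finally show ?thesis by simp
qed

context signed_graph
begin

text \<open>If some negative circuit has \<open>sig\<close>-sign \<open>1\<close>, then \<open>sig\<close> is a coboundary. If it has sign \<open>-1\<close>,
  then \<open>eps * sig\<close> is one, and this product agrees with \<open>sig\<close> on positive sets.\<close>

theorem positive_even_set_sign:
  assumes V: "finite V" and ears: "ear_property V adj" and none: "\<And>xs. \<not> bad xs"
    and edge_V: "\<And>x y. adj x y \<Longrightarrow> x \<in> V" and big: "card V \<ge> 3"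
    and F: "\<And>e. e \<in> F \<Longrightarrow> e \<subseteq> V \<and> card e = 2" "\<And>x y. {x, y} \<in> F \<Longrightarrow> adj x y"
    and even: "\<And>v. v \<in> V \<Longrightarrow> even (card {e \<in> F. v \<in> e})"
    and pos: "(\<Prod>e\<in>F. eps e) = 1"
  shows "(\<Prod>e\<in>F. sig e) = 1"
proof -
  have "F \<subseteq> Pow V" using F by auto
  then have finF: "finite F" using V by (simp add: finite_subset)
  have conclude: "(\<Prod>e\<in>F. g e) = 1"
    if cob: "\<exists>s. (\<forall>x. s x * s x = 1) \<and> (\<forall>x y. adj x y \<longrightarrow> g {x, y} = s x * s y)" for g :: "'a set \<Rightarrow> real"
  proof -
    obtain s where "\<And>x. s x * s x = 1" "\<And>x y. adj x y \<Longrightarrow> g {x, y} = s x * s y" using cob by blast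
    then show ?thesis using prod_even_degree_coboundary[OF V finF F(1) even] F(2) by blast
  qed
  consider (a) C where "circuit C" "cycle_eps C = -1" "cycle_sig C = 1"
    | (b) C where "circuit C" "cycle_eps C = -1" "cycle_sig C = -1"
    | (c) "\<And>C. circuit C \<Longrightarrow> cycle_eps C = 1"
    using cycle_eps_cases cycle_sig_cases by metis
  then show ?thesis
  proof cases
    case a
    show ?thesis by (rule conclude[OF coboundary_if_negative_circuit[OF V ears none edge_V a]])
  next
    case b
    define sig' where "sig' e = eps e * sig e" for e
    interpret S: signed_graph adj eps sig'
    proof
      show "sig' e * sig' e = 1" for e
        using eps_cases[of e] sig_cases[of e] by (auto simp: sig'_def)
    qed (use adj_sym adj_irrefl eps_sq in auto)
    have w: "S.cycle_sig xs = cycle_eps xs * cycle_sig xs" for xs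
      by (simp add: sig'_def cycle_weight_mult)
    have none': "\<not> S.bad xs" for xs using none[of xs] w[of xs] by (simp add: S.bad_def bad_def)
    have sgC: "S.cycle_sig C = 1" using b w by simp
    have "(\<Prod>e\<in>F. sig' e) = 1"
      by (rule conclude[OF S.coboundary_if_negative_circuit[OF V ears none' edge_V b(1,2) sgC]])
    then show ?thesis using pos by (simp add: sig'_def prod.distrib)
  next
    case c
    have sig1: "cycle_sig C = 1" if "circuit C" for C
      using none[of C] c[OF that] cycle_sig_cases[of C] that by (auto simp: bad_def)
    \<comment> \<open>Two successive ears produce some circuit. As \<open>sig\<close> is trivial on all circuits, the charge may
      be replaced by one that is negative on this circuit, which reduces to the first case.\<close>
    obtain C where C: "circuit C" "length C \<ge> 3"
    proof -
      have ear: "\<exists>u v Z. u \<in> {a, b} \<and> v \<in> {a, b} \<and> u \<noteq> v \<and> Z \<noteq> [] \<and> distinct Z \<and> set Z \<subseteq> V - {a, b} \<and>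
          successively adj (u # Z @ [v])" if "a \<in> V" "b \<in> V" "a \<noteq> b" for a b
      proof -
        have "card {a, b} = 2" using that by simp
        then have "{a, b} \<noteq> V" using big by auto
        then have "{a, b} \<subset> V" using that by auto
        then show ?thesis
          using ears[unfolded ear_property_def, rule_format, of "{a, b}" a b] that(3) by blast
      qed
      have "V \<noteq> {}" using big by auto
      then obtain a where a: "a \<in> V" by auto
      have "V \<noteq> {a}" using big by auto
      then obtain b where b: "b \<in> V" "a \<noteq> b" using a by blast
      obtain u v Z where Z: "u \<in> {a, b}" "Z \<noteq> []" "set Z \<subseteq> V - {a, b}" "successively adj (u # Z @ [v])"
        using ear[OF a b] by blast
      define z where "z = hd Z"
      have z: "adj u z" "z \<in> V" "z \<noteq> u" using Z by (cases Z; auto simp: z_def)+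
      have "u \<in> V" using Z(1) a b by auto
      obtain u' v' Z' where Z': "u' \<in> {u, z}" "v' \<in> {u, z}" "u' \<noteq> v'" "Z' \<noteq> []" "distinct Z'"
          "set Z' \<subseteq> V - {u, z}" "successively adj (u' # Z' @ [v'])"
        using ear[OF \<open>u \<in> V\<close> z(2) z(3)[symmetric]] by blast
      have "adj v' u'" using Z'(1-3) z(1) adj_sym by auto
      then have "circuit (u' # Z' @ [v'])" using Z' by (auto simp: circuit_def)
      moreover have "length (u' # Z' @ [v']) \<ge> 3" using Z'(4) by (cases Z') auto
      ultimately show ?thesis by (rule that)
    qed
    define e0 where "e0 = {last C, hd C}"
    define eps' where "eps' e = (if e = e0 then -1 else 1 :: real)" for e
    interpret S: signed_graph adj eps' sig
      by unfold_locales (use adj_sym adj_irrefl sig_sq in \<open>auto simp: eps'_def\<close>)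
    have none': "\<not> S.bad xs" for xs using sig1[of xs] by (auto simp: S.bad_def)
    have dC: "distinct C" using C by (simp add: circuit_def)
    have "S.cycle_eps C = (\<Prod>e\<in>cycle_edges C. eps' e)"
      by (rule prod_cycle_edges[OF dC C(2), symmetric])
    also have "\<dots> = (\<Prod>e\<in>{e0}. -1)"
      by (rule prod.mono_neutral_cong_right) (auto simp: eps'_def e0_def cycle_edges_def)
    finally have epC: "S.cycle_eps C = -1" by simp
    show ?thesis
      by (rule conclude[OF S.coboundary_if_negative_circuit[OF V ears none' edge_V C(1) epC sig1[OF C(1)]]])
  qed
qed

end

section \<open>Simple cycles, closed lists and blocks\<close>

definition adjacent :: "'a graph \<Rightarrow> 'a \<Rightarrow> 'a \<Rightarrow> bool" where
  "adjacent G x y \<longleftrightarrow> {x, y} \<in> edges G"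

lemma adjacent_sym: "adjacent G x y \<Longrightarrow> adjacent G y x"
  by (simp add: adjacent_def insert_commute)

lemma adjacent_irrefl: "simple_graph G \<Longrightarrow> \<not> adjacent G x x"
  by (auto simp: adjacent_def simple_graph_def)

lemma adjacent_verts: "simple_graph G \<Longrightarrow> adjacent G x y \<Longrightarrow> x \<in> verts G \<and> y \<in> verts G"
  by (auto simp: adjacent_def simple_graph_def)

lemma simple_graph_finite_edges: "simple_graph G \<Longrightarrow> finite (edges G)"
  by (rule finite_subset[of _ "Pow (verts G)"]) (auto simp: simple_graph_def)

lemma simple_graph_edge: "simple_graph G \<Longrightarrow> e \<in> edges G \<Longrightarrow> \<exists>x y. e = {x, y} \<and> x \<noteq> y \<and> x \<in> verts G \<and> y \<in> verts G"
proof -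
  assume "simple_graph G" "e \<in> edges G"
  then have "card e = 2" "e \<subseteq> verts G" by (auto simp: simple_graph_def)
  then show ?thesis unfolding card_2_iff by auto
qed

lemma rtrancl_leaves:
  assumes "(a, b) \<in> r\<^sup>*" "a \<in> U" "b \<notin> U"
  shows "\<exists>x y. (x, y) \<in> r \<and> x \<in> U \<and> y \<notin> U"
  using assms by (induction rule: converse_rtrancl_induct) auto

lemma rtrancl_first_hit:
  assumes "(x, v) \<in> r\<^sup>*" "x \<notin> U" "v \<in> U"
  shows "\<exists>Z v'. Z \<noteq> [] \<and> distinct Z \<and> hd Z = x \<and> set Z \<inter> U = {} \<and>
    successively (\<lambda>a b. (a, b) \<in> r) Z \<and> v' \<in> U \<and> (last Z, v') \<in> r"
  using assms
proof (induction rule: converse_rtrancl_induct)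
  case (step x y)
  show ?case
  proof (cases "y \<in> U")
    case True
    then show ?thesis using step by (intro exI[of _ "[x]"] exI[of _ y]) auto
  next
    case False
    then obtain Z v' where Z: "Z \<noteq> []" "distinct Z" "hd Z = y" "set Z \<inter> U = {}"
      "successively (\<lambda>a b. (a, b) \<in> r) Z" "v' \<in> U" "(last Z, v') \<in> r" using step by blast
    show ?thesis
    proof (cases "x \<in> set Z")
      case True
      then obtain Z1 Z2 where "Z = Z1 @ x # Z2" by (metis split_list)
      then show ?thesis using Z
        by (intro exI[of _ "x # Z2"] exI[of _ v']) (auto simp: successively_append_iff)
    next
      case False
      then show ?thesis using Z step
        by (intro exI[of _ "x # Z"] exI[of _ v']) (auto simp: successively_Cons)
    qed
  qed
qed auto

text \<open>Leave \<open>U\<close> along an edge at some vertex \<open>u\<close>. As \<open>u\<close> is no articulation point, \<open>U\<close> can be reached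
  again without passing through \<open>u\<close>; the first return ends the ear.\<close>

lemma two_connected_ear_property:
  assumes H: "two_connected H" "simple_graph H"
  shows "ear_property (verts H) (adjacent H)"
  unfolding ear_property_def
proof (intro allI impI)
  fix U a b assume U: "U \<subset> verts H" "a \<in> U" "b \<in> U" "a \<noteq> b"
  let ?r = "{(x, y). {x, y} \<in> edges H}"
  obtain c where c: "c \<in> verts H" "c \<notin> U" using U by auto
  have "(a, c) \<in> ?r\<^sup>*" using H(1) U c by (auto simp: two_connected_def connected_graph_def)
  then obtain u x where ux: "{u, x} \<in> edges H" "u \<in> U" "x \<notin> U"
    using rtrancl_leaves[of a c ?r U] U(2) c(2) by auto
  obtain w where w: "w \<in> U" "w \<noteq> u" using U by metis
  let ?H' = "remove_vertex H u"
  have "connected_graph ?H'" using H(1) U ux(2) by (auto simp: two_connected_def articulation_point_def)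
  moreover have "x \<in> verts ?H'" "w \<in> verts ?H'"
    using adjacent_verts[OF H(2), of u x] ux w U by (auto simp: remove_vertex_def adjacent_def)
  ultimately have "(x, w) \<in> {(x, y). {x, y} \<in> edges ?H'}\<^sup>*" by (simp add: connected_graph_def)
  from rtrancl_first_hit[OF this ux(3) w(1)] obtain Z v where Z: "Z \<noteq> []" "distinct Z" "hd Z = x"
      "set Z \<inter> U = {}" "successively (\<lambda>a b. {a, b} \<in> edges ?H') Z" "v \<in> U" "{last Z, v} \<in> edges ?H'"
    by auto
  have succ: "successively (adjacent H) Z"
    using Z(5) by (rule successively_mono) (auto simp: remove_vertex_def adjacent_def)
  have "v \<noteq> u" "adjacent H (last Z) v" using Z(7) by (auto simp: remove_vertex_def adjacent_def)
  moreover have "adjacent H u (hd Z)" using ux Z by (simp add: adjacent_def)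
  ultimately have path: "successively (adjacent H) (u # Z @ [v])"
    using succ Z(1) by (auto simp: successively_Cons successively_append_iff)
  have "set Z \<subseteq> verts H"
  proof
    fix z assume "z \<in> set Z"
    then obtain Z1 Z2 where "Z = Z1 @ z # Z2" by (metis split_list)
    then have "adjacent H z (hd (Z2 @ [v]))"
      using path by (cases Z2) (auto simp: successively_Cons successively_append_iff)
    then show "z \<in> verts H" using adjacent_verts[OF H(2)] by blast
  qed
  then show "\<exists>u v Z. u \<in> U \<and> v \<in> U \<and> u \<noteq> v \<and> Z \<noteq> [] \<and> distinct Z \<and> set Z \<subseteq> verts H - U \<and>
      successively (adjacent H) (u # Z @ [v])"
    using ux(2) Z \<open>v \<noteq> u\<close> path by blast
qed

text \<open>The circuits that are simple cycles; lists of length two are excluded.\<close>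

definition closed_list :: "'a graph \<Rightarrow> 'a list \<Rightarrow> bool" where
  "closed_list G xs \<longleftrightarrow> length xs \<ge> 3 \<and> distinct xs \<and> successively (adjacent G) xs \<and>
    adjacent G (last xs) (hd xs)"

lemma closed_list_rotate: "closed_list G (xs @ ys) = closed_list G (ys @ xs)"
  by (cases "xs = []"; cases "ys = []") (auto simp: closed_list_def successively_append_iff)

lemma closed_list_edges: "closed_list G xs \<Longrightarrow> cycle_edges xs \<subseteq> edges G"
  using successively_path_edges[of "\<lambda>e. e \<in> edges G" xs]
  by (auto simp: closed_list_def cycle_edges_def adjacent_def)

lemma successively_connected:
  assumes "successively (adjacent G) xs" "x \<in> set xs" "y \<in> set xs"
  shows "(x, y) \<in> {(x, y). {x, y} \<in> edges G}\<^sup>*"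
proof -
  let ?r = "{(x, y). {x, y} \<in> edges G}"
  have hd: "(hd xs, z) \<in> ?r\<^sup>*" if "successively (adjacent G) xs" "z \<in> set xs" for xs z
    using that
  proof (induction xs)
    case (Cons a xs)
    show ?case
    proof (cases "z = a")
      case False
      then have z: "z \<in> set xs" "xs \<noteq> []" using Cons.prems by auto
      then have "(hd xs, z) \<in> ?r\<^sup>*" "(a, hd xs) \<in> ?r"
        using Cons by (auto simp: successively_Cons adjacent_def)
      then show ?thesis by (simp add: converse_rtrancl_into_rtrancl)
    qed simp
  qed simp
  have "sym ?r" by (auto simp: sym_def insert_commute)
  then have "sym (?r\<^sup>*)" by (rule sym_rtrancl)
  then have "(x, hd xs) \<in> ?r\<^sup>*" using hd[OF assms(1,2)] by (auto dest: symD)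
  then show ?thesis using hd[OF assms(1,3)] by simp
qed

lemma cycle_edges_at_vertex:
  assumes "distinct xs" "length xs \<ge> 3" "v \<in> set xs"
  shows "card {e \<in> cycle_edges xs. v \<in> e} = 2"
proof -
  obtain P Q where PQ: "xs = P @ v # Q" using assms(3) by (metis split_list)
  let ?T = "Q @ P"
  have ce: "cycle_edges xs = cycle_edges ([v] @ ?T)"
    using cycle_edges_rotate[of P "v # Q"] by (simp add: PQ)
  have T: "distinct ?T" "v \<notin> set ?T" "length ?T \<ge> 2" using assms by (auto simp: PQ)
  have Tne: "?T \<noteq> []" using T(3) by auto
  have "hd ?T \<noteq> last ?T" using distinct_hd_eq_last[OF T(1) Tne] T(3) by auto
  then have "{v, hd ?T} \<noteq> {last ?T, v}" using T(2) Tne by (auto simp: doubleton_eq_iff)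
  moreover have "{e \<in> cycle_edges xs. v \<in> e} = {{v, hd ?T}, {last ?T, v}}"
  proof -
    have "cycle_edges xs = {{v, hd ?T}, {last ?T, v}} \<union> path_edges ?T"
      unfolding ce using cycle_edges_append[of "[v]" ?T] Tne by auto
    moreover have "v \<notin> e" if "e \<in> path_edges ?T" for e
      using path_edges_subset[OF that] T(2) by blast
    ultimately show ?thesis by blast
  qed
  ultimately show ?thesis by simp
qed

lemma closed_list_verts: "simple_graph G \<Longrightarrow> closed_list G xs \<Longrightarrow> set xs \<subseteq> verts G"
proof
  fix x assume G: "simple_graph G" "closed_list G xs" and "x \<in> set xs"
  then obtain us vs where "xs = us @ x # vs" by (metis split_list)
  then have "closed_list G (x # vs @ us)" using G closed_list_rotate[of G us "x # vs"] by simp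
  then have "adjacent G (last (x # vs @ us)) x" by (simp add: closed_list_def)
  then show "x \<in> verts G" using adjacent_verts[OF G(1)] by blast
qed

lemma closed_list_simple_cycle:
  assumes G: "simple_graph G" and xs: "closed_list G xs"
  shows "(set xs, cycle_edges xs) \<in> simple_cycles G"
proof -
  have ne: "xs \<noteq> []" using xs by (auto simp: closed_list_def)
  have e: "cycle_edges xs \<subseteq> edges G" by (rule closed_list_edges[OF xs])
  then have "simple_graph (set xs, cycle_edges xs)"
    using G cycle_edges_subset[OF ne] by (auto simp: simple_graph_def)
  moreover have "set xs \<subseteq> verts G" by (rule closed_list_verts[OF assms])
  moreover have "connected_graph (set xs, cycle_edges xs)"
  proof -
    have "successively (adjacent (set xs, cycle_edges xs)) xs"
      using successively_path_edges[of "\<lambda>e. e \<in> cycle_edges xs" xs]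
      by (auto simp: adjacent_def[abs_def] cycle_edges_def)
    then show ?thesis using successively_connected[of "(set xs, cycle_edges xs)" xs] ne
      by (simp add: connected_graph_def)
  qed
  moreover have "degree_in (set xs, cycle_edges xs) v = 2" if "v \<in> set xs" for v
    using cycle_edges_at_vertex[OF _ _ that] xs by (simp add: degree_in_def closed_list_def)
  ultimately show ?thesis using e by (simp add: simple_cycles_def is_subgraph_def)
qed

lemma degree_in_neighbours:
  assumes "simple_graph C" shows "degree_in C v = card {w. adjacent C v w}"
proof -
  have "inj_on (\<lambda>w. {v, w}) {w. adjacent C v w}" by (rule inj_onI) (auto simp: doubleton_eq_iff)
  moreover have "(\<lambda>w. {v, w}) ` {w. adjacent C v w} = {e \<in> edges C. v \<in> e}"
  proof (intro equalityI subsetI)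
    fix e assume e: "e \<in> {e \<in> edges C. v \<in> e}"
    then obtain x y where "e = {x, y}" using simple_graph_edge[OF assms, of e] by auto
    then have "e = {v, if v = x then y else x}" using e by auto
    then show "e \<in> (\<lambda>w. {v, w}) ` {w. adjacent C v w}"
      using e unfolding adjacent_def by blast
  qed (auto simp: adjacent_def)
  ultimately show ?thesis using card_image[of "\<lambda>w. {v, w}" "{w. adjacent C v w}"]
    by (simp add: degree_in_def)
qed

lemma finite_has_maximizer:
  fixes f :: "'b \<Rightarrow> nat"
  assumes "finite S" "S \<noteq> {}"
  shows "\<exists>x\<in>S. \<forall>y\<in>S. f y \<le> f x"
proof -
  have "Max (f ` S) \<in> f ` S" using assms by (intro Max_in) auto
  then obtain x where "x \<in> S" "f x = Max (f ` S)" by auto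
  then show ?thesis using assms(1) by (intro bexI[of _ x]) auto
qed

text \<open>All neighbours of the last vertex of a longest path lie on the path. As all degrees are two, one
  of them is the first vertex. The resulting closed list uses up the degrees of its vertices, so
  by connectedness it is the whole cycle.\<close>

lemma simple_cycle_closed_list:
  assumes C: "C \<in> simple_cycles G"
  obtains xs where "closed_list C xs" "verts C = set xs" "edges C = cycle_edges xs"
proof -
  have sg: "simple_graph C" and con: "connected_graph C" and deg: "\<And>v. v \<in> verts C \<Longrightarrow> degree_in C v = 2"
    using C by (auto simp: simple_cycles_def is_subgraph_def)
  have fin: "finite (verts C)" using sg by (simp add: simple_graph_def)
  define N where "N v = {w. adjacent C v w}" for v
  have N: "card (N v) = 2" if "v \<in> verts C" for v
    using degree_in_neighbours[OF sg, of v] deg[OF that] by (simp add: N_def)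
  let ?P = "{xs. xs \<noteq> [] \<and> distinct xs \<and> set xs \<subseteq> verts C \<and> successively (adjacent C) xs}"
  have "?P \<subseteq> {xs. set xs \<subseteq> verts C \<and> distinct xs}" by auto
  then have finP: "finite ?P" using finite_subset_distinct[OF fin] finite_subset by blast
  obtain v0 where "v0 \<in> verts C" using con by (auto simp: connected_graph_def)
  then have "[v0] \<in> ?P" by simp
  then have "?P \<noteq> {}" by blast
  from finite_has_maximizer[OF finP this, of length] obtain xs
    where xs: "xs \<in> ?P" and longest: "\<And>ys. ys \<in> ?P \<Longrightarrow> length ys \<le> length xs" by blast
  let ?x = "last xs"
  have xV: "?x \<in> verts C" using xs by auto
  have Nx: "N ?x \<subseteq> set xs - {?x}"
  proof
    fix w assume "w \<in> N ?x"
    then have w: "adjacent C ?x w" "w \<in> verts C" "w \<noteq> ?x"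
      using adjacent_verts[OF sg] adjacent_irrefl[OF sg] by (auto simp: N_def)
    have "w \<in> set xs"
    proof (rule ccontr)
      assume "w \<notin> set xs"
      then have "xs @ [w] \<in> ?P" using xs w by (auto simp: successively_append_iff)
      from longest[OF this] show False by simp
    qed
    then show "w \<in> set xs - {?x}" using w by simp
  qed
  have "card (N ?x) \<le> card (set xs - {?x})" using Nx by (intro card_mono) auto
  then have len: "length xs \<ge> 3" using N[OF xV] xs distinct_card[of xs] by auto
  define us where "us = butlast xs"
  have us: "xs = us @ [?x]" using xs by (simp add: us_def)
  have "us \<noteq> []"
  proof
    assume "us = []"
    then have "length xs = length [?x]" using us by (metis append_Nil)
    then show False using len by simp
  qed
  note us = us this
  let ?p = "last us"
  have "\<exists>w. w \<in> N ?x \<and> w \<noteq> ?p"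
  proof (rule ccontr)
    assume "\<not> ?thesis"
    then have "N ?x \<subseteq> {?p}" by auto
    then have "card (N ?x) \<le> 1" using card_mono[of "{?p}" "N ?x"] by simp
    then show False using N[OF xV] by simp
  qed
  then obtain w where w: "w \<in> N ?x" "w \<noteq> ?p" by blast
  have "w \<in> set us"
    using Nx w(1) us(1)
    by (metis DiffE UnE set_append empty_set insertI1 list.simps(15) subsetD singletonD)
  then obtain P Q where PQ: "us = P @ w # Q" by (metis split_list)
  have Q: "Q \<noteq> []" using w(2) PQ by auto
  have xs_eq: "xs = P @ w # Q @ [?x]" using us(1) PQ by simp
  have dxs: "distinct (P @ w # Q @ [?x])" using xs xs_eq by simp
  have succ: "successively (adjacent C) (P @ w # Q @ [?x])" using xs xs_eq by simp
  have P: "P = []"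
  proof (rule ccontr)
    assume "P \<noteq> []"
    then have "adjacent C w (last P)" "adjacent C w (hd Q)" "adjacent C w ?x"
      using succ Q w(1) adjacent_sym[of C _ w] unfolding N_def
      by (auto simp: successively_append_iff successively_Cons)
    then have "{last P, hd Q, ?x} \<subseteq> N w" by (auto simp: N_def)
    moreover have "last P \<in> set P" "hd Q \<in> set Q" using \<open>P \<noteq> []\<close> Q by auto
    then have "card {last P, hd Q, ?x} = 3" using dxs by (auto simp: card_insert_if)
    moreover have "w \<in> verts C"
      using xs xs_eq by (metis (no_types, lifting) in_set_conv_decomp mem_Collect_eq subsetD)
    moreover have "finite (N w)" using N[OF \<open>w \<in> verts C\<close>] card.infinite by fastforce
    ultimately show False using N[of w] card_mono[of "N w" "{last P, hd Q, ?x}"] by simp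
  qed
  have "hd xs = w" using xs_eq P by (metis append_Nil list.sel(1))
  then have closed: "closed_list C xs" using xs len w(1) by (simp add: closed_list_def N_def)
  have edges_at: "{e \<in> edges C. v \<in> e} = {e \<in> cycle_edges xs. v \<in> e}" if v: "v \<in> set xs" for v
  proof (rule card_subset_eq[symmetric])
    show "finite {e \<in> edges C. v \<in> e}" using simple_graph_finite_edges[OF sg] by simp
    show "{e \<in> cycle_edges xs. v \<in> e} \<subseteq> {e \<in> edges C. v \<in> e}" using closed_list_edges[OF closed] by auto
    have "v \<in> verts C" using xs v by auto
    then show "card {e \<in> cycle_edges xs. v \<in> e} = card {e \<in> edges C. v \<in> e}"
      using deg cycle_edges_at_vertex[of xs v] v closed by (simp add: degree_in_def closed_list_def)
  qed
  have ne: "xs \<noteq> []" using xs by simp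
  have "verts C \<subseteq> set xs"
  proof (rule ccontr)
    assume "\<not> verts C \<subseteq> set xs"
    then obtain z where z: "z \<in> verts C" "z \<notin> set xs" by auto
    have "(?x, z) \<in> {(x, y). {x, y} \<in> edges C}\<^sup>*"
      using con xV z by (simp add: connected_graph_def)
    then obtain a b where "{a, b} \<in> edges C" "a \<in> set xs" "b \<notin> set xs"
      using rtrancl_leaves[of ?x z "{(x, y). {x, y} \<in> edges C}" "set xs"] z(2) ne by auto
    then have "{a, b} \<in> cycle_edges xs" using edges_at[of a] by blast
    then show False using cycle_edges_subset[OF ne] \<open>b \<notin> set xs\<close> by blast
  qed
  then have V: "verts C = set xs" using xs by auto
  have "edges C \<subseteq> cycle_edges xs"
  proof
    fix e assume e: "e \<in> edges C"
    then obtain a b where "e = {a, b}" "a \<in> verts C" using simple_graph_edge[OF sg] by blast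
    then show "e \<in> cycle_edges xs" using edges_at[of a] e V by blast
  qed
  then have "edges C = cycle_edges xs" using closed_list_edges[OF closed] by auto
  then show ?thesis using that[OF closed V] by simp
qed

lemma closed_list_subgraph: "is_subgraph C G \<Longrightarrow> closed_list C xs \<Longrightarrow> closed_list G xs"
  unfolding closed_list_def is_subgraph_def
  by (auto simp: adjacent_def elim!: successively_mono)

lemma is_subgraph_refl: "simple_graph G \<Longrightarrow> is_subgraph G G"
  by (simp add: is_subgraph_def)

lemma is_subgraph_trans: "is_subgraph A B \<Longrightarrow> is_subgraph B C \<Longrightarrow> is_subgraph A C"
  by (auto simp: is_subgraph_def)

lemma simple_cycle_two_connected:
  assumes C: "C \<in> simple_cycles G"
  shows "two_connected C" "card (verts C) \<ge> 3"
proof -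
  obtain xs where xs: "closed_list C xs" "verts C = set xs" "edges C = cycle_edges xs"
    using simple_cycle_closed_list[OF C] by blast
  then show card: "card (verts C) \<ge> 3" by (simp add: closed_list_def distinct_card)
  have "\<not> articulation_point C v" for v
  proof
    assume art: "articulation_point C v"
    then have "v \<in> set xs" using xs(2) by (simp add: articulation_point_def)
    then obtain P Q where PQ: "xs = P @ v # Q" by (metis split_list)
    have cl: "closed_list C (v # Q @ P)"
      using xs(1) closed_list_rotate[of C P "v # Q"] by (simp add: PQ)
    let ?T = "Q @ P"
    let ?R = "remove_vertex C v"
    have T: "?T \<noteq> []" "v \<notin> set ?T" using cl by (auto simp: closed_list_def)
    have VR: "verts ?R = set ?T"
      using xs(1) unfolding remove_vertex_def xs(2) PQ closed_list_def by auto
    have "successively (adjacent C) ?T" using cl T(1) by (auto simp: closed_list_def successively_Cons)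
    then have "\<forall>e\<in>path_edges ?T. e \<in> edges C"
      using successively_path_edges[of "\<lambda>e. e \<in> edges C" ?T] by (simp add: adjacent_def[abs_def])
    moreover have "\<forall>e\<in>path_edges ?T. v \<notin> e" using path_edges_subset T(2) by blast
    ultimately have "\<forall>e\<in>path_edges ?T. e \<in> edges ?R" by (simp add: remove_vertex_def)
    then have "successively (adjacent ?R) ?T"
      using successively_path_edges[of "\<lambda>e. e \<in> edges ?R" ?T] by (simp add: adjacent_def[abs_def])
    then have "connected_graph ?R"
      using successively_connected[of ?R ?T] T(1) unfolding connected_graph_def VR by blast
    then show False using art by (simp add: articulation_point_def)
  qed
  then show "two_connected C" using C card by (auto simp: two_connected_def simple_cycles_def)
qed

definition graph_union :: "'a graph \<Rightarrow> 'a graph \<Rightarrow> 'a graph" where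
  "graph_union A B = (verts A \<union> verts B, edges A \<union> edges B)"

lemma connected_graph_union:
  assumes A: "connected_graph A" and B: "connected_graph B" and z: "z \<in> verts A" "z \<in> verts B"
  shows "connected_graph (graph_union A B)"
proof -
  let ?r = "\<lambda>G. {(x, y). {x, y} \<in> edges G}"
  let ?U = "graph_union A B"
  have "?r A \<subseteq> ?r ?U" "?r B \<subseteq> ?r ?U" by (auto simp: graph_union_def)
  then have mono: "(?r A)\<^sup>* \<subseteq> (?r ?U)\<^sup>*" "(?r B)\<^sup>* \<subseteq> (?r ?U)\<^sup>*" by (simp_all only: rtrancl_mono)
  have "(x, z) \<in> (?r ?U)\<^sup>* \<and> (z, x) \<in> (?r ?U)\<^sup>*" if "x \<in> verts ?U" for x
  proof -
    from that consider "x \<in> verts A" | "x \<in> verts B" by (auto simp: graph_union_def)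
    then show ?thesis
    proof cases
      case 1
      then have "(x, z) \<in> (?r A)\<^sup>*" "(z, x) \<in> (?r A)\<^sup>*" using A z by (simp_all add: connected_graph_def)
      then show ?thesis using mono(1) by blast
    next
      case 2
      then have "(x, z) \<in> (?r B)\<^sup>*" "(z, x) \<in> (?r B)\<^sup>*" using B z by (simp_all add: connected_graph_def)
      then show ?thesis using mono(2) by blast
    qed
  qed
  then show ?thesis using z unfolding connected_graph_def
    by (auto simp: graph_union_def intro: rtrancl_trans)
qed

lemma remove_vertex_other:
  assumes "simple_graph A" "v \<notin> verts A" shows "remove_vertex A v = A"
proof -
  have "\<forall>e\<in>edges A. v \<notin> e" using assms by (auto simp: simple_graph_def)
  then show ?thesis using assms(2) by (cases A) (auto simp: remove_vertex_def)
qed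

text \<open>After the removal of a vertex the two graphs are still connected, and one of the two common
  vertices is left to connect them with each other.\<close>

lemma two_connected_union:
  assumes A: "two_connected A" "simple_graph A" and B: "two_connected B" "simple_graph B"
    and z: "z \<in> verts A" "z \<in> verts B" and w: "w \<in> verts A" "w \<in> verts B" "z \<noteq> w"
  shows "two_connected (graph_union A B)"
proof -
  have con: "connected_graph (graph_union A B)"
    using A B connected_graph_union[OF _ _ z] by (auto simp: two_connected_def)
  have fin: "finite (verts A \<union> verts B)" using A B by (simp add: simple_graph_def)
  have "card (verts A) \<le> card (verts (graph_union A B))"
    using fin by (intro card_mono) (auto simp: graph_union_def)
  then have card: "card (verts (graph_union A B)) \<ge> 2" using A by (simp add: two_connected_def)
  have rem: "connected_graph (remove_vertex G v)" if "two_connected G" "simple_graph G" for G :: "'a graph" and v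
  proof (cases "v \<in> verts G")
    case True
    then show ?thesis using that by (auto simp: two_connected_def articulation_point_def)
  next
    case False
    then show ?thesis using that remove_vertex_other by (metis two_connected_def)
  qed
  have "connected_graph (remove_vertex (graph_union A B) v)" for v
  proof -
    obtain y where y: "y \<in> verts A" "y \<in> verts B" "y \<noteq> v" using z w by metis
    have "remove_vertex (graph_union A B) v = graph_union (remove_vertex A v) (remove_vertex B v)"
      by (auto simp: remove_vertex_def graph_union_def)
    then show ?thesis
      using connected_graph_union[OF rem[OF A] rem[OF B], of y v v] y by (simp add: remove_vertex_def)
  qed
  then show ?thesis using con card by (auto simp: two_connected_def articulation_point_def)
qed

lemma finite_subgraphs: assumes "simple_graph G" shows "finite {H. is_subgraph H G}"
proof (rule finite_subset)
  show "{H. is_subgraph H G} \<subseteq> Pow (verts G) \<times> Pow (edges G)"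
    by (auto simp: is_subgraph_def)
  show "finite (Pow (verts G) \<times> Pow (edges G))"
    using assms simple_graph_finite_edges[OF assms] by (simp add: simple_graph_def)
qed

lemma finite_blocks: "simple_graph G \<Longrightarrow> finite (blocks G)"
  by (rule finite_subset[OF _ finite_subgraphs]) (auto simp: blocks_def)

lemma two_connected_in_block:
  assumes G: "simple_graph G" and A: "is_subgraph A G" "two_connected A"
  obtains H where "H \<in> blocks G" "is_subgraph A H"
proof -
  let ?S = "{H. is_subgraph H G \<and> two_connected H \<and> is_subgraph A H}"
  let ?m = "\<lambda>H. card (verts H) + card (edges H)"
  have "?S \<subseteq> {H. is_subgraph H G}" by auto
  then have finS: "finite ?S" using finite_subgraphs[OF G] finite_subset by blast
  have "A \<in> ?S" using A is_subgraph_refl by (auto simp: is_subgraph_def)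
  then have "?S \<noteq> {}" by blast
  from finite_has_maximizer[OF finS this, of ?m] obtain H
    where H: "H \<in> ?S" and max: "\<And>H'. H' \<in> ?S \<Longrightarrow> ?m H' \<le> ?m H" by blast
  have "H' = H" if H': "is_subgraph H' G" "two_connected H'" "is_subgraph H H'" for H'
  proof -
    have "?m H' \<le> ?m H" using max H H' is_subgraph_trans[of A H H'] by blast
    moreover have sub: "verts H \<subseteq> verts H'" "edges H \<subseteq> edges H'"
      using H' by (auto simp: is_subgraph_def)
    moreover have "simple_graph H'" using H'(1) by (simp add: is_subgraph_def)
    then have fin: "finite (verts H')" "finite (edges H')"
      using simple_graph_finite_edges[of H'] by (auto simp: simple_graph_def)
    moreover have "card (verts H) \<le> card (verts H')" "card (edges H) \<le> card (edges H')"
      using sub fin by (auto intro: card_mono)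
    ultimately have "card (verts H) = card (verts H')" "card (edges H) = card (edges H')" by linarith+
    then have "verts H = verts H'" "edges H = edges H'" using sub fin card_subset_eq by metis+
    then show ?thesis by (simp add: prod_eqI)
  qed
  then have "H \<in> blocks G" using H by (auto simp: blocks_def)
  then show ?thesis using that H by blast
qed

lemma block_simple: "H \<in> blocks G \<Longrightarrow> simple_graph H"
  by (simp add: blocks_def is_subgraph_def)

text \<open>The union of a block with a simple cycle through one of its edges is two-connected, so by
  maximality it is the block.\<close>

lemma simple_cycle_in_block:
  assumes G: "simple_graph G" and H: "H \<in> blocks G" and C: "C \<in> simple_cycles G"
    and e: "e \<in> edges C" "e \<in> edges H"
  shows "C \<in> simple_cycles H"
proof -
  have sub: "is_subgraph C G" "is_subgraph H G" "two_connected H"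
    using C H by (auto simp: simple_cycles_def blocks_def)
  then have sg: "simple_graph C" "simple_graph H" by (auto simp: is_subgraph_def)
  obtain x y where xy: "e = {x, y}" "x \<noteq> y" "x \<in> verts C" "y \<in> verts C"
    using simple_graph_edge[OF sg(1) e(1)] by blast
  have xyH: "x \<in> verts H" "y \<in> verts H" using e(2) xy(1) sg(2) by (auto simp: simple_graph_def)
  let ?U = "graph_union C H"
  have U: "two_connected ?U"
    using two_connected_union[OF simple_cycle_two_connected(1)[OF C] sg(1) sub(3) sg(2) xy(3) xyH(1) xy(4) xyH(2) xy(2)] .
  have "simple_graph ?U" using sg by (auto simp: simple_graph_def graph_union_def)
  then have "is_subgraph ?U G" "is_subgraph H ?U"
    using sub by (auto simp: is_subgraph_def graph_union_def)
  then have "?U = H" using H U unfolding blocks_def by blast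
  then have "verts ?U = verts H" "edges ?U = edges H" by simp_all
  then have "verts C \<subseteq> verts H" "edges C \<subseteq> edges H" by (auto simp: graph_union_def)
  then show ?thesis using C sg by (auto simp: simple_cycles_def is_subgraph_def)
qed

lemma simple_cycle_has_block:
  assumes G: "simple_graph G" and C: "C \<in> simple_cycles G"
  obtains H where "H \<in> blocks G" "C \<in> simple_cycles H" "\<not> trivial_block H"
proof -
  obtain H where H: "H \<in> blocks G" "is_subgraph C H"
    using two_connected_in_block[OF G _ simple_cycle_two_connected(1)[OF C]] C
    by (auto simp: simple_cycles_def)
  have "finite (verts H)" using block_simple[OF H(1)] by (simp add: simple_graph_def)
  then have "card (verts C) \<le> card (verts H)"
    using H(2) by (intro card_mono) (auto simp: is_subgraph_def)
  then have "\<not> trivial_block H"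
    using simple_cycle_two_connected(2)[OF C] by (simp add: trivial_block_def)
  moreover have "C \<in> simple_cycles H" using C H(2) by (auto simp: simple_cycles_def)
  ultimately show ?thesis using that H(1) by blast
qed

section \<open>The span of the positive simple cycles\<close>

definition bit_sign :: "bit \<Rightarrow> real" where
  "bit_sign b = (if b = 0 then 1 else -1)"

lemma bit_sign_sq: "bit_sign b * bit_sign b = 1"
  by (simp add: bit_sign_def)

lemma bit_sign_add: "bit_sign (a + b) = bit_sign a * bit_sign b"
  by (cases a; cases b) (simp_all add: bit_sign_def)

lemma bit_sign_sum: "finite F \<Longrightarrow> bit_sign (\<Sum>e\<in>F. f e) = (\<Prod>e\<in>F. bit_sign (f e))"
proof (induction F rule: finite_induct)
  case empty
  then show ?case by (simp add: bit_sign_def)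
next
  case (insert x F)
  then show ?case
    by (simp only: sum.insert[OF insert.hyps(1,2)] prod.insert[OF insert.hyps(1,2)] bit_sign_add)
qed

definition edge_vector :: "'a set \<Rightarrow> 'a set \<Rightarrow> bit" where
  "edge_vector e = (\<lambda>e'. if e' = e then 1 else 0)"

lemma incidence_vector_sum:
  assumes "finite (edges C)"
  shows "incidence_vector C = (\<Sum>e\<in>edges C. edge_vector e)"
proof
  fix e
  have "(\<Sum>e'\<in>E. edge_vector e') e = (\<Sum>e'\<in>E. edge_vector e' e)" if "finite E" for E :: "'a set set"
    using that
  proof (induction E rule: finite_induct)
    case empty
    show ?case by (simp only: sum.empty zero_fun_apply)
  next
    case (insert x F)
    then show ?case by (simp only: sum.insert[OF insert.hyps(1,2)] plus_fun_apply)
  qed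
  then have "(\<Sum>e'\<in>edges C. edge_vector e') e = (\<Sum>e'\<in>edges C. edge_vector e' e)" using assms .
  also have "\<dots> = incidence_vector C e"
    by (simp only: edge_vector_def incidence_vector_def sum.delta'[OF assms])
  finally show "incidence_vector C e = (\<Sum>e'\<in>edges C. edge_vector e') e" by simp
qed

text \<open>A basis of the span remains independent when \<open>x\<close> is added, so the values on it can be
  prescribed.\<close>

lemma separating_functional:
  fixes x :: "'e \<Rightarrow> bit"
  assumes "x \<notin> gf2.span S"
  obtains \<phi> :: "('e \<Rightarrow> bit) \<Rightarrow> bit" where "\<And>a b. \<phi> (a + b) = \<phi> a + \<phi> b" "\<And>v. v \<in> S \<Longrightarrow> \<phi> v = 0" "\<phi> x = 1"
proof -
  interpret target: Vector_Spaces.vector_space "(*) :: bit \<Rightarrow> bit \<Rightarrow> bit"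
    by unfold_locales (auto simp: algebra_simps)
  interpret pair: Vector_Spaces.vector_space_pair "\<lambda>(c::bit) (x::'e \<Rightarrow> bit) e. c * x e" "(*) :: bit \<Rightarrow> bit \<Rightarrow> bit"
    by unfold_locales
  obtain B where B: "B \<subseteq> S" "gf2.independent B" "S \<subseteq> gf2.span B"
    using gf2.maximal_independent_subset[of S] by blast
  have spanB: "gf2.span B = gf2.span S"
    using B by (metis gf2.span_mono gf2.span_span subset_antisym)
  then have "x \<notin> gf2.span B" using assms by metis
  then have ind: "gf2.independent (insert x B)" using B(2) by (rule gf2.independent_insertI)
  obtain \<phi> where lin: "Vector_Spaces.linear (\<lambda>(c::bit) (x::'e \<Rightarrow> bit) e. c * x e) (*) \<phi>"
    and \<phi>: "\<forall>y\<in>insert x B. \<phi> y = (if y = x then 1 else 0)"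
    using pair.linear_independent_extend[OF ind, of "\<lambda>y. if y = x then 1 else 0"] by blast
  interpret \<phi>: Vector_Spaces.linear "\<lambda>(c::bit) (x::'e \<Rightarrow> bit) e. c * x e" "(*)" \<phi> by fact
  have "x \<notin> B" using assms B(1) gf2.span_base by blast
  have "\<phi> v = 0" if "v \<in> S" for v
  proof -
    have "v \<in> gf2.span B" using that B(3) by blast
    then show ?thesis
    proof (induction rule: gf2.span_induct_alt)
      case base
      show ?case using \<phi>.zero by (simp add: zero_fun_def)
    next
      case (step c b y)
      have "\<phi> b = 0" using \<phi> step(1) \<open>x \<notin> B\<close> by auto
      then show ?case using step by (simp only: \<phi>.add \<phi>.scale mult_zero_right add_0)
    qed
  qed
  then show ?thesis using that[of \<phi>] \<phi>.add \<phi> by simp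
qed

text \<open>The values of a separating functional on the single edges, written multiplicatively.\<close>

lemma separating_sign:
  fixes X :: "'a graph set"
  assumes F: "finite (edges F)" "incidence_vector F \<notin> gf2.span (incidence_vector ` X)"
    and X: "\<And>C. C \<in> X \<Longrightarrow> finite (edges C)"
  obtains sg :: "'a set \<Rightarrow> real" where "\<And>e. sg e * sg e = 1"
    "\<And>C. C \<in> X \<Longrightarrow> (\<Prod>e\<in>edges C. sg e) = 1" "(\<Prod>e\<in>edges F. sg e) = -1"
proof -
  obtain \<phi> :: "('a set \<Rightarrow> bit) \<Rightarrow> bit" where \<phi>: "\<And>a b. \<phi> (a + b) = \<phi> a + \<phi> b"
    "\<And>v. v \<in> incidence_vector ` X \<Longrightarrow> \<phi> v = 0" "\<phi> (incidence_vector F) = 1"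
    using separating_functional[OF F(2)] by blast
  have "\<phi> 0 = \<phi> 0 + \<phi> 0" using \<phi>(1)[of 0 0] by simp
  then have \<phi>0: "\<phi> 0 = 0" by simp
  have \<phi>_sum: "\<phi> (\<Sum>e\<in>E. edge_vector e) = (\<Sum>e\<in>E. \<phi> (edge_vector e))" if "finite E" for E :: "'a set set"
    using that
  proof (induction E rule: finite_induct)
    case empty
    show ?case by (simp only: sum.empty \<phi>0)
  next
    case (insert x F)
    then show ?case by (simp only: sum.insert[OF insert.hyps(1,2)] \<phi>(1))
  qed
  define sg where "sg e = bit_sign (\<phi> (edge_vector e))" for e
  have prod: "(\<Prod>e\<in>edges C. sg e) = bit_sign (\<phi> (incidence_vector C))" if "finite (edges C)" for C :: "'a graph"
    using that by (simp add: sg_def incidence_vector_sum \<phi>_sum bit_sign_sum)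
  show ?thesis
  proof (rule that[of sg])
    show "sg e * sg e = 1" for e unfolding sg_def by (rule bit_sign_sq)
    show "(\<Prod>e\<in>edges C. sg e) = 1" if "C \<in> X" for C
      using prod[OF X[OF that]] \<phi>(2)[of "incidence_vector C"] that by (simp add: bit_sign_def)
    show "(\<Prod>e\<in>edges F. sg e) = -1" using prod[OF F(1)] \<phi>(3) by (simp add: bit_sign_def)
  qed
qed

text \<open>The product over the support of a vector turns sums into products, so it is \<open>1\<close> on the whole
  span.\<close>

lemma span_preserves_sign:
  fixes X :: "'a graph set"
  assumes E: "finite E" and sg: "\<And>e. sg e * sg e = (1::real)"
    and X: "\<And>D. D \<in> X \<Longrightarrow> edges D \<subseteq> E \<and> (\<Prod>e\<in>edges D. sg e) = 1"
    and C: "incidence_vector C \<in> gf2.span (incidence_vector ` X)" "edges C \<subseteq> E"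
  shows "(\<Prod>e\<in>edges C. sg e) = 1"
proof -
  define h where "h x = (\<Prod>e\<in>E. if x e = 0 then 1 else sg e)" for x :: "'a set \<Rightarrow> bit"
  have h_vec: "h (incidence_vector D) = (\<Prod>e\<in>edges D. sg e)" if "edges D \<subseteq> E" for D :: "'a graph"
  proof -
    have "h (incidence_vector D) = (\<Prod>e\<in>E. if e \<in> edges D then sg e else 1)"
      unfolding h_def by (rule prod.cong) (auto simp: incidence_vector_def)
    also have "\<dots> = (\<Prod>e\<in>E \<inter> edges D. sg e)" by (rule prod.inter_restrict[OF E, symmetric])
    finally show ?thesis using that by (simp add: Int_absorb1)
  qed
  have h_add: "h (x + y) = h x * h y" for x y
  proof -
    have "(if (x + y) e = 0 then 1 else sg e) = (if x e = 0 then 1 else sg e) * (if y e = 0 then 1 else sg e)" for e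
      using sg[of e] by (cases "x e"; cases "y e") (simp_all add: plus_fun_def)
    then show ?thesis by (simp add: h_def prod.distrib)
  qed
  have "h v = 1" if "v \<in> gf2.span (incidence_vector ` X)" for v
    using that
  proof (induction rule: gf2.span_induct_alt)
    case base
    then show ?case by (simp add: h_def zero_fun_def)
  next
    case (step c x y)
    then have hx: "h x = 1" using X h_vec by auto
    show ?case
    proof (cases c)
      case zero
      then have "(\<lambda>e. c * x e) = 0" by (simp add: fun_eq_iff)
      then show ?thesis using step.IH by (simp only: add_0)
    next
      case one
      then have "(\<lambda>e. c * x e) = x" by (simp only: mult_1_left)
      then show ?thesis using step.IH hx by (simp only: h_add mult_1_left)
    qed
  qed
  then show ?thesis using C h_vec by metis
qed

text \<open>A version of the charge with values \<open>1\<close> and \<open>-1\<close> on all sets; it agrees with the charge on the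
  edges.\<close>

definition edge_sign :: "('a set \<Rightarrow> real) \<Rightarrow> 'a set \<Rightarrow> real" where
  "edge_sign \<epsilon> e = (if \<epsilon> e < 0 then -1 else 1)"

lemma edge_sign_sq: "edge_sign \<epsilon> e * edge_sign \<epsilon> e = 1"
  by (simp add: edge_sign_def)

definition charged :: "('a set \<Rightarrow> real) \<Rightarrow> 'a graph \<Rightarrow> bool" where
  "charged \<epsilon> G \<longleftrightarrow> (\<forall>e\<in>edges G. \<epsilon> e = 1 \<or> \<epsilon> e = -1)"

lemma charge_eq_edge_sign: "charged \<epsilon> G \<Longrightarrow> edges C \<subseteq> edges G \<Longrightarrow> charge \<epsilon> C = (\<Prod>e\<in>edges C. edge_sign \<epsilon> e)"
  unfolding charge_def by (rule prod.cong) (force simp: charged_def edge_sign_def)+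

lemma signed_graph_adjacent:
  assumes "simple_graph G" "\<And>e. sg e * sg e = 1"
  shows "signed_graph (adjacent G) (edge_sign \<epsilon>) sg"
  by unfold_locales (use assms adjacent_sym[of G] adjacent_irrefl[of G] edge_sign_sq in auto)

lemma circuit_closed_list:
  assumes "simple_graph G" "length xs \<ge> 3"
  shows "signed_graph.circuit (adjacent G) xs = closed_list G xs"
proof -
  interpret signed_graph "adjacent G" "\<lambda>_. 1" "\<lambda>_. 1"
    by unfold_locales (use assms(1) adjacent_sym[of G] adjacent_irrefl[of G] in auto)
  show ?thesis using assms(2) by (auto simp: circuit_def closed_list_def)
qed

text \<open>Sums are symmetric differences of edge sets. Common edges contribute an even number to every
  degree and the square of their charge.\<close>

lemma positive_cycle_space_subspace:
  assumes G: "simple_graph G" and ch: "charged \<epsilon> G"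
  shows "gf2.subspace (positive_cycle_space \<epsilon> G)"
proof (rule gf2.subspaceI)
  have "(({}, {}) :: 'a graph) \<in> cycles G" by (simp add: cycles_def is_subgraph_def simple_graph_def)
  moreover have "charge \<epsilon> ({}, {}) = 1" by (simp add: charge_def)
  moreover have "incidence_vector (({}, {}) :: 'a graph) = 0"
    by (auto simp: incidence_vector_def zero_fun_def)
  ultimately show zero: "0 \<in> positive_cycle_space \<epsilon> G" unfolding positive_cycle_space_def by force
  fix x y assume "x \<in> positive_cycle_space \<epsilon> G" "y \<in> positive_cycle_space \<epsilon> G"
  then obtain C D where C: "x = incidence_vector C" "C \<in> cycles G" "charge \<epsilon> C = 1"
    and D: "y = incidence_vector D" "D \<in> cycles G" "charge \<epsilon> D = 1"
      unfolding positive_cycle_space_def by blast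
  have sub: "edges C \<subseteq> edges G" "edges D \<subseteq> edges G" "simple_graph C" "simple_graph D"
    using C D by (auto simp: cycles_def is_subgraph_def)
  have fin: "finite (edges C)" "finite (edges D)"
    using simple_graph_finite_edges[OF sub(3)] simple_graph_finite_edges[OF sub(4)] .
  have even: "even (card {e \<in> edges C. v \<in> e})" if "C \<in> cycles G" "simple_graph C" for C :: "'a graph" and v
  proof (cases "v \<in> verts C")
    case True
    then show ?thesis using that by (simp add: cycles_def degree_in_def)
  next
    case False
    then have none: "{e \<in> edges C. v \<in> e} = {}" using that(2) by (auto simp: simple_graph_def)
    show ?thesis unfolding none by simp
  qed
  let ?S = "(verts G, (edges C - edges D) \<union> (edges D - edges C))"
  have "even (card {e \<in> edges ?S. v \<in> e})" for v
  proof -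
    let ?A = "{e \<in> edges C. v \<in> e}" and ?B = "{e \<in> edges D. v \<in> e}"
    have eq: "{e \<in> edges ?S. v \<in> e} = (?A - ?B) \<union> (?B - ?A)" by auto
    have "card ((?A - ?B) \<union> (?B - ?A)) + 2 * card (?A \<inter> ?B) = card ?A + card ?B"
    proof -
      have "card ((?A - ?B) \<union> (?B - ?A)) = card (?A - ?B) + card (?B - ?A)"
        using fin by (intro card_Un_disjoint) auto
      moreover have "card ?A = card (?A \<inter> ?B) + card (?A - ?B)"
        using fin by (intro card_Int_Diff) simp
      moreover have "card ?B = card (?B \<inter> ?A) + card (?B - ?A)"
        using fin by (intro card_Int_Diff) simp
      ultimately show ?thesis by (simp add: Int_commute)
    qed
    moreover have "even (card ?A + card ?B)"
      using even[OF C(2) sub(3), of v] even[OF D(2) sub(4), of v] by (rule dvd_add)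
    moreover have "even a" if "a + 2 * b = c" "even c" for a b c :: nat using that by presburger
    ultimately show ?thesis unfolding eq by blast
  qed
  then have S: "?S \<in> cycles G"
    using G sub by (auto simp: cycles_def is_subgraph_def simple_graph_def degree_in_def)
  have vec: "x + y = incidence_vector ?S"
    unfolding C(1) D(1) by (auto simp: incidence_vector_def plus_fun_def)
  have "(\<Prod>e\<in>edges ?S. edge_sign \<epsilon> e) = (\<Prod>e\<in>edges C. edge_sign \<epsilon> e) * (\<Prod>e\<in>edges D. edge_sign \<epsilon> e)"
  proof -
    let ?P = "\<lambda>A. \<Prod>e\<in>A. edge_sign \<epsilon> e"
    have "?P (edges ?S) = ?P (edges C - edges D) * ?P (edges D - edges C)"
      using fin by (simp, intro prod.union_disjoint) auto
    moreover have "?P (edges C) = ?P (edges C - edges D) * ?P (edges C \<inter> edges D)"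
      using fin by (subst prod.union_disjoint[symmetric]) (auto intro!: prod.cong)
    moreover have "?P (edges D) = ?P (edges D - edges C) * ?P (edges C \<inter> edges D)"
      using fin by (subst prod.union_disjoint[symmetric]) (auto intro!: prod.cong)
    moreover have "?P (edges C \<inter> edges D) * ?P (edges C \<inter> edges D) = 1"
      by (simp add: prod.distrib[symmetric] edge_sign_sq)
    ultimately show ?thesis by (metis (no_types, lifting) mult.assoc mult.commute mult.right_neutral)
  qed
  moreover have "edges ?S \<subseteq> edges G" using sub by auto
  ultimately have "charge \<epsilon> ?S = 1"
    using charge_eq_edge_sign[OF ch, of ?S] charge_eq_edge_sign[OF ch sub(1)] charge_eq_edge_sign[OF ch sub(2)] C D
    by simp
  then show "x + y \<in> positive_cycle_space \<epsilon> G" unfolding vec positive_cycle_space_def using S by blast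
next
  fix c x assume x: "x \<in> positive_cycle_space \<epsilon> G"
  have "(\<lambda>e. 0) \<in> positive_cycle_space \<epsilon> G"
  proof -
    have "(({}, {}) :: 'a graph) \<in> cycles G" by (simp add: cycles_def is_subgraph_def simple_graph_def)
    moreover have "charge \<epsilon> ({}, {}) = 1" by (simp add: charge_def)
    moreover have "incidence_vector (({}, {}) :: 'a graph) = (\<lambda>e. 0)"
      by (auto simp: incidence_vector_def)
    ultimately show ?thesis unfolding positive_cycle_space_def by force
  qed
  then show "(\<lambda>e. c * x e) \<in> positive_cycle_space \<epsilon> G"
    using x by (cases c) (simp_all only: mult_zero_left mult_1_left)
qed

lemma simple_cycle_is_cycle: "C \<in> simple_cycles G \<Longrightarrow> C \<in> cycles G"
  by (auto simp: simple_cycles_def cycles_def)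

lemma short_subset_space:
  "incidence_vector ` short_positive_simple_cycles \<epsilon> G L \<subseteq> positive_cycle_space \<epsilon> G"
proof
  fix x assume "x \<in> incidence_vector ` short_positive_simple_cycles \<epsilon> G L"
  then obtain C where "x = incidence_vector C" "C \<in> simple_cycles G" "charge \<epsilon> C = 1"
    unfolding short_positive_simple_cycles_def by blast
  then show "x \<in> positive_cycle_space \<epsilon> G"
    using simple_cycle_is_cycle[of C G] unfolding positive_cycle_space_def by blast
qed

text \<open>A positive cycle outside the span would be separated from it by a sign pattern that has no bad
  circuit but is \<open>-1\<close> on this positive even edge set.\<close>

lemma positive_simple_cycles_span:
  assumes H: "two_connected H" "simple_graph H" "\<not> trivial_block H" and ch: "charged \<epsilon> H"
  shows "gf2.span (incidence_vector ` short_positive_simple_cycles \<epsilon> H (card (edges H))) = positive_cycle_space \<epsilon> H"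
proof (rule antisym)
  let ?X = "short_positive_simple_cycles \<epsilon> H (card (edges H))"
  show "gf2.span (incidence_vector ` ?X) \<subseteq> positive_cycle_space \<epsilon> H"
    by (rule gf2.span_minimal[OF short_subset_space positive_cycle_space_subspace[OF H(2) ch]])
  have finE: "finite (edges H)" by (rule simple_graph_finite_edges[OF H(2)])
  show "positive_cycle_space \<epsilon> H \<subseteq> gf2.span (incidence_vector ` ?X)"
  proof (rule ccontr)
    assume "\<not> ?thesis"
    then obtain F where F: "F \<in> cycles H" "charge \<epsilon> F = 1" "incidence_vector F \<notin> gf2.span (incidence_vector ` ?X)"
      unfolding positive_cycle_space_def by blast
    have subF: "is_subgraph F H" using F(1) by (simp add: cycles_def)
    then have finF: "finite (edges F)" using finE finite_subset by (auto simp: is_subgraph_def)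
    have finX: "finite (edges C)" if "C \<in> ?X" for C
      using that simple_graph_finite_edges[of C]
      by (auto simp: short_positive_simple_cycles_def simple_cycles_def is_subgraph_def)
    obtain sg where sg: "\<And>e. sg e * sg e = (1::real)" "\<And>C. C \<in> ?X \<Longrightarrow> (\<Prod>e\<in>edges C. sg e) = 1"
      "(\<Prod>e\<in>edges F. sg e) = -1"
      using separating_sign[OF finF F(3) finX] by blast
    interpret S: signed_graph "adjacent H" "edge_sign \<epsilon>" sg
      by (rule signed_graph_adjacent[OF H(2) sg(1)])
    have none: "\<not> S.bad xs" for xs
    proof
      assume bad: "S.bad xs"
      then have len: "length xs \<ge> 3" "distinct xs"
        using S.bad_length by (auto simp: S.bad_def S.circuit_def)
      have cl: "closed_list H xs" using bad circuit_closed_list[OF H(2) len(1)] by (simp add: S.bad_def)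
      let ?C = "(set xs, cycle_edges xs)"
      have C: "?C \<in> simple_cycles H" by (rule closed_list_simple_cycle[OF H(2) cl])
      have sub: "edges ?C \<subseteq> edges H" using closed_list_edges[OF cl] by simp
      have "charge \<epsilon> ?C = 1"
        using charge_eq_edge_sign[OF ch sub] prod_cycle_edges[OF len(2,1)] bad by (simp add: S.bad_def)
      moreover have "card (edges ?C) \<le> card (edges H)" using sub finE by (rule card_mono[rotated])
      ultimately have "?C \<in> ?X" using C by (simp add: short_positive_simple_cycles_def)
      then have "(\<Prod>e\<in>cycle_edges xs. sg e) = 1" using sg(2)[of ?C] by simp
      then show False using prod_cycle_edges[OF len(2,1), of sg] bad by (simp add: S.bad_def)
    qed
    have fin: "finite (verts H)" using H(2) by (simp add: simple_graph_def)
    have big: "card (verts H) \<ge> 3" using H(1,3) by (auto simp: two_connected_def trivial_block_def)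
    have subE: "edges F \<subseteq> edges H" using subF by (simp add: is_subgraph_def)
    have "even (card {e \<in> edges F. v \<in> e})" for v
    proof (cases "v \<in> verts F")
      case True
      then show ?thesis using F(1) by (simp add: cycles_def degree_in_def)
    next
      case False
      then have no_edge: "{e \<in> edges F. v \<in> e} = {}"
        using subF by (auto simp: is_subgraph_def simple_graph_def)
      show ?thesis unfolding no_edge by simp
    qed
    moreover have "(\<Prod>e\<in>edges F. edge_sign \<epsilon> e) = 1" using F(2) charge_eq_edge_sign[OF ch subE] by simp
    ultimately have "(\<Prod>e\<in>edges F. sg e) = 1"
    proof (intro S.positive_even_set_sign[OF fin two_connected_ear_property[OF H(1,2)] none _ big])
      show "x \<in> verts H" if "adjacent H x y" for x y using adjacent_verts[OF H(2) that] by simp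
      show "e \<subseteq> verts H \<and> card e = 2" if "e \<in> edges F" for e
        using that subE H(2) by (auto simp: simple_graph_def)
      show "adjacent H x y" if "{x, y} \<in> edges F" for x y using that subE by (auto simp: adjacent_def)
    qed auto
    then show False using sg(3) by simp
  qed
qed

lemma block_sparsity_spans:
  assumes H: "two_connected H" "simple_graph H" "\<not> trivial_block H" and ch: "charged \<epsilon> H"
  shows "gf2.span (incidence_vector ` short_positive_simple_cycles \<epsilon> H (block_sparsity \<epsilon> H)) = positive_cycle_space \<epsilon> H"
proof -
  have "block_sparsity \<epsilon> H = (LEAST L. gf2.span (incidence_vector ` short_positive_simple_cycles \<epsilon> H L) = positive_cycle_space \<epsilon> H)"
    using H(3) by (simp add: block_sparsity_def)
  then show ?thesis
    using LeastI[of "\<lambda>L. gf2.span (incidence_vector ` short_positive_simple_cycles \<epsilon> H L) = positive_cycle_space \<epsilon> H",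
        OF positive_simple_cycles_span[OF assms]] by simp
qed

lemma block_sparsity_witness:
  assumes H: "two_connected H" "simple_graph H" "\<not> trivial_block H" and ch: "charged \<epsilon> H"
    and L: "L = block_sparsity \<epsilon> H" "L > 0"
  obtains C where "C \<in> simple_cycles H" "charge \<epsilon> C = 1" "card (edges C) = L"
    "incidence_vector C \<notin> gf2.span (incidence_vector ` short_positive_simple_cycles \<epsilon> H (L - 1))"
proof -
  let ?V = "\<lambda>L. incidence_vector ` short_positive_simple_cycles \<epsilon> H L"
  have "gf2.span (?V (L - 1)) \<noteq> positive_cycle_space \<epsilon> H"
    using not_less_Least[of "L - 1" "\<lambda>L. gf2.span (?V L) = positive_cycle_space \<epsilon> H"] L H(3)
    by (simp add: block_sparsity_def)
  moreover have span: "gf2.span (?V L) = positive_cycle_space \<epsilon> H"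
    using block_sparsity_spans[OF H ch] L by simp
  moreover have "?V (L - 1) \<subseteq> ?V L" by (auto simp: short_positive_simple_cycles_def)
  ultimately have "\<not> ?V L \<subseteq> gf2.span (?V (L - 1))"
    by (metis gf2.span_mono gf2.span_span subset_antisym)
  then obtain C where C: "C \<in> short_positive_simple_cycles \<epsilon> H L" "incidence_vector C \<notin> gf2.span (?V (L - 1))"
    by blast
  then have "C \<notin> short_positive_simple_cycles \<epsilon> H (L - 1)" using gf2.span_base by blast
  then show ?thesis using that[of C] C by (auto simp: short_positive_simple_cycles_def)
qed

text \<open>A two-connected graph is its own only block, so the sparsity is a maximum over blocks in either
  case of the definition.\<close>

lemma simple_cycle_sparsity_blocks:
  assumes G: "simple_graph G" and ne: "blocks G \<noteq> {}"
  shows "\<exists>H\<in>blocks G. simple_cycle_sparsity \<epsilon> G = block_sparsity \<epsilon> H"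
    and "\<And>H. H \<in> blocks G \<Longrightarrow> block_sparsity \<epsilon> H \<le> simple_cycle_sparsity \<epsilon> G"
proof -
  have sp: "simple_cycle_sparsity \<epsilon> G = Max (block_sparsity \<epsilon> ` blocks G)"
  proof (cases "two_connected G")
    case True
    then have "H = G" if "H \<in> blocks G" for H
      using that is_subgraph_refl[OF G] unfolding blocks_def by blast
    then have "blocks G = {G}" using ne by blast
    then show ?thesis using True by (simp add: simple_cycle_sparsity_def)
  qed (use ne in \<open>simp add: simple_cycle_sparsity_def\<close>)
  have fin: "finite (block_sparsity \<epsilon> ` blocks G)" using finite_blocks[OF G] by simp
  show "\<exists>H\<in>blocks G. simple_cycle_sparsity \<epsilon> G = block_sparsity \<epsilon> H"
    unfolding sp using Max_in[OF fin] ne by blast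
  show "block_sparsity \<epsilon> H \<le> simple_cycle_sparsity \<epsilon> G" if "H \<in> blocks G" for H
    unfolding sp using Max_ge[OF fin] that by blast
qed

section \<open>Recovering a matrix from its short principal minors\<close>

lemma perm_det_cong:
  assumes "\<And>i j. i \<in> S \<Longrightarrow> j \<in> S \<Longrightarrow> v i j = w i j"
  shows "perm_det v S = perm_det w S"
  unfolding perm_det_def
proof (rule sum.cong[OF refl])
  fix p assume "p \<in> {p. p permutes S}"
  then have "p i \<in> S" if "i \<in> S" for i using that permutes_in_image by fastforce
  then have "(\<Prod>i\<in>S. v i (p i)) = (\<Prod>i\<in>S. w i (p i))" using assms by (intro prod.cong) auto
  then show "of_int (sign p) * (\<Prod>i\<in>S. v i (p i)) = of_int (sign p) * (\<Prod>i\<in>S. w i (p i))" by simp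
qed

lemma perm_det_singleton: "perm_det w {i} = w i i"
proof -
  have "rooted_lists {i} i = {[i]}"
  proof (intro equalityI subsetI)
    fix xs assume xs: "xs \<in> rooted_lists {i} i"
    then obtain ys where "xs = i # ys" "distinct xs" "set xs \<subseteq> {i}"
      by (cases xs) (auto simp: rooted_lists_def)
    then show "xs \<in> {[i]}" by (cases ys) auto
  qed (auto simp: rooted_lists_def)
  then show ?thesis using perm_det_expand[of "{i}" i w] by (simp add: cycle_weight_def)
qed

lemma perm_det_doubleton:
  assumes "i \<noteq> j" shows "perm_det w {i, j} = w i i * w j j - w i j * w j i"
proof -
  have L: "rooted_lists {i, j} i = {[i], [i, j]}"
  proof (intro equalityI subsetI)
    fix xs assume xs: "xs \<in> rooted_lists {i, j} i"
    then obtain ys where ys: "xs = i # ys" "distinct (i # ys)" "set ys \<subseteq> {i, j}"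
      by (cases xs) (auto simp: rooted_lists_def)
    then show "xs \<in> {[i], [i, j]}"
    proof (cases ys)
      case (Cons y zs)
      then show ?thesis using ys by (cases zs) auto
    qed simp
  qed (use assms in \<open>auto simp: rooted_lists_def\<close>)
  have "{i, j} - {i} = {j}" using assms by auto
  then show ?thesis
    using perm_det_expand[of "{i, j}" i w] by (simp add: L cycle_weight_def perm_det_singleton)
qed

lemma magnitude_symmetricD: "magnitude_symmetric N K \<Longrightarrow> i < N \<Longrightarrow> j < N \<Longrightarrow> \<bar>K $$ (j, i)\<bar> = \<bar>K $$ (i, j)\<bar>"
  by (simp add: magnitude_symmetric_def)

lemma simple_sparsity_graph: "simple_graph (sparsity_graph N K)"
  by (auto simp: simple_graph_def sparsity_graph_def card_2_iff)

lemma adjacent_sparsity_graph: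
  assumes "magnitude_symmetric N K"
  shows "adjacent (sparsity_graph N K) i j \<longleftrightarrow> i < N \<and> j < N \<and> i \<noteq> j \<and> K $$ (i, j) \<noteq> 0"
proof
  assume "adjacent (sparsity_graph N K) i j"
  then obtain a b where ab: "{i, j} = {a, b}" "a < N" "b < N" "a \<noteq> b" "K $$ (a, b) \<noteq> 0"
    by (auto simp: adjacent_def sparsity_graph_def)
  then have "K $$ (b, a) \<noteq> 0" using magnitude_symmetricD[OF assms ab(2,3)] by auto
  then show "i < N \<and> j < N \<and> i \<noteq> j \<and> K $$ (i, j) \<noteq> 0" using ab by (auto simp: doubleton_eq_iff)
qed (auto simp: adjacent_def sparsity_graph_def)

lemma charged_sparsity_graph:
  assumes "magnitude_symmetric N K"
  shows "charged (sparsity_charge K) (sparsity_graph N K)"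
  unfolding charged_def
proof
  fix e assume "e \<in> edges (sparsity_graph N K)"
  then obtain i j where e: "e = {i, j}" and ij: "i < N" "j < N" "K $$ (i, j) \<noteq> 0"
    by (auto simp: sparsity_graph_def)
  then have "K $$ (j, i) \<noteq> 0" using magnitude_symmetricD[OF assms ij(1,2)] by auto
  then show "sparsity_charge K e = 1 \<or> sparsity_charge K e = -1"
    using ij by (simp add: e sparsity_charge_edge sgn_real_def)
qed

lemma sparsity_generic_weights:
  assumes K: "K \<in> generic_magnitude_symmetric N" and sg: "\<And>e. sg e * sg e = 1"
  shows "generic_weights (adjacent (sparsity_graph N K)) (edge_sign (sparsity_charge K)) sg {..<N}
    (\<lambda>i j. K $$ (i, j))"
proof -
  have ms: "magnitude_symmetric N K" and gen: "generic_entries N K"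
    using K by (auto simp: generic_magnitude_symmetric_def)
  interpret signed_graph "adjacent (sparsity_graph N K)" "edge_sign (sparsity_charge K)" sg
    by (rule signed_graph_adjacent[OF simple_sparsity_graph sg])
  note adj = adjacent_sparsity_graph[OF ms]
  show ?thesis
  proof
    show "adjacent (sparsity_graph N K) x y \<longleftrightarrow> x \<in> {..<N} \<and> y \<in> {..<N} \<and> x \<noteq> y \<and> K $$ (x, y) \<noteq> 0" for x y
      using adj by simp
    show "K $$ (y, x) = edge_sign (sparsity_charge K) {x, y} * K $$ (x, y)" if "x \<in> {..<N}" "y \<in> {..<N}" for x y
    proof -
      have "K $$ (y, x) = K $$ (x, y) \<or> K $$ (y, x) = - K $$ (x, y)"
        using magnitude_symmetricD[OF ms, of x y] that by (simp add: abs_eq_iff)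
      moreover have "(sgn a < 0) = (a < 0)" for a :: real by (simp add: sgn_real_def)
      ultimately show ?thesis
        by (auto simp: edge_sign_def sparsity_charge_edge mult_less_0_iff)
    qed
  next
    fix i j l m assume d: "distinct [i, j, l, m]"
      and a: "adjacent (sparsity_graph N K) i j" "adjacent (sparsity_graph N K) j l"
        "adjacent (sparsity_graph N K) l m" "adjacent (sparsity_graph N K) m i"
    have prem: "i < N" "j < N" "l < N" "m < N"
      "distinct [i, j, l, m] \<and> K $$ (i,j) * K $$ (j,l) * K $$ (l,m) * K $$ (m,i) \<noteq> 0"
      using a d by (auto simp: adj)
    from gen[unfolded generic_entries_def, rule_format, OF prem]
    have "\<bar>K $$ (i,j) * K $$ (l,m)\<bar> \<noteq> \<bar>K $$ (j,l) * K $$ (m,i)\<bar>"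
      and sums: "\<And>p q r. p \<in> {-1,1} \<Longrightarrow> q \<in> {-1,1} \<Longrightarrow> r \<in> {-1,1} \<Longrightarrow>
        p * K $$ (i,j) * K $$ (j,l) * K $$ (l,m) * K $$ (m,i) +
        q * K $$ (i,j) * K $$ (j,m) * K $$ (m,l) * K $$ (l,i) +
        r * K $$ (i,l) * K $$ (l,j) * K $$ (j,m) * K $$ (m,i) \<noteq> 0" by blast+
    then show "\<bar>K $$ (i,j) * K $$ (l,m)\<bar> \<noteq> \<bar>K $$ (j,l) * K $$ (m,i)\<bar>" by simp
    show "K $$ (i,j) * K $$ (j,l) * K $$ (l,m) * K $$ (m,i) +
        K $$ (i,j) * K $$ (j,m) * K $$ (m,l) * K $$ (l,i) +
        K $$ (i,l) * K $$ (l,j) * K $$ (j,m) * K $$ (m,i) \<noteq> 0"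
      using sums[of 1 1 1] by simp
  qed
qed

text \<open>The minors of order one give the diagonal and those of order two the products \<open>K(i,j) * K(j,i)\<close>.
  By magnitude symmetry these give the magnitudes, and they force the sign changes at \<open>(i,j)\<close> and
  \<open>(j,i)\<close> to agree.\<close>

lemma minors_determine_magnitudes:
  assumes K: "K \<in> generic_magnitude_symmetric N" and K': "K' \<in> generic_magnitude_symmetric N"
    and minors: "\<And>S. S \<subseteq> {..<N} \<Longrightarrow> card S \<le> 2 \<Longrightarrow> principal_minor S K = principal_minor S K'"
  obtains sg :: "nat set \<Rightarrow> real" where "\<And>e. sg e * sg e = 1" "\<And>i. i < N \<Longrightarrow> sg {i} = 1"
    "\<And>i j. i < N \<Longrightarrow> j < N \<Longrightarrow> K' $$ (i, j) = sg {i, j} * K $$ (i, j)"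
proof -
  have car: "K \<in> carrier_mat N N" "K' \<in> carrier_mat N N"
    and ms: "magnitude_symmetric N K" "magnitude_symmetric N K'"
    using K K' by (auto simp: generic_magnitude_symmetric_def)
  have diag: "K' $$ (i, i) = K $$ (i, i)" if "i < N" for i
    using minors[of "{i}"] principal_minor_eq_perm_det[OF car(1), of "{i}"]
      principal_minor_eq_perm_det[OF car(2), of "{i}"] that by (simp add: perm_det_singleton)
  have prod: "K' $$ (i, j) * K' $$ (j, i) = K $$ (i, j) * K $$ (j, i)" if "i < N" "j < N" for i j
  proof (cases "i = j")
    case True
    then show ?thesis using diag that by simp
  next
    case False
    then show ?thesis
      using minors[of "{i, j}"] principal_minor_eq_perm_det[OF car(1), of "{i, j}"]
        principal_minor_eq_perm_det[OF car(2), of "{i, j}"] that diag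
      by (simp add: perm_det_doubleton)
  qed
  have abs: "\<bar>K' $$ (i, j)\<bar> = \<bar>K $$ (i, j)\<bar>" if "i < N" "j < N" for i j
  proof -
    have "\<bar>K' $$ (i, j)\<bar> * \<bar>K' $$ (j, i)\<bar> = \<bar>K $$ (i, j)\<bar> * \<bar>K $$ (j, i)\<bar>"
      using prod[OF that] by (simp only: abs_mult[symmetric])
    then have "\<bar>K' $$ (i, j)\<bar>\<^sup>2 = \<bar>K $$ (i, j)\<bar>\<^sup>2"
      using magnitude_symmetricD[OF ms(1) that] magnitude_symmetricD[OF ms(2) that]
      by (simp only: power2_eq_square)
    then show ?thesis by (rule power2_eq_imp_eq) auto
  qed
  \<comment> \<open>The entry above the diagonal decides; for a singleton this is the diagonal entry itself.\<close>
  define sg where "sg e = (if K' $$ (Min e, Max e) = K $$ (Min e, Max e) then 1 else -1 :: real)" for e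
  have upper: "K' $$ (i, j) = sg {i, j} * K $$ (i, j)" if "i < N" "j < N" "i \<le> j" for i j
    using abs[OF that(1,2)] that(3) by (auto simp: sg_def abs_eq_iff)
  have sq: "sg e * sg e = 1" for e by (simp add: sg_def)
  show ?thesis
  proof (rule that[of sg])
    show "sg e * sg e = 1" for e by (rule sq)
    show "sg {i} = 1" if "i < N" for i using diag[OF that] by (simp add: sg_def)
    show "K' $$ (i, j) = sg {i, j} * K $$ (i, j)" if "i < N" "j < N" for i j
    proof (cases "i \<le> j")
      case False
      then have up: "K' $$ (j, i) = sg {i, j} * K $$ (j, i)"
        using upper[of j i] that by (simp add: insert_commute)
      show ?thesis
      proof (cases "K $$ (j, i) = 0")
        case True
        then show ?thesis using abs[OF that] magnitude_symmetricD[OF ms(1) that] by auto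
      next
        case nz: False
        have "K' $$ (i, j) * sg {i, j} * K $$ (j, i) = K $$ (i, j) * K $$ (j, i)"
          using prod[OF that] up by (simp add: mult.assoc)
        then have "K' $$ (i, j) * sg {i, j} = K $$ (i, j)" using nz by simp
        then have "K' $$ (i, j) * (sg {i, j} * sg {i, j}) = sg {i, j} * K $$ (i, j)"
          by (metis mult.assoc mult.commute)
        then show ?thesis using sq by simp
      qed
    qed (use upper that in simp)
  qed
qed

lemma principal_minor_signed:
  assumes "K' \<in> carrier_mat N N" "S \<subseteq> {..<N}"
    and "\<And>i j. i < N \<Longrightarrow> j < N \<Longrightarrow> K' $$ (i, j) = sg {i, j} * K $$ (i, j)"
  shows "principal_minor S K' = perm_det (\<lambda>i j. sg {i, j} * K $$ (i, j)) S"
proof -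
  have "principal_minor S K' = perm_det (\<lambda>i j. K' $$ (i, j)) S"
    by (rule principal_minor_eq_perm_det[OF assms(1,2)])
  also have "\<dots> = perm_det (\<lambda>i j. sg {i, j} * K $$ (i, j)) S"
    using assms(2,3) by (intro perm_det_cong) auto
  finally show ?thesis .
qed

lemma signed_matrix_generic:
  assumes K: "K \<in> generic_magnitude_symmetric N" and sg: "\<And>e. sg e * sg e = 1"
  shows "mat N N (\<lambda>(i, j). sg {i, j} * K $$ (i, j)) \<in> generic_magnitude_symmetric N"
proof -
  let ?M = "mat N N (\<lambda>(i, j). sg {i, j} * K $$ (i, j))"
  have ms: "magnitude_symmetric N K" and gen: "generic_entries N K"
    using K by (auto simp: generic_magnitude_symmetric_def)
  have sgn: "sg e = 1 \<or> sg e = -1" for e using sg[of e] by (simp add: square_eq_1_iff)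
  have entry: "?M $$ (i, j) = sg {i, j} * K $$ (i, j)" if "i < N" "j < N" for i j using that by simp
  have abs: "\<bar>?M $$ (i, j)\<bar> = \<bar>K $$ (i, j)\<bar>" if "i < N" "j < N" for i j
    using sgn[of "{i, j}"] entry[OF that] by auto
  have "magnitude_symmetric N ?M" using ms abs by (auto simp: magnitude_symmetric_def)
  moreover have "generic_entries N ?M"
    unfolding generic_entries_def
  proof (intro allI impI)
    fix i j k l assume N: "i < N" "j < N" "k < N" "l < N"
      and nz: "distinct [i, j, k, l] \<and> ?M $$ (i,j) * ?M $$ (j,k) * ?M $$ (k,l) * ?M $$ (l,i) \<noteq> 0"
    then have nz': "distinct [i, j, k, l] \<and> K $$ (i,j) * K $$ (j,k) * K $$ (k,l) * K $$ (l,i) \<noteq> 0"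
      by (auto simp: entry)
    note g = gen[unfolded generic_entries_def, rule_format, OF N nz']
    have "\<bar>?M $$ (i,j) * ?M $$ (k,l)\<bar> \<noteq> \<bar>?M $$ (j,k) * ?M $$ (l,i)\<bar>"
      using conjunct1[OF g] N by (simp only: abs_mult abs not_False_eq_True)
    moreover have "\<forall>\<phi>1\<in>{-1,1}. \<forall>\<phi>2\<in>{-1,1}. \<forall>\<phi>3\<in>{-1,1}.
            \<phi>1 * ?M $$ (i,j) * ?M $$ (j,k) * ?M $$ (k,l) * ?M $$ (l,i)
          + \<phi>2 * ?M $$ (i,j) * ?M $$ (j,l) * ?M $$ (l,k) * ?M $$ (k,i)
          + \<phi>3 * ?M $$ (i,k) * ?M $$ (k,j) * ?M $$ (j,l) * ?M $$ (l,i) \<noteq> 0"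
    proof (intro ballI)
      fix p q r :: real assume pqr: "p \<in> {-1,1}" "q \<in> {-1,1}" "r \<in> {-1,1}"
      have five: "a * b * c * d * e \<in> {-1, 1}"
        if "a \<in> {-1,1}" "b = 1 \<or> b = -1" "c = 1 \<or> c = -1" "d = 1 \<or> d = -1" "e = 1 \<or> e = -1" for a b c d e :: real
        using that by auto
      have "p * sg {i,j} * sg {j,k} * sg {k,l} * sg {l,i} \<in> {-1,1}"
        "q * sg {i,j} * sg {j,l} * sg {l,k} * sg {k,i} \<in> {-1,1}"
        "r * sg {i,k} * sg {k,j} * sg {j,l} * sg {l,i} \<in> {-1,1}"
        using five[OF pqr(1) sgn sgn sgn sgn] five[OF pqr(2) sgn sgn sgn sgn] five[OF pqr(3) sgn sgn sgn sgn]
        by blast+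
      then have "(p * sg {i,j} * sg {j,k} * sg {k,l} * sg {l,i}) * K $$ (i,j) * K $$ (j,k) * K $$ (k,l) * K $$ (l,i)
          + (q * sg {i,j} * sg {j,l} * sg {l,k} * sg {k,i}) * K $$ (i,j) * K $$ (j,l) * K $$ (l,k) * K $$ (k,i)
          + (r * sg {i,k} * sg {k,j} * sg {j,l} * sg {l,i}) * K $$ (i,k) * K $$ (k,j) * K $$ (j,l) * K $$ (l,i) \<noteq> 0"
        using g by blast
      then show "p * ?M $$ (i,j) * ?M $$ (j,k) * ?M $$ (k,l) * ?M $$ (l,i)
          + q * ?M $$ (i,j) * ?M $$ (j,l) * ?M $$ (l,k) * ?M $$ (k,i)
          + r * ?M $$ (i,k) * ?M $$ (k,j) * ?M $$ (j,l) * ?M $$ (l,i) \<noteq> 0"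
        unfolding entry[OF N(1,2)] entry[OF N(2,3)] entry[OF N(3,4)] entry[OF N(4,1)] entry[OF N(2,4)]
          entry[OF N(4,3)] entry[OF N(3,1)] entry[OF N(1,3)] entry[OF N(3,2)]
        by (simp only: mult_ac not_False_eq_True)
    qed
    ultimately show "\<bar>?M $$ (i,j) * ?M $$ (k,l)\<bar> \<noteq> \<bar>?M $$ (j,k) * ?M $$ (l,i)\<bar> \<and>
        (\<forall>\<phi>1\<in>{-1,1}. \<forall>\<phi>2\<in>{-1,1}. \<forall>\<phi>3\<in>{-1,1}.
            \<phi>1 * ?M $$ (i,j) * ?M $$ (j,k) * ?M $$ (k,l) * ?M $$ (l,i)
          + \<phi>2 * ?M $$ (i,j) * ?M $$ (j,l) * ?M $$ (l,k) * ?M $$ (k,i)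
          + \<phi>3 * ?M $$ (i,k) * ?M $$ (k,j) * ?M $$ (j,l) * ?M $$ (l,i) \<noteq> 0)" by blast
  qed
  ultimately show ?thesis by (simp add: generic_magnitude_symmetric_def)
qed

locale charged_simple_graph =
  fixes G :: "'a graph" and \<epsilon> sg :: "'a set \<Rightarrow> real"
  assumes simple: "simple_graph G" and charged: "charged \<epsilon> G" and sg_sq: "\<And>e. sg e * sg e = 1"

sublocale charged_simple_graph \<subseteq> signed_graph "adjacent G" "edge_sign \<epsilon>" sg
  by (rule signed_graph_adjacent[OF simple sg_sq])

context charged_simple_graph
begin

lemma circuit_simple_cycle:
  assumes "circuit xs" "length xs \<ge> 3"
  shows "(set xs, cycle_edges xs) \<in> simple_cycles G" "charge \<epsilon> (set xs, cycle_edges xs) = cycle_eps xs"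
    "(\<Prod>e\<in>cycle_edges xs. sg e) = cycle_sig xs" "card (cycle_edges xs) = length xs"
proof -
  have cl: "closed_list G xs" using assms circuit_closed_list[OF simple] by simp
  then show "(set xs, cycle_edges xs) \<in> simple_cycles G" by (rule closed_list_simple_cycle[OF simple])
  have "edges (set xs, cycle_edges xs) \<subseteq> edges G" using closed_list_edges[OF cl] by simp
  moreover have d: "distinct xs" using assms by (simp add: circuit_def)
  ultimately show "charge \<epsilon> (set xs, cycle_edges xs) = cycle_eps xs"
    using charge_eq_edge_sign[OF charged, of "(set xs, cycle_edges xs)"] prod_cycle_edges[OF d assms(2)]
    by simp
  show "(\<Prod>e\<in>cycle_edges xs. sg e) = cycle_sig xs" by (rule prod_cycle_edges[OF d assms(2)])
  show "card (cycle_edges xs) = length xs" by (rule card_cycle_edges[OF d assms(2)])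
qed

lemma simple_cycle_circuit:
  assumes "C \<in> simple_cycles G"
  obtains xs where "circuit xs" "length xs \<ge> 3" "verts C = set xs" "edges C = cycle_edges xs"
    "charge \<epsilon> C = cycle_eps xs" "(\<Prod>e\<in>edges C. sg e) = cycle_sig xs" "card (edges C) = length xs"
proof -
  obtain xs where xs: "closed_list C xs" "verts C = set xs" "edges C = cycle_edges xs"
    using simple_cycle_closed_list[OF assms] by blast
  have "is_subgraph C G" using assms by (simp add: simple_cycles_def)
  then have cl: "closed_list G xs" using closed_list_subgraph xs(1) by blast
  then have len: "length xs \<ge> 3" by (simp add: closed_list_def)
  then have circ: "circuit xs" using cl circuit_closed_list[OF simple] by simp
  have "C = (set xs, cycle_edges xs)" using xs by (simp add: prod_eq_iff)
  then show ?thesis using that[OF circ len xs(2,3)] circuit_simple_cycle[OF circ len] xs(3) by simp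
qed

lemma simple_cycle_good:
  assumes "C \<in> simple_cycles G" "charge \<epsilon> C = 1" and "\<And>xs. bad xs \<Longrightarrow> card (edges C) < length xs"
  shows "(\<Prod>e\<in>edges C. sg e) = 1"
proof -
  obtain xs where xs: "circuit xs" "charge \<epsilon> C = cycle_eps xs" "(\<Prod>e\<in>edges C. sg e) = cycle_sig xs"
    "card (edges C) = length xs" using simple_cycle_circuit[OF assms(1)] by metis
  have "\<not> bad xs" using assms(3)[of xs] xs(4) by auto
  then show ?thesis using xs assms(2) cycle_sig_cases[of xs] by (auto simp: bad_def)
qed

lemma block_facts:
  assumes "H \<in> blocks G"
  shows "two_connected H" "simple_graph H" "charged \<epsilon> H" "is_subgraph H G"
  using assms charged by (auto simp: blocks_def is_subgraph_def charged_def)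

text \<open>A positive simple cycle lies in some block, where it is a sum of positive simple cycles that are
  short enough to be good.\<close>

lemma no_bad_if_no_short_bad:
  assumes short: "\<And>xs. bad xs \<Longrightarrow> simple_cycle_sparsity \<epsilon> G < length xs"
  shows "\<not> bad xs"
proof
  assume bad: "bad xs"
  then have circ: "circuit xs" by (simp add: bad_def)
  note len = bad_length[OF bad]
  let ?C = "(set xs, cycle_edges xs)"
  note C = circuit_simple_cycle[OF circ len]
  obtain H where H: "H \<in> blocks G" "?C \<in> simple_cycles H" "\<not> trivial_block H"
    using simple_cycle_has_block[OF simple C(1)] by blast
  note Hf = block_facts[OF H(1)]
  let ?X = "short_positive_simple_cycles \<epsilon> H (block_sparsity \<epsilon> H)"
  have le: "block_sparsity \<epsilon> H \<le> simple_cycle_sparsity \<epsilon> G"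
    using simple_cycle_sparsity_blocks(2)[OF simple _ H(1)] H(1) by blast
  have "(\<Prod>e\<in>edges ?C. sg e) = 1"
  proof (rule span_preserves_sign[where X = ?X and E = "edges H"])
    show "finite (edges H)" by (rule simple_graph_finite_edges[OF Hf(2)])
    show "edges D \<subseteq> edges H \<and> (\<Prod>e\<in>edges D. sg e) = 1" if "D \<in> ?X" for D
    proof
      have D: "D \<in> simple_cycles H" "charge \<epsilon> D = 1" "card (edges D) \<le> block_sparsity \<epsilon> H"
        using that by (auto simp: short_positive_simple_cycles_def)
      show "edges D \<subseteq> edges H" using D by (auto simp: simple_cycles_def is_subgraph_def)
      have "D \<in> simple_cycles G"
        using D(1) Hf(4) is_subgraph_trans[of D H G] by (auto simp: simple_cycles_def)
      then show "(\<Prod>e\<in>edges D. sg e) = 1"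
        using simple_cycle_good D(2,3) le short by (meson le_less_trans order_trans)
    qed
    have "charge \<epsilon> ?C = 1" using C(2) bad by (simp add: bad_def)
    then have "incidence_vector ?C \<in> positive_cycle_space \<epsilon> H"
      unfolding positive_cycle_space_def using simple_cycle_is_cycle[OF H(2)] by blast
    then show "incidence_vector ?C \<in> gf2.span (incidence_vector ` ?X)"
      using block_sparsity_spans[OF Hf(1,2) H(3) Hf(3)] by simp
    show "edges ?C \<subseteq> edges H" using H(2) by (auto simp: simple_cycles_def is_subgraph_def)
  qed (rule sg_sq)
  then show False using C(3) bad by (simp add: bad_def)
qed

end

text \<open>Choose a block that attains the sparsity, and in it a positive simple cycle of this length that
  is not in the span of the shorter ones. Extending a separating sign pattern by \<open>1\<close> outside the
  block creates no shorter bad cycle, since a simple cycle that meets the edges of the block lies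
  in it.\<close>

lemma sign_with_shortest_bad_of_sparsity:
  fixes G :: "'a graph"
  assumes G: "simple_graph G" "charged \<epsilon> G" and L: "simple_cycle_sparsity \<epsilon> G \<ge> 3"
  obtains sg xs where "charged_simple_graph G \<epsilon> sg" "\<And>e. e \<notin> edges G \<Longrightarrow> sg e = 1"
    "signed_graph.shortest_bad (adjacent G) (edge_sign \<epsilon>) sg xs" "length xs = simple_cycle_sparsity \<epsilon> G"
proof -
  let ?L = "simple_cycle_sparsity \<epsilon> G"
  have ne: "blocks G \<noteq> {}" using L by (auto simp: simple_cycle_sparsity_def split: if_splits)
  obtain H where H: "H \<in> blocks G" "?L = block_sparsity \<epsilon> H"
    using simple_cycle_sparsity_blocks(1)[OF G(1) ne] by blast
  have nt: "\<not> trivial_block H" using H(2) L by (auto simp: block_sparsity_def)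
  have Hf: "two_connected H" "simple_graph H" "charged \<epsilon> H" "is_subgraph H G"
    using H(1) G(2) by (auto simp: blocks_def is_subgraph_def charged_def)
  let ?X = "short_positive_simple_cycles \<epsilon> H (?L - 1)"
  have "?L > 0" using L by simp
  then obtain C where C: "C \<in> simple_cycles H" "charge \<epsilon> C = 1" "card (edges C) = ?L"
    "incidence_vector C \<notin> gf2.span (incidence_vector ` ?X)"
    using block_sparsity_witness[OF Hf(1,2) nt Hf(3) H(2)] by blast
  have fin: "finite (edges D)" if "D \<in> simple_cycles H" for D
    using that simple_graph_finite_edges[of D] by (auto simp: simple_cycles_def is_subgraph_def)
  have finX: "finite (edges D)" if "D \<in> ?X" for D
    using that fin by (simp add: short_positive_simple_cycles_def)
  obtain sg0 where sg0: "\<And>e. sg0 e * sg0 e = (1::real)" "\<And>D. D \<in> ?X \<Longrightarrow> (\<Prod>e\<in>edges D. sg0 e) = 1"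
      "(\<Prod>e\<in>edges C. sg0 e) = -1"
    using separating_sign[OF fin[OF C(1)] C(4) finX] by blast
  define sg where "sg e = (if e \<in> edges H then sg0 e else 1)" for e
  interpret charged_simple_graph G \<epsilon> sg
    by unfold_locales (use G sg0(1) in \<open>auto simp: sg_def\<close>)
  have sg_H: "(\<Prod>e\<in>edges D. sg e) = (\<Prod>e\<in>edges D. sg0 e)" if "edges D \<subseteq> edges H" for D :: "'a graph"
    using that by (intro prod.cong) (auto simp: sg_def)
  have edges_sub: "edges D \<subseteq> edges H" if "D \<in> simple_cycles H" for D
    using that by (auto simp: simple_cycles_def is_subgraph_def)
  have "C \<in> simple_cycles G"
    using C(1) Hf(4) is_subgraph_trans[of C H G] by (auto simp: simple_cycles_def)
  then obtain xs where xs: "circuit xs" "charge \<epsilon> C = cycle_eps xs" "(\<Prod>e\<in>edges C. sg e) = cycle_sig xs"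
      "card (edges C) = length xs" using simple_cycle_circuit by metis
  have badxs: "bad xs" using xs C(2) sg_H[OF edges_sub[OF C(1)]] sg0(3) by (simp add: bad_def)
  have "length xs \<le> length ys" if bad: "bad ys" for ys
  proof (rule ccontr)
    assume "\<not> length xs \<le> length ys"
    then have less: "length ys < ?L" using xs(4) C(3) by simp
    have circ: "circuit ys" using bad by (simp add: bad_def)
    note D = circuit_simple_cycle[OF circ bad_length[OF bad]]
    let ?D = "(set ys, cycle_edges ys)"
    have "(\<Prod>e\<in>edges ?D. sg e) = 1"
    proof (cases "edges ?D \<inter> edges H = {}")
      case True
      then show ?thesis by (intro prod.neutral) (auto simp: sg_def)
    next
      case False
      then have DH: "?D \<in> simple_cycles H" using simple_cycle_in_block[OF G(1) H(1) D(1)] by blast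
      have "?D \<in> ?X" using DH D(2,4) bad less by (auto simp: short_positive_simple_cycles_def bad_def)
      then show ?thesis using sg0(2)[of ?D] sg_H[OF edges_sub[OF DH]] by simp
    qed
    then show False using D(3) bad by (simp add: bad_def)
  qed
  then have "shortest_bad xs" using badxs by (simp add: shortest_bad_def)
  moreover have "sg e = 1" if "e \<notin> edges G" for e
    using that Hf(4) by (auto simp: sg_def is_subgraph_def)
  ultimately show ?thesis using that[of sg xs] charged_simple_graph_axioms xs(4) C(3) by simp
qed

theorem theorem1:
  fixes N :: nat and K :: "real mat" and L :: nat
  assumes "K \<in> generic_magnitude_symmetric N"
    and "L = simple_cycle_sparsity (sparsity_charge K) (sparsity_graph N K)"
    and "L \<ge> 3"
  shows "(\<forall>K' \<in> generic_magnitude_symmetric N.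
            (\<forall>S \<subseteq> {..<N}. card S \<le> L \<longrightarrow> principal_minor S K = principal_minor S K') \<longrightarrow>
            (\<forall>S \<subseteq> {..<N}. principal_minor S K = principal_minor S K')) \<and>
         (\<exists>K_hat \<in> generic_magnitude_symmetric N.
            (\<forall>S \<subseteq> {..<N}. card S < L \<longrightarrow> principal_minor S K_hat = principal_minor S K) \<and>
            (\<exists>S \<subseteq> {..<N}. card S = L \<and> principal_minor S K_hat \<noteq> principal_minor S K))"
proof -
  let ?G = "sparsity_graph N K" and ?\<epsilon> = "sparsity_charge K"
  have car: "K \<in> carrier_mat N N" and ms: "magnitude_symmetric N K"
    using assms(1) by (auto simp: generic_magnitude_symmetric_def)
  note G = simple_sparsity_graph[of N K] charged_sparsity_graph[OF ms]
  have minor_K: "principal_minor S K = perm_det (\<lambda>i j. K $$ (i, j)) S" if "S \<subseteq> {..<N}" for S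
    by (rule principal_minor_eq_perm_det[OF car that])
  have part1: "principal_minor S K = principal_minor S K'"
    if K': "K' \<in> generic_magnitude_symmetric N"
      and eq: "\<forall>S \<subseteq> {..<N}. card S \<le> L \<longrightarrow> principal_minor S K = principal_minor S K'"
      and S: "S \<subseteq> {..<N}" for K' S
  proof -
    have car': "K' \<in> carrier_mat N N" using K' by (simp add: generic_magnitude_symmetric_def)
    have eq2: "principal_minor S K = principal_minor S K'" if "S \<subseteq> {..<N}" "card S \<le> 2" for S
      using eq that assms(3) by simp
    obtain sg where sg: "\<And>e. sg e * sg e = (1::real)" "\<And>i. i < N \<Longrightarrow> sg {i} = 1"
        "\<And>i j. i < N \<Longrightarrow> j < N \<Longrightarrow> K' $$ (i, j) = sg {i, j} * K $$ (i, j)"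
      using minors_determine_magnitudes[OF assms(1) K' eq2] by blast
    interpret generic_weights "adjacent ?G" "edge_sign ?\<epsilon>" sg "{..<N}" "\<lambda>i j. K $$ (i, j)"
      by (rule sparsity_generic_weights[OF assms(1) sg(1)])
    interpret C: charged_simple_graph ?G ?\<epsilon> sg
      by unfold_locales (use G sg(1) in auto)
    have minor_K': "principal_minor S K' = perm_det (\<lambda>i j. sg {i, j} * K $$ (i, j)) S" if "S \<subseteq> {..<N}" for S
      by (rule principal_minor_signed[OF car' that sg(3)])
    have "L < length xs" if "bad xs" for xs
    proof (rule ccontr)
      assume "\<not> L < length xs"
      obtain C where C: "bad C" "\<And>ys. bad ys \<Longrightarrow> length C \<le> length ys"
        using ex_has_least_nat[of bad xs length] \<open>bad xs\<close> by blast
      then have short: "shortest_bad C" by (simp add: shortest_bad_def)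
      have circ: "circuit C" using C by (simp add: bad_def)
      have "set C \<subseteq> {..<N}" by (rule circuit_vertices[OF circ])
      moreover have "card (set C) \<le> L"
        using C(2)[OF \<open>bad xs\<close>] circuit_card[OF circ] \<open>\<not> L < length xs\<close> by simp
      moreover have "perm_det (\<lambda>i j. sg {i, j} * K $$ (i, j)) (set C) \<noteq> perm_det (\<lambda>i j. K $$ (i, j)) (set C)"
        by (rule bad_circuit_changes_minor[OF _ _ short]) (use sg(2) in auto)
      ultimately show False using eq minor_K[of "set C"] minor_K'[of "set C"] by auto
    qed
    then have none: "\<not> bad xs" for xs using C.no_bad_if_no_short_bad assms(2) by blast
    have "finite S" using S finite_subset by blast
    then have "perm_det (\<lambda>i j. sg {i, j} * K $$ (i, j)) S = perm_det (\<lambda>i j. K $$ (i, j)) S"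
      by (rule perm_det_eq_if_no_bad[OF _ S]) (use sg(2) none in auto)
    then show ?thesis using minor_K[OF S] minor_K'[OF S] by simp
  qed
  have part2: "\<exists>K_hat \<in> generic_magnitude_symmetric N.
            (\<forall>S \<subseteq> {..<N}. card S < L \<longrightarrow> principal_minor S K_hat = principal_minor S K) \<and>
            (\<exists>S \<subseteq> {..<N}. card S = L \<and> principal_minor S K_hat \<noteq> principal_minor S K)"
  proof -
    obtain sg xs where cs: "charged_simple_graph ?G ?\<epsilon> sg" and off: "\<And>e. e \<notin> edges ?G \<Longrightarrow> sg e = 1"
      and short: "signed_graph.shortest_bad (adjacent ?G) (edge_sign ?\<epsilon>) sg xs" and len: "length xs = L"
      using sign_with_shortest_bad_of_sparsity[OF G] assms(2,3) by metis
    have sg_sq: "sg e * sg e = 1" for e by (rule charged_simple_graph.sg_sq[OF cs])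
    interpret generic_weights "adjacent ?G" "edge_sign ?\<epsilon>" sg "{..<N}" "\<lambda>i j. K $$ (i, j)"
      by (rule sparsity_generic_weights[OF assms(1) sg_sq])
    have sg1: "sg {i} = 1" for i
    proof (rule off)
      show "{i} \<notin> edges ?G" using G(1) by (force simp: simple_graph_def)
    qed
    define K_hat where "K_hat = mat N N (\<lambda>(i, j). sg {i, j} * K $$ (i, j))"
    have hat: "K_hat \<in> generic_magnitude_symmetric N"
      unfolding K_hat_def by (rule signed_matrix_generic[OF assms(1) sg_sq])
    have car': "K_hat \<in> carrier_mat N N" by (simp add: K_hat_def)
    have minor_hat: "principal_minor S K_hat = perm_det (\<lambda>i j. sg {i, j} * K $$ (i, j)) S" if "S \<subseteq> {..<N}" for S
      by (rule principal_minor_signed[OF car' that]) (simp add: K_hat_def)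
    have "principal_minor S K_hat = principal_minor S K" if S: "S \<subseteq> {..<N}" "card S < L" for S
    proof -
      have fin: "finite S" using S(1) finite_subset by blast
      have none: "False" if "bad ys" "set ys \<subseteq> S" for ys
      proof -
        have "length ys \<le> card S"
          using circuit_card[of ys] that card_mono[OF fin that(2)] by (simp add: bad_def)
        moreover have "L \<le> length ys" using short that(1) len by (simp add: shortest_bad_def)
        ultimately show False using S(2) by simp
      qed
      have "perm_det (\<lambda>i j. sg {i, j} * K $$ (i, j)) S = perm_det (\<lambda>i j. K $$ (i, j)) S"
        by (rule perm_det_eq_if_no_bad[OF fin S(1) sg1 none])
      then show ?thesis using minor_K[OF S(1)] minor_hat[OF S(1)] by simp
    qed
    moreover have "\<exists>S \<subseteq> {..<N}. card S = L \<and> principal_minor S K_hat \<noteq> principal_minor S K"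
    proof (intro exI[of _ "set xs"] conjI)
      have circ: "circuit xs" using shortest_badD[OF short] by (simp add: bad_def)
      show sub: "set xs \<subseteq> {..<N}" by (rule circuit_vertices[OF circ])
      show "card (set xs) = L" using circuit_card[OF circ] len by simp
      have "perm_det (\<lambda>i j. sg {i, j} * K $$ (i, j)) (set xs) \<noteq> perm_det (\<lambda>i j. K $$ (i, j)) (set xs)"
        by (rule bad_circuit_changes_minor[OF _ _ short]) (use sg1 in auto)
      then show "principal_minor (set xs) K_hat \<noteq> principal_minor (set xs) K"
        using minor_K[OF sub] minor_hat[OF sub] by simp
    qed
    ultimately show ?thesis using hat by blast
  qed
  show ?thesis using part1 part2 by blast
qed

end
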